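(* There is an absolute constant $c\ge1$ such that the following holds. Let $\mathcal{P}$ be a graph property and let $q:(0,1)\to\mathbb{N}$ be such that for every $\varepsilon\in(0,1)$ there is an $\varepsilon$-tester for $\mathcal{P}$ making at most $q(\varepsilon)$ queries. Then for every $\varepsilon\in(0,1)$ there is a randomized algorithm which, given any real $\alpha$ and edge-query access to any graph $G$, makes at most $2^{(1/\varepsilon)^{c}\cdot 2^{q(\varepsilon/2)^{c}}}$ queries and with probability at least $2/3$ outputs "close" if $G$ is $(\alpha-\varepsilon)$-close to $\mathcal{P}$ and outputs "far" if $G$ is $\alpha$-far from $\mathcal{P}$.
   Context: Graphs are finite and simple; a graph property is a family of graphs closed under isomorphism. A graph $G$ on $n$ vertices is $\beta$-far from $\mathcal{P}$ if one must add/delete at least $\beta n^2$ edges to obtain a graph in $\mathcal{P}$, and $\beta$-close otherwise. An edge query asks whether a given pair of vertices of $G$ is an edge (the number of vertices is known to the algorithm). An $\varepsilon$-tester for $\mathcal{P}$ is a randomized algorithm that, given edge-query access to any graph $G$, accepts with probability at least $2/3$ if $G\in\mathcal{P}$ and rejects with probability at least $2/3$ if $G$ is $\varepsilon$-far from $\mathcal{P}$; its query complexity is the maximum number of queries it makes over all inputs. *)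

theory Defs
  imports "HOL-Probability.Probability_Mass_Function"
begin

text \<open>A graph on n vertices is represented on the vertex set {..<n}; its edges are two-element
  sets of vertices.  The graph without vertices is excluded: for n = 0 the bound
  \<beta> n^2 is 0, so that graph would be \<beta>-far from every property containing it.\<close>

record sgraph =
  nverts :: nat
  edges :: "nat set set"

definition simple_graph :: "sgraph \<Rightarrow> bool" where
  "simple_graph G \<longleftrightarrow> nverts G \<ge> 1 \<and> edges G \<subseteq> {e. e \<subseteq> {..<nverts G} \<and> card e = 2}"

definition isomorphic :: "sgraph \<Rightarrow> sgraph \<Rightarrow> bool" where
  "isomorphic G H \<longleftrightarrow>
    (\<exists>\<pi>. bij_betw \<pi> {..<nverts G} {..<nverts H} \<and>
      (\<forall>u<nverts G. \<forall>v<nverts G. {u, v} \<in> edges G \<longleftrightarrow> {\<pi> u, \<pi> v} \<in> edges H))"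

definition graph_property :: "sgraph set \<Rightarrow> bool" where
  "graph_property P \<longleftrightarrow>
    (\<forall>G\<in>P. simple_graph G) \<and>
    (\<forall>G\<in>P. \<forall>H. simple_graph H \<and> isomorphic G H \<longrightarrow> H \<in> P)"

definition edit_distance :: "sgraph \<Rightarrow> sgraph \<Rightarrow> nat" where
  "edit_distance G H = card ((edges G - edges H) \<union> (edges H - edges G))"

text \<open>If the property contains no graph with as many vertices as G, then G is \<beta>-far
  from it for every \<beta>.\<close>

definition far_from :: "real \<Rightarrow> sgraph set \<Rightarrow> sgraph \<Rightarrow> bool" where
  "far_from \<beta> P G \<longleftrightarrow>
    (\<forall>H\<in>P. nverts H = nverts G \<longrightarrow> real (edit_distance G H) \<ge> \<beta> * (real (nverts G))\<^sup>2)"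

definition close_to :: "real \<Rightarrow> sgraph set \<Rightarrow> sgraph \<Rightarrow> bool" where
  "close_to \<beta> P G \<longleftrightarrow> \<not> far_from \<beta> P G"

text \<open>A deterministic adaptive query algorithm on graphs with a fixed number of vertices is a
  decision tree; \<open>Query u v s t\<close> asks for the pair u, v and continues with s if it is an
  edge and with t otherwise.\<close>

datatype 'r qtree = Output 'r | Query nat nat "'r qtree" "'r qtree"

primrec result :: "sgraph \<Rightarrow> 'r qtree \<Rightarrow> 'r" where
  "result G (Output r) = r"
| "result G (Query u v s t) = (if {u, v} \<in> edges G then result G s else result G t)"

primrec queries :: "sgraph \<Rightarrow> 'r qtree \<Rightarrow> (nat \<times> nat) list" where
  "queries G (Output r) = []"
| "queries G (Query u v s t) =
    (u, v) # (if {u, v} \<in> edges G then queries G s else queries G t)"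

text \<open>A randomized algorithm knows the number n of vertices and draws a decision tree at random
  from a distribution depending on n.  Discrete distributions suffice, since decision trees over
  a countable set of outputs form a countable set.  As usual for query complexity, no
  computability or uniformity in n is demanded.\<close>

type_synonym 'r algorithm = "nat \<Rightarrow> 'r qtree pmf"

definition prob_output :: "'r algorithm \<Rightarrow> sgraph \<Rightarrow> 'r \<Rightarrow> real" where
  "prob_output A G r = measure_pmf.prob (A (nverts G)) {t. result G t = r}"

definition makes_at_most_queries :: "'r algorithm \<Rightarrow> real \<Rightarrow> bool" where
  "makes_at_most_queries A b \<longleftrightarrow>
    (\<forall>G. simple_graph G \<longrightarrow> (\<forall>t\<in>set_pmf (A (nverts G)).
      (\<forall>(u, v)\<in>set (queries G t). u < nverts G \<and> v < nverts G \<and> u \<noteq> v) \<and>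
      real (length (queries G t)) \<le> b))"

datatype decision = Accept | Reject

definition tester :: "real \<Rightarrow> sgraph set \<Rightarrow> decision algorithm \<Rightarrow> bool" where
  "tester \<epsilon> P A \<longleftrightarrow>
    (\<forall>G. simple_graph G \<longrightarrow>
      (G \<in> P \<longrightarrow> prob_output A G Accept \<ge> 2/3) \<and>
      (far_from \<epsilon> P G \<longrightarrow> prob_output A G Reject \<ge> 2/3))"

datatype verdict = Close | Far

definition distinguishes :: "real \<Rightarrow> real \<Rightarrow> sgraph set \<Rightarrow> verdict algorithm \<Rightarrow> bool" where
  "distinguishes \<alpha> \<epsilon> P A \<longleftrightarrow>
    (\<forall>G. simple_graph G \<longrightarrow>
      (close_to (\<alpha> - \<epsilon>) P G \<longrightarrow> prob_output A G Close \<ge> 2/3) \<and>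
      (far_from \<alpha> P G \<longrightarrow> prob_output A G Far \<ge> 2/3))"

end

theory Submission
  imports Defs "HOL-Library.FuncSet" "HOL-Combinatorics.Permutations"
begin

text \<open>If G is \<open>(\<alpha> - \<epsilon>)\<close>-close to the property, some G' in it is near G and is accepted by the
  \<open>\<epsilon>/2\<close>-tester; conversely any K near G that the tester does not reject is \<open>\<epsilon>/2\<close>-close to the
  property.  So it suffices to search for such a K among few structured graphs.  Averaging over
  vertex relabellings turns the acceptance probability into a pattern density.  A weak regular
  partition of G' relative to G (edge densities are taken separately over the edges and the
  non-edges of G) replaces G' by a vertex colouring and a table without changing the distance to G
  and almost without changing the pattern density.  The colouring is then replaced block by block,
  as in the partition algorithm of Goldreich, Goldwasser and Ron: a vertex receives the colour that
  maximises a gradient estimated from random samples, and that estimate depends only on the block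
  of the vertex and on its G-neighbours in the sample.  Rounding the table yields a graph in which
  the adjacency of u and v is a function of their classes and of their adjacency in G.  There are
  few enough such functions to estimate density and distance of all of them at once on one fresh
  sample, by Hoeffding's inequality and a union bound.\<close>

section \<open>Averages over finite sets\<close>

text \<open>The obstacle is that the regular partition of \<open>G'\<close> belongs to an unknown
  graph, so no sample reveals it. The recolouring removes this without being computed: it starts
  from the unknown colouring and follows an unknown table, and all that matters is that the final
  colour is some function of the vertex class, which queries do reveal. The algorithm then needs
  nothing about \<open>G'\<close> and checks every table on the classes.

  The distance enters as a squared penalty, written as a product over two disjoint pairs of sampled
  vertices, so that one sample average controls density and distance. Ignoring samples with two
  vertices in a block makes it linear in each block and affine in each table entry.

  All parameters are powers of an integer \<open>R\<close> of order \<open>2^q / \<epsilon>\<close>.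
  There are at most \<open>2^W\<close> tables, where \<open>W\<close> is exponential in a power of
  \<open>R\<close>, and the union bound needs a number of samples linear in \<open>W\<close>; hence
  the double exponential in \<open>q\<close>.

  The case \<open>\<epsilon> \<ge> 1/2\<close> is separate because for \<open>q = 0\<close> and
  \<open>\<epsilon>\<close> near 1 the allowed number of queries is close to 2, and no constant can
  be absorbed.\<close>

definition avg :: "'a set \<Rightarrow> ('a \<Rightarrow> real) \<Rightarrow> real" where
  "avg S f = (\<Sum>x\<in>S. f x) / real (card S)"

text \<open>Extensional functions keep the set finite. Iterating the construction gives sample
  spaces such as \<open>tuples N (tuples m (tuples k V))\<close>; the average over one of them
  stands for independent sampling with replacement.\<close>

definition tuples :: "nat \<Rightarrow> 'a set \<Rightarrow> (nat \<Rightarrow> 'a) set" where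
  "tuples k S = PiE {..<k} (\<lambda>_. S)"

lemma finite_tuples [simp]: "finite S \<Longrightarrow> finite (tuples k S)"
  by (simp add: tuples_def finite_PiE)

lemma tuples_empty_iff [simp]: "tuples k S = {} \<longleftrightarrow> k \<noteq> 0 \<and> S = {}"
  by (auto simp: tuples_def PiE_eq_empty_iff)

lemma tuples_mem: "x \<in> tuples k S \<Longrightarrow> i < k \<Longrightarrow> x i \<in> S"
  by (auto simp: tuples_def)

lemma tuples_upd: "x \<in> tuples k S \<Longrightarrow> i < k \<Longrightarrow> s \<in> S \<Longrightarrow> x(i := s) \<in> tuples k S"
  by (auto simp: tuples_def PiE_iff extensional_def)

lemma card_tuples: "card (tuples k S) = card S ^ k"
  by (simp add: tuples_def card_PiE)

lemma avg_mono: "(\<And>x. x \<in> S \<Longrightarrow> f x \<le> g x) \<Longrightarrow> avg S f \<le> avg S g"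
  by (auto simp: avg_def intro!: divide_right_mono sum_mono)

lemma avg_cong: "(\<And>x. x \<in> S \<Longrightarrow> f x = g x) \<Longrightarrow> avg S f = avg S g"
  by (simp add: avg_def)

lemma avg_const: "finite S \<Longrightarrow> S \<noteq> {} \<Longrightarrow> avg S (\<lambda>_. c) = c"
  by (simp add: avg_def)

lemma avg_add: "avg S (\<lambda>x. f x + g x) = avg S f + avg S g"
  by (simp add: avg_def sum.distrib add_divide_distrib)

lemma avg_diff: "avg S (\<lambda>x. f x - g x) = avg S f - avg S g"
  by (simp add: avg_def sum_subtractf diff_divide_distrib)

lemma avg_cmult: "avg S (\<lambda>x. c * f x) = c * avg S f"
  by (simp add: avg_def sum_distrib_left)

lemma avg_multc: "avg S (\<lambda>x. f x * c) = avg S f * c"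
  by (simp add: avg_def sum_distrib_right)

lemma avg_sum: "avg S (\<lambda>x. \<Sum>i\<in>I. f i x) = (\<Sum>i\<in>I. avg S (f i))"
  unfolding avg_def by (subst sum.swap) (simp add: sum_divide_distrib)

lemma avg_swap: "avg S (\<lambda>x. avg T (f x)) = avg T (\<lambda>y. avg S (\<lambda>x. f x y))"
  unfolding avg_def
  by (simp add: sum_divide_distrib [symmetric] mult.commute) (metis sum.swap)

lemma avg_nonneg: "(\<And>x. x \<in> S \<Longrightarrow> 0 \<le> f x) \<Longrightarrow> 0 \<le> avg S f"
  by (auto simp: avg_def intro!: divide_nonneg_nonneg sum_nonneg)

lemma avg_upper:
  assumes "finite S" "S \<noteq> {}" "\<And>x. x \<in> S \<Longrightarrow> f x \<le> c"
  shows "avg S f \<le> c"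
  using avg_mono[of S f "\<lambda>_. c"] assms by (simp add: avg_const)

lemma avg_lower:
  assumes "finite S" "S \<noteq> {}" "\<And>x. x \<in> S \<Longrightarrow> c \<le> f x"
  shows "c \<le> avg S f"
  using avg_mono[of S "\<lambda>_. c" f] assms by (simp add: avg_const)

lemma abs_avg_le: "\<bar>avg S f\<bar> \<le> avg S (\<lambda>x. \<bar>f x\<bar>)"
  by (auto simp: avg_def abs_divide intro!: divide_right_mono sum_abs)

lemma abs_avg_upper:
  assumes "finite S" "S \<noteq> {}" "\<And>x. x \<in> S \<Longrightarrow> \<bar>f x\<bar> \<le> c"
  shows "\<bar>avg S f\<bar> \<le> c"
  using assms by (intro order_trans[OF abs_avg_le avg_upper])

lemma avg_reindex: "bij_betw h S S \<Longrightarrow> avg S (\<lambda>x. f (h x)) = avg S f"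
  unfolding avg_def by (simp add: sum.reindex_bij_betw)

lemma avg_Times: "avg (S \<times> T) (\<lambda>z. f (fst z) (snd z)) = avg S (\<lambda>x. avg T (f x))"
  by (simp add: avg_def sum.cartesian_product' card_cartesian_product
      sum_divide_distrib [symmetric] case_prod_beta mult.commute)

lemma avg_card: "finite S \<Longrightarrow> avg S (\<lambda>x. of_bool (P x)) = card {x\<in>S. P x} / card S"
  by (simp add: avg_def sum.If_cases of_bool_def Int_def)

lemma Markov_avg:
  assumes "\<And>x. x \<in> S \<Longrightarrow> 0 \<le> f x" "c > 0"
  shows "avg S (\<lambda>x. of_bool (f x \<ge> c)) \<le> avg S f / c"
proof -
  have "avg S (\<lambda>x. of_bool (f x \<ge> c)) \<le> avg S (\<lambda>x. f x * (1 / c))"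
    using assms by (intro avg_mono) (auto simp: field_simps)
  then show ?thesis by (simp only: avg_multc) simp
qed

text \<open>The map from \<open>(x, s)\<close> to \<open>(x(a := s), x a)\<close> is an involution
  of \<open>tuples k S \<times> S\<close>: replacing one coordinate by a fresh element does not
  change the distribution. Most later uses of independence are instances of this.\<close>

lemma avg_resample:
  assumes "finite S" "S \<noteq> {}" "a < k"
  shows "avg (tuples k S) f = avg (tuples k S) (\<lambda>x. avg S (\<lambda>s. f (x(a := s))))"
proof -
  have "(\<Sum>(x, s)\<in>tuples k S \<times> S. f (x(a := s))) = (\<Sum>(x, s)\<in>tuples k S \<times> S. f x)"
    by (rule sum.reindex_bij_witness[where i = "\<lambda>(x, s). (x(a := s), x a)"
          and j = "\<lambda>(x, s). (x(a := s), x a)"])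
       (use assms in \<open>auto simp: tuples_upd tuples_mem\<close>)
  then have "(\<Sum>x\<in>tuples k S. \<Sum>s\<in>S. f (x(a := s))) = (\<Sum>x\<in>tuples k S. f x) * real (card S)"
    by (simp add: sum.cartesian_product [symmetric] mult.commute sum_distrib_left)
  then show ?thesis
    using assms by (simp add: avg_def sum_divide_distrib [symmetric])
qed

lemma avg_coord:
  assumes "finite S" "S \<noteq> {}" "a < k"
  shows "avg (tuples k S) (\<lambda>x. f (x a)) = avg S f"
  using assms by (subst avg_resample[of S a]) (auto simp: avg_const)

lemma avg_coord2:
  assumes "finite S" "S \<noteq> {}" "a < k" "b < k" "a \<noteq> b"
  shows "avg (tuples k S) (\<lambda>x. f (x a) (x b)) = avg S (\<lambda>u. avg S (f u))"
proof -
  have "avg (tuples k S) (\<lambda>x. f (x a) (x b))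
      = avg (tuples k S) (\<lambda>x. avg S (\<lambda>s. f s (x b)))"
    using assms by (subst avg_resample[of S a]) auto
  also have "\<dots> = avg S (\<lambda>v. avg S (\<lambda>s. f s v))"
    using assms by (intro avg_coord[where f="\<lambda>v. avg S (\<lambda>s. f s v)"]) auto
  also have "\<dots> = avg S (\<lambda>u. avg S (f u))" by (rule avg_swap)
  finally show ?thesis .
qed

lemma avg_tuples_prod:
  assumes "finite S"
  shows "avg (tuples m S) (\<lambda>x. \<Prod>j<m. h (x j)) = avg S h ^ m"
  using assms prod_sum_PiE[of "{..<m}" "\<lambda>_. S" "\<lambda>_. h"]
  by (simp add: avg_def card_tuples power_divide) (simp add: tuples_def)

text \<open>Birthday bound, by a union over the pairs of positions. It is used with the identity for
  coinciding vertices and with the block map for two vertices in one block.\<close>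

lemma avg_not_inj_le:
  assumes "finite S" "S \<noteq> {}" "\<rho> \<ge> 0"
    and fib: "\<And>z. real (card {v\<in>S. h v = z}) \<le> \<rho> * real (card S)"
  shows "avg (tuples k S) (\<lambda>x. of_bool (\<not> inj_on (\<lambda>a. h (x a)) {..<k})) \<le> real (k\<^sup>2) * \<rho>"
proof -
  let ?D = "{p\<in>{..<k} \<times> {..<k}. fst p \<noteq> snd p}"
  have fin: "finite ?D" by auto
  have "avg (tuples k S) (\<lambda>x. of_bool (\<not> inj_on (\<lambda>a. h (x a)) {..<k}))
     \<le> avg (tuples k S) (\<lambda>x. \<Sum>p\<in>?D. of_bool (h (x (fst p)) = h (x (snd p))))"
  proof (rule avg_mono)
    fix x
    show "of_bool (\<not> inj_on (\<lambda>a. h (x a)) {..<k})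
        \<le> (\<Sum>p\<in>?D. of_bool (h (x (fst p)) = h (x (snd p))) :: real)"
    proof (cases "inj_on (\<lambda>a. h (x a)) {..<k}")
      case False
      then obtain a b where ab: "a < k" "b < k" "a \<noteq> b" "h (x a) = h (x b)"
        by (auto simp: inj_on_def)
      then have "(1::real) = of_bool (h (x (fst (a,b))) = h (x (snd (a,b))))" by simp
      also have "\<dots> \<le> (\<Sum>p\<in>?D. of_bool (h (x (fst p)) = h (x (snd p))))"
        using ab by (intro member_le_sum) auto
      finally show ?thesis using False by simp
    qed (simp add: sum_nonneg)
  qed
  also have "\<dots> = (\<Sum>p\<in>?D. avg (tuples k S) (\<lambda>x. of_bool (h (x (fst p)) = h (x (snd p)))))"
    by (rule avg_sum)
  also have "\<dots> \<le> (\<Sum>p\<in>?D. \<rho>)"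
  proof (rule sum_mono)
    fix p assume "p \<in> ?D"
    then have "avg (tuples k S) (\<lambda>x. of_bool (h (x (fst p)) = h (x (snd p))))
        = avg S (\<lambda>u. avg S (\<lambda>v. of_bool (h u = h v)))"
      using assms by (intro avg_coord2[where f="\<lambda>u v. of_bool (h u = h v)"]) auto
    also have "\<dots> \<le> \<rho>"
    proof (rule avg_upper)
      fix u
      have "card S > 0" using assms by (simp add: card_gt_0_iff)
      moreover have "{v\<in>S. h u = h v} = {v\<in>S. h v = h u}" by auto
      ultimately show "avg S (\<lambda>v. of_bool (h u = h v)) \<le> \<rho>"
        using assms fib[of "h u"] by (simp add: avg_card field_simps)
    qed (use assms in auto)
    finally show "avg (tuples k S) (\<lambda>x. of_bool (h (x (fst p)) = h (x (snd p)))) \<le> \<rho>" .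
  qed
  also have "\<dots> \<le> real (k\<^sup>2) * \<rho>"
  proof -
    have "card ?D \<le> card ({..<k} \<times> {..<k})" by (intro card_mono) auto
    then have "real (card ?D) \<le> real (k\<^sup>2)"
      by (simp only: of_nat_le_iff) (simp add: power2_eq_square card_cartesian_product)
    then show ?thesis using assms(3) by (simp add: mult_right_mono)
  qed
  finally show ?thesis .
qed

section \<open>Hoeffding's inequality for uniform samples\<close>

lemma exp_le_quadratic:
  fixes y :: real
  assumes "\<bar>y\<bar> \<le> 1"
  shows "exp y \<le> 1 + y + y\<^sup>2"
proof (cases "y \<ge> 0")
  case True
  then show ?thesis using exp_bound[of y] assms by simp
next
  case False
  \<comment> \<open>For negative \<open>y\<close> the reciprocal is bounded:
    \<open>(1 - z + z^2) * (1 + z) = 1 + z^3 \<ge> 1\<close> and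
    \<open>1 + z \<le> exp z\<close>.\<close>
  define z where "z = -y"
  have z: "0 < z" "z \<le> 1" using False assms by (auto simp: z_def)
  have "(1 - z + z\<^sup>2) * (1 + z) = 1 + z ^ 3" by (simp add: algebra_simps power3_eq_cube power2_eq_square)
  also have "\<dots> \<ge> 1" using z by simp
  finally have *: "1 \<le> (1 - z + z\<^sup>2) * (1 + z)" .
  have "1 - z + z\<^sup>2 = (1 - z / 2)\<^sup>2 + 3 / 4 * z\<^sup>2" by (simp add: power2_eq_square algebra_simps)
  then have pos: "1 - z + z\<^sup>2 \<ge> 0" by (metis add_nonneg_nonneg mult_nonneg_nonneg zero_le_power2 zero_le_divide_iff zero_le_numeral)
  have "1 \<le> (1 - z + z\<^sup>2) * exp z"
    using * mult_left_mono[OF exp_ge_add_one_self[of z] pos] by linarith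
  then have "exp (-z) \<le> 1 - z + z\<^sup>2"
    by (simp add: exp_minus field_simps)
  then show ?thesis by (simp add: z_def)
qed

text \<open>Exponential moment method. The bound \<open>2 * B\<close> is that of a function bounded
  by \<open>B\<close> after centring. The quadratic estimate of \<open>exp\<close> in place of a
  sharper one affects only the constant 16.\<close>

lemma Hoeffding_upper:
  fixes h :: "'a \<Rightarrow> real"
  assumes S: "finite S" "S \<noteq> {}" and hB: "\<And>s. s \<in> S \<Longrightarrow> \<bar>h s\<bar> \<le> 2 * B" and B: "B > 0"
    and h0: "avg S h = 0" and \<gamma>: "0 < \<gamma>" "\<gamma> \<le> 2 * B"
  shows "avg (tuples m S) (\<lambda>x. of_bool (real m * \<gamma> \<le> (\<Sum>j<m. h (x j))))
     \<le> exp (- (real m * \<gamma>\<^sup>2 / (16 * B\<^sup>2)))"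
proof -
  \<comment> \<open>The minimiser of \<open>4 * B^2 * t^2 - t * \<gamma>\<close>. The assumption
    \<open>\<gamma> \<le> 2 * B\<close> keeps \<open>t * h s\<close> in the interval where the
    quadratic estimate applies.\<close>
  define t where "t = \<gamma> / (8 * B\<^sup>2)"
  have t: "t > 0" using \<gamma> B by (simp add: t_def)
  have tB: "t * (2 * B) \<le> 1" using \<gamma> B by (simp add: t_def field_simps power2_eq_square)
  have 1: "avg S (\<lambda>s. exp (t * h s)) \<le> exp (4 * B\<^sup>2 * t\<^sup>2)"
  proof -
    have "avg S (\<lambda>s. exp (t * h s)) \<le> avg S (\<lambda>s. 1 + t * h s + 4 * B\<^sup>2 * t\<^sup>2)"
    proof (rule avg_mono)
      fix s assume s: "s \<in> S"
      have "\<bar>t * h s\<bar> \<le> t * (2 * B)" using hB[OF s] t by (simp add: abs_mult)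
      then have a: "\<bar>t * h s\<bar> \<le> 1" using tB by linarith
      have "(t * h s)\<^sup>2 \<le> (t * (2 * B))\<^sup>2"
        using \<open>\<bar>t * h s\<bar> \<le> t * (2 * B)\<close> by (metis abs_ge_zero power2_abs power_mono)
      also have "\<dots> = 4 * B\<^sup>2 * t\<^sup>2" by (simp add: power2_eq_square)
      finally show "exp (t * h s) \<le> 1 + t * h s + 4 * B\<^sup>2 * t\<^sup>2"
        using exp_le_quadratic[OF a] by linarith
    qed
    also have "\<dots> = 1 + 4 * B\<^sup>2 * t\<^sup>2"
      using S h0 by (simp add: avg_add avg_cmult avg_const)
    also have "\<dots> \<le> exp (4 * B\<^sup>2 * t\<^sup>2)" by (rule exp_ge_add_one_self)
    finally show ?thesis .
  qed
  have "avg (tuples m S) (\<lambda>x. of_bool (real m * \<gamma> \<le> (\<Sum>j<m. h (x j))))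
      \<le> avg (tuples m S) (\<lambda>x. exp (- (t * (real m * \<gamma>))) * (\<Prod>j<m. exp (t * h (x j))))"
  proof (rule avg_mono)
    fix x
    have "exp (- (t * (real m * \<gamma>))) * (\<Prod>j<m. exp (t * h (x j)))
        = exp (t * ((\<Sum>j<m. h (x j)) - real m * \<gamma>))"
      by (simp add: exp_sum [symmetric] exp_add [symmetric] sum_distrib_left [symmetric] algebra_simps)
    then show "of_bool (real m * \<gamma> \<le> (\<Sum>j<m. h (x j)))
        \<le> exp (- (t * (real m * \<gamma>))) * (\<Prod>j<m. exp (t * h (x j)))"
      using t by auto
  qed
  also have "\<dots> = exp (- (t * (real m * \<gamma>))) * avg S (\<lambda>s. exp (t * h s)) ^ m"
    using S by (simp only: avg_cmult avg_tuples_prod[where h="\<lambda>s. exp (t * h s)"])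
  also have "\<dots> \<le> exp (- (t * (real m * \<gamma>))) * exp (4 * B\<^sup>2 * t\<^sup>2) ^ m"
    using 1 by (intro mult_left_mono power_mono avg_nonneg) auto
  also have "\<dots> = exp (real m * (4 * B\<^sup>2 * t\<^sup>2 - t * \<gamma>))"
    by (simp add: exp_of_nat_mult [symmetric] exp_add [symmetric] algebra_simps)
  also have "4 * B\<^sup>2 * t\<^sup>2 - t * \<gamma> = - (\<gamma>\<^sup>2 / (16 * B\<^sup>2))"
    using B by (simp add: t_def field_simps power2_eq_square)
  finally show ?thesis by simp
qed

lemma Hoeffding:
  fixes f :: "'a \<Rightarrow> real"
  assumes S: "finite S" "S \<noteq> {}" and fB: "\<And>s. s \<in> S \<Longrightarrow> \<bar>f s\<bar> \<le> B" and B: "B > 0"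
    and \<gamma>: "0 < \<gamma>" and m: "m > 0"
  shows "avg (tuples m S) (\<lambda>x. of_bool (\<bar>avg {..<m} (\<lambda>j. f (x j)) - avg S f\<bar> > \<gamma>))
     \<le> 2 * exp (- (real m * \<gamma>\<^sup>2 / (16 * B\<^sup>2)))"
proof (cases "\<gamma> \<le> 2 * B")
  case False
  have "\<bar>avg {..<m} (\<lambda>j. f (x j)) - avg S f\<bar> \<le> 2 * B" if "x \<in> tuples m S" for x
  proof -
    have "\<bar>avg {..<m} (\<lambda>j. f (x j))\<bar> \<le> B"
      using that fB m by (intro abs_avg_upper) (auto simp: tuples_mem)
    moreover have "\<bar>avg S f\<bar> \<le> B" using S fB by (intro abs_avg_upper)
    ultimately show ?thesis by linarith
  qed
  then have "avg (tuples m S) (\<lambda>x. of_bool (\<bar>avg {..<m} (\<lambda>j. f (x j)) - avg S f\<bar> > \<gamma>)) \<le> 0"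
    using False S by (intro avg_upper) (auto, fastforce)
  then show ?thesis by (meson exp_ge_zero mult_nonneg_nonneg order_trans zero_le_numeral)
next
  case True
  define h where "h = (\<lambda>s. f s - avg S f)"
  have "\<bar>avg S f\<bar> \<le> B" using S fB by (intro abs_avg_upper)
  then have hB: "\<bar>h s\<bar> \<le> 2 * B" if "s \<in> S" for s using fB[OF that] by (simp add: h_def)
  have h0: "avg S h = 0" using S by (simp add: h_def avg_diff avg_const)
  then have h0': "avg S (\<lambda>s. - h s) = 0" using avg_cmult[of S "-1" h] by simp
  have hB': "\<bar>- h s\<bar> \<le> 2 * B" if "s \<in> S" for s using hB[OF that] by simp
  have "avg (tuples m S) (\<lambda>x. of_bool (\<bar>avg {..<m} (\<lambda>j. f (x j)) - avg S f\<bar> > \<gamma>))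
    \<le> avg (tuples m S) (\<lambda>x. of_bool (real m * \<gamma> \<le> (\<Sum>j<m. h (x j)))
        + of_bool (real m * \<gamma> \<le> (\<Sum>j<m. - h (x j))))"
  proof (rule avg_mono)
    fix x
    have "avg {..<m} (\<lambda>j. f (x j)) - avg S f = (\<Sum>j<m. h (x j)) / real m"
      using m by (simp add: avg_def h_def sum_subtractf diff_divide_distrib)
    then have "\<bar>avg {..<m} (\<lambda>j. f (x j)) - avg S f\<bar> > \<gamma> \<Longrightarrow>
       real m * \<gamma> \<le> (\<Sum>j<m. h (x j)) \<or> real m * \<gamma> \<le> (\<Sum>j<m. - h (x j))"
      using m by (auto simp: sum_negf abs_if field_simps split: if_splits)
    then show "of_bool (\<bar>avg {..<m} (\<lambda>j. f (x j)) - avg S f\<bar> > \<gamma>)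
      \<le> (of_bool (real m * \<gamma> \<le> (\<Sum>j<m. h (x j))) :: real)
        + of_bool (real m * \<gamma> \<le> (\<Sum>j<m. - h (x j)))"
      by (auto simp: of_bool_def)
  qed
  also have "\<dots> \<le> 2 * exp (- (real m * \<gamma>\<^sup>2 / (16 * B\<^sup>2)))"
    unfolding avg_add
    using Hoeffding_upper[where S=S and h=h, OF S hB B h0 \<gamma> True, of m]
      Hoeffding_upper[where S=S and h="\<lambda>s. - h s", OF S hB' B h0' \<gamma> True, of m]
    by linarith
  finally show ?thesis .
qed

section \<open>Weak regularity relative to a graph\<close>

text \<open>Conditional expectation of \<open>f\<close> given the label \<open>\<kappa>\<close>, as
  a function of the label value. On a value that does not occur, division by zero makes it 0, which
  still lies in [0, 1].\<close>

definition cexp :: "'a set \<Rightarrow> ('a \<Rightarrow> 'l) \<Rightarrow> ('a \<Rightarrow> real) \<Rightarrow> 'l \<Rightarrow> real" where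
  "cexp X \<kappa> f l = avg {x\<in>X. \<kappa> x = l} f"

lemma cexp_orthogonal:
  assumes "finite X"
  shows "(\<Sum>x\<in>X. (f x - cexp X \<kappa> f (\<kappa> x)) * h (\<kappa> x)) = 0"
proof -
  have "(\<Sum>x\<in>{x\<in>X. \<kappa> x = l}. (f x - cexp X \<kappa> f (\<kappa> x)) * h (\<kappa> x)) = 0" if "l \<in> \<kappa> ` X" for l
  proof -
    let ?F = "{x\<in>X. \<kappa> x = l}"
    have "card ?F > 0" using that assms by (auto simp: card_gt_0_iff)
    then have *: "real (card ?F) * cexp X \<kappa> f l = (\<Sum>x\<in>?F. f x)"
      by (simp add: cexp_def avg_def)
    have "(\<Sum>x\<in>?F. (f x - cexp X \<kappa> f (\<kappa> x)) * h (\<kappa> x)) = (\<Sum>x\<in>?F. (f x - cexp X \<kappa> f l) * h l)"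
      by (intro sum.cong) auto
    also have "\<dots> = ((\<Sum>x\<in>?F. f x) - real (card ?F) * cexp X \<kappa> f l) * h l"
      by (simp add: sum_distrib_right [symmetric] sum_subtractf)
    finally show ?thesis using * by simp
  qed
  then show ?thesis
    using assms by (subst sum.image_gen[of X _ \<kappa>]) (auto intro: sum.neutral)
qed

lemma cexp_bounds:
  assumes "\<And>x. x \<in> X \<Longrightarrow> 0 \<le> f x \<and> f x \<le> 1" "finite X"
  shows "0 \<le> cexp X \<kappa> f l" "cexp X \<kappa> f l \<le> 1"
proof -
  show "0 \<le> cexp X \<kappa> f l" using assms by (auto simp: cexp_def intro!: avg_nonneg)
  show "cexp X \<kappa> f l \<le> 1"
  proof (cases "{x\<in>X. \<kappa> x = l} = {}")
    case True
    then show ?thesis unfolding cexp_def by (simp only: avg_def) simp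
  next
    case False
    then show ?thesis using assms by (auto simp: cexp_def intro!: avg_upper)
  qed
qed

text \<open>As \<open>\<kappa>\<close> is a function of \<open>\<kappa>'\<close>, the coarser
  expectation is also a function of the finer label, so both errors are orthogonal to it. The energy
  gained by a refinement is therefore the squared distance of the two approximations.\<close>

lemma cexp_pythagoras:
  assumes "finite X" and r: "\<And>x. x \<in> X \<Longrightarrow> \<kappa> x = r (\<kappa>' x)"
  shows "(\<Sum>x\<in>X. (cexp X \<kappa>' f (\<kappa>' x) - cexp X \<kappa> f (\<kappa> x))\<^sup>2)
       = (\<Sum>x\<in>X. (cexp X \<kappa>' f (\<kappa>' x))\<^sup>2) - (\<Sum>x\<in>X. (cexp X \<kappa> f (\<kappa> x))\<^sup>2)"
proof -
  let ?E' = "\<lambda>x. cexp X \<kappa>' f (\<kappa>' x)" and ?E = "\<lambda>x. cexp X \<kappa> f (\<kappa> x)"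
  have "(\<Sum>x\<in>X. (f x - ?E' x) * ?E x) = (\<Sum>x\<in>X. (f x - ?E' x) * cexp X \<kappa> f (r (\<kappa>' x)))"
    by (intro sum.cong) (auto simp: r)
  also have "\<dots> = 0" using assms by (intro cexp_orthogonal[where h="\<lambda>l. cexp X \<kappa> f (r l)"])
  finally have 1: "(\<Sum>x\<in>X. (f x - ?E' x) * ?E x) = 0" .
  have 2: "(\<Sum>x\<in>X. (f x - ?E x) * ?E x) = 0" using assms by (intro cexp_orthogonal)
  have "(\<Sum>x\<in>X. (?E' x - ?E x)\<^sup>2)
      = (\<Sum>x\<in>X. (?E' x)\<^sup>2 - (?E x)\<^sup>2 + 2 * ((f x - ?E' x) * ?E x) - 2 * ((f x - ?E x) * ?E x))"
    by (intro sum.cong) (auto simp: power2_eq_square algebra_simps)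
  also have "\<dots> = (\<Sum>x\<in>X. (?E' x)\<^sup>2) - (\<Sum>x\<in>X. (?E x)\<^sup>2)"
    using 1 2 by (simp add: sum.distrib sum_subtractf sum_distrib_left [symmetric])
  finally show ?thesis .
qed

text \<open>A linear form on the cube \<open>[0, 1]^V\<close> attains its extremes at vertices: take
  the indices with positive coefficients, or those with negative ones if the sum is
  negative.\<close>

lemma sum_extreme_subset:
  fixes s :: "'a \<Rightarrow> real"
  assumes "finite V" "\<And>u. u \<in> V \<Longrightarrow> 0 \<le> \<alpha> u \<and> \<alpha> u \<le> 1"
  shows "\<exists>A\<subseteq>V. \<bar>\<Sum>u\<in>V. \<alpha> u * s u\<bar> \<le> \<bar>\<Sum>u\<in>A. s u\<bar>"
proof -
  have *: "(\<Sum>u\<in>V. \<alpha> u * t u) \<le> (\<Sum>u\<in>{u\<in>V. t u > 0}. t u)" for t :: "'a \<Rightarrow> real"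
  proof -
    have "\<alpha> u * t u \<le> (if t u > 0 then t u else 0)" if "u \<in> V" for u
      using assms(2)[OF that] mult_left_le_one_le[of "t u" "\<alpha> u"] by (auto simp: mult_nonneg_nonpos)
    then have "(\<Sum>u\<in>V. \<alpha> u * t u) \<le> (\<Sum>u\<in>V. if t u > 0 then t u else 0)" by (rule sum_mono)
    also have "\<dots> = (\<Sum>u\<in>{u\<in>V. t u > 0}. t u)"
      using assms(1) by (simp add: sum.inter_filter)
    finally show ?thesis .
  qed
  show ?thesis
  proof (cases "(\<Sum>u\<in>V. \<alpha> u * s u) \<ge> 0")
    case True
    then show ?thesis using *[of s] by (intro exI[of _ "{u\<in>V. s u > 0}"]) auto
  next
    case False
    then show ?thesis using *[of "\<lambda>u. - s u"]
      by (intro exI[of _ "{u\<in>V. - s u > 0}"]) (auto simp: sum_negf)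
  qed
qed

text \<open>The normalised cut norm of \<open>D\<close> is at most \<open>\<delta>\<close>. Weights
  in [0, 1] replace vertex sets because the counting argument produces such weights.\<close>

definition cut_small :: "'v set \<Rightarrow> ('v \<Rightarrow> 'v \<Rightarrow> real) \<Rightarrow> real \<Rightarrow> bool" where
  "cut_small V D \<delta> \<longleftrightarrow> (\<forall>\<alpha> \<beta>. (\<forall>u\<in>V. 0 \<le> \<alpha> u \<and> \<alpha> u \<le> 1) \<longrightarrow> (\<forall>u\<in>V. 0 \<le> \<beta> u \<and> \<beta> u \<le> 1)
    \<longrightarrow> \<bar>avg V (\<lambda>u. avg V (\<lambda>v. D u v * (\<alpha> u * \<beta> v)))\<bar> \<le> \<delta>)"

text \<open>The weighted form is bilinear, so sets suffice: first the weights on \<open>u\<close>,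
  then those on \<open>v\<close> are replaced by an extreme set.\<close>

lemma cut_smallI:
  fixes D :: "'v \<Rightarrow> 'v \<Rightarrow> real"
  assumes V: "finite V"
    and cut: "\<And>A B. A \<subseteq> V \<Longrightarrow> B \<subseteq> V \<Longrightarrow> \<bar>\<Sum>u\<in>A. \<Sum>v\<in>B. D u v\<bar> \<le> \<delta> * (real (card V))\<^sup>2"
    and "\<delta> \<ge> 0"
  shows "cut_small V D \<delta>"
  unfolding cut_small_def
proof (intro allI impI)
  fix \<alpha> \<beta> :: "'v \<Rightarrow> real"
  assume "\<forall>u\<in>V. 0 \<le> \<alpha> u \<and> \<alpha> u \<le> 1" "\<forall>u\<in>V. 0 \<le> \<beta> u \<and> \<beta> u \<le> 1"
  then have \<alpha>: "\<And>u. u \<in> V \<Longrightarrow> 0 \<le> \<alpha> u \<and> \<alpha> u \<le> 1" and \<beta>: "\<And>u. u \<in> V \<Longrightarrow> 0 \<le> \<beta> u \<and> \<beta> u \<le> 1"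
    by blast+
  have "\<exists>A\<subseteq>V. \<bar>\<Sum>u\<in>V. \<alpha> u * (\<Sum>v\<in>V. \<beta> v * D u v)\<bar> \<le> \<bar>\<Sum>u\<in>A. \<Sum>v\<in>V. \<beta> v * D u v\<bar>"
    using V \<alpha> by (rule sum_extreme_subset)
  then obtain A where A: "A \<subseteq> V"
    "\<bar>\<Sum>u\<in>V. \<alpha> u * (\<Sum>v\<in>V. \<beta> v * D u v)\<bar> \<le> \<bar>\<Sum>u\<in>A. \<Sum>v\<in>V. \<beta> v * D u v\<bar>"
    by blast
  have sw: "(\<Sum>u\<in>A. \<Sum>v\<in>V. \<beta> v * D u v) = (\<Sum>v\<in>V. \<beta> v * (\<Sum>u\<in>A. D u v))"
    by (subst sum.swap) (simp add: sum_distrib_left)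
  have "\<exists>B\<subseteq>V. \<bar>\<Sum>v\<in>V. \<beta> v * (\<Sum>u\<in>A. D u v)\<bar> \<le> \<bar>\<Sum>v\<in>B. \<Sum>u\<in>A. D u v\<bar>"
    using V \<beta> by (rule sum_extreme_subset)
  then obtain B where B: "B \<subseteq> V"
    "\<bar>\<Sum>v\<in>V. \<beta> v * (\<Sum>u\<in>A. D u v)\<bar> \<le> \<bar>\<Sum>v\<in>B. \<Sum>u\<in>A. D u v\<bar>"
    by blast
  have "(\<Sum>v\<in>B. \<Sum>u\<in>A. D u v) = (\<Sum>u\<in>A. \<Sum>v\<in>B. D u v)" by (rule sum.swap)
  then have le: "\<bar>\<Sum>u\<in>V. \<alpha> u * (\<Sum>v\<in>V. \<beta> v * D u v)\<bar> \<le> \<delta> * (real (card V))\<^sup>2"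
    using A B cut[OF A(1) B(1)] unfolding sw by linarith
  have "avg V (\<lambda>u. avg V (\<lambda>v. D u v * (\<alpha> u * \<beta> v)))
      = (\<Sum>u\<in>V. \<alpha> u * (\<Sum>v\<in>V. \<beta> v * D u v)) / (real (card V))\<^sup>2"
    by (simp add: avg_def sum_distrib_left sum_divide_distrib [symmetric] power2_eq_square mult_ac)
  also have "\<bar>\<dots>\<bar> \<le> \<delta>"
  proof (cases "card V = 0")
    case False
    then show ?thesis using le by (simp add: abs_divide divide_le_eq)
  qed (use \<open>\<delta> \<ge> 0\<close> in simp)
  finally show "\<bar>avg V (\<lambda>u. avg V (\<lambda>v. D u v * (\<alpha> u * \<beta> v)))\<bar> \<le> \<delta>" .
qed

text \<open>Refining a colour by two sets appends a base-4 digit holding the two membership bits, so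
  that \<open>j\<close> refinements need only numbers below \<open>4 ^ j\<close>.\<close>

lemma base4_digits:
  fixes x :: nat
  shows "(4 * x + (if P then 2 else 0) + (if Q then 1 else 0)) div 4 = x"
    "((4 * x + (if P then 2 else 0) + (if Q then 1 else 0)) div 2) mod 2 = (if P then 1 else 0)"
    "(4 * x + (if P then 2 else 0) + (if Q then 1 else 0)) mod 2 = (if Q then 1 else 0)"
proof -
  show "(4 * x + (if P then 2 else 0) + (if Q then 1 else 0)) div 4 = x" by auto
  show "((4 * x + (if P then 2 else 0) + (if Q then 1 else 0)) div 2) mod 2 = (if P then 1 else 0)"
    by (auto; presburger)
  show "(4 * x + (if P then 2 else 0) + (if Q then 1 else 0)) mod 2 = (if Q then 1 else 0)"
    by (auto; presburger)
qed

text \<open>Energy increment as in the Frieze--Kannan weak regularity lemma, but relative to g: the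
  approximation of h may depend on the pair being an edge of g.  Hence h and its approximation
  have the same density on the edges and on the non-edges of g, so the edit distance to g is
  preserved exactly.\<close>

lemma relative_weak_regularity:
  fixes g h :: "'v \<Rightarrow> 'v \<Rightarrow> bool"
  assumes V: "finite V" and gs: "\<And>u v. g u v = g v u" and hs: "\<And>u v. h u v = h v u"
    and \<delta>: "\<delta> > 0" and L: "real L * \<delta>\<^sup>2 > 1"
  obtains \<xi> :: "'v \<Rightarrow> nat" and w :: "nat \<Rightarrow> nat \<Rightarrow> bool \<Rightarrow> real" where
    "\<And>v. \<xi> v < 4 ^ L"
    "\<And>c c' b. w c c' b = w c' c b" "\<And>c c' b. 0 \<le> w c c' b" "\<And>c c' b. w c c' b \<le> 1"
    "\<And>A B. A \<subseteq> V \<Longrightarrow> B \<subseteq> V \<Longrightarrow>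
      \<bar>\<Sum>u\<in>A. \<Sum>v\<in>B. of_bool (h u v) - w (\<xi> u) (\<xi> v) (g u v)\<bar> \<le> \<delta> * (real (card V))\<^sup>2"
    "\<And>b. (\<Sum>u\<in>V. \<Sum>v\<in>V. (of_bool (h u v) - w (\<xi> u) (\<xi> v) (g u v)) * of_bool (g u v = b)) = 0"
proof -
  define X where "X = V \<times> V"
  define n where "n = real (card V)"
  have finX: "finite X" using V by (simp add: X_def)
  have cardX: "real (card X) = n\<^sup>2"
    by (simp add: X_def n_def card_cartesian_product power2_eq_square)
  define f :: "'v \<times> 'v \<Rightarrow> real" where "f = (\<lambda>p. of_bool (h (fst p) (snd p)))"
  have f01: "0 \<le> f x \<and> f x \<le> 1" for x by (simp add: f_def)
  \<comment> \<open>The adjacency in \<open>g\<close> is part of the label of a pair. This makes the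
    partition relative to \<open>g\<close>, and by orthogonality it yields the exact equality of
    densities at the end.\<close>
  define \<kappa> where "\<kappa> = (\<lambda>\<xi>::'v \<Rightarrow> nat. \<lambda>p. (\<xi> (fst p), \<xi> (snd p), g (fst p) (snd p)))"
  define E where "E = (\<lambda>\<xi> p. cexp X (\<kappa> \<xi>) f (\<kappa> \<xi> p))"
  define en where "en = (\<lambda>\<xi>. \<Sum>p\<in>X. (E \<xi> p)\<^sup>2)"
  define good where "good = (\<lambda>\<xi>. \<forall>A B. A \<subseteq> V \<longrightarrow> B \<subseteq> V \<longrightarrow>
      \<bar>\<Sum>p\<in>A \<times> B. f p - E \<xi> p\<bar> \<le> \<delta> * n\<^sup>2)"
  have E01: "0 \<le> E \<xi> p" "E \<xi> p \<le> 1" for \<xi> p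
    using cexp_bounds[of X f "\<kappa> \<xi>" "\<kappa> \<xi> p"] f01 finX by (auto simp: E_def)
  have en_le: "en \<xi> \<le> n\<^sup>2" for \<xi>
  proof -
    have "en \<xi> \<le> (\<Sum>p\<in>X. 1)"
      unfolding en_def using E01[of \<xi>] by (intro sum_mono) (simp add: power_le_one)
    then show ?thesis using cardX by simp
  qed
  have step: "\<exists>\<xi>'. (\<forall>v. \<xi>' v < 4 * m) \<and> en \<xi>' \<ge> en \<xi> + \<delta>\<^sup>2 * n\<^sup>2"
    if bad: "\<not> good \<xi>" and rng: "\<forall>v. \<xi> v < m" for \<xi> m
  proof -
    from bad obtain A B where A: "A \<subseteq> V" and B: "B \<subseteq> V"
      and AB: "\<bar>\<Sum>p\<in>A \<times> B. f p - E \<xi> p\<bar> > \<delta> * n\<^sup>2" by (auto simp: good_def not_le)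
    define \<xi>' where "\<xi>' = (\<lambda>u. 4 * \<xi> u + (if u \<in> A then 2 else 0) + (if u \<in> B then 1 else 0))"
    have "n \<noteq> 0"
    proof
      assume "n = 0"
      then have "V = {}" using V by (simp add: n_def)
      then show False using AB A B \<open>n = 0\<close> by simp
    qed
    then have n: "n > 0" by (simp add: n_def)
    have div: "\<xi>' u div 4 = \<xi> u" "(\<xi>' u div 2) mod 2 = (if u \<in> A then 1 else 0)"
      "\<xi>' u mod 2 = (if u \<in> B then 1 else 0)" for u
      by (simp_all only: \<xi>'_def base4_digits)
    define r where "r = (\<lambda>(c::nat, c'::nat, b::bool). (c div 4, c' div 4, b))"
    have r: "\<kappa> \<xi> p = r (\<kappa> \<xi>' p)" for p by (simp add: \<kappa>_def r_def div)
    \<comment> \<open>The indicator of \<open>A \<times> B\<close> is a function of the refined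
      label. So \<open>f - E \<xi>'\<close> is orthogonal to it, and \<open>f\<close> may be
      replaced by \<open>E \<xi>'\<close> in the violated cut.\<close>
    define ind where "ind = (\<lambda>(c::nat, c'::nat, b::bool). (real ((c div 2) mod 2)) * real (c' mod 2))"
    have ind: "ind (\<kappa> \<xi>' p) = of_bool (p \<in> A \<times> B)" for p
      by (cases p) (simp add: ind_def \<kappa>_def div)
    have ABX: "A \<times> B \<subseteq> X" using A B by (auto simp: X_def)
    have o: "(\<Sum>p\<in>X. (f p - E \<xi>' p) * ind (\<kappa> \<xi>' p)) = 0"
      unfolding E_def using finX by (rule cexp_orthogonal)
    have "(\<Sum>p\<in>A \<times> B. f p - E \<xi> p) = (\<Sum>p\<in>X. (f p - E \<xi> p) * of_bool (p \<in> A \<times> B))"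
      using ABX finX by (simp add: sum.inter_restrict[symmetric] of_bool_def if_distrib Int_absorb1 cong: if_cong)
    also have "\<dots> = (\<Sum>p\<in>X. (f p - E \<xi>' p) * ind (\<kappa> \<xi>' p) + (E \<xi>' p - E \<xi> p) * of_bool (p \<in> A \<times> B))"
      by (intro sum.cong) (auto simp: ind algebra_simps)
    also have "\<dots> = (\<Sum>p\<in>X. (E \<xi>' p - E \<xi> p) * of_bool (p \<in> A \<times> B))"
      using o by (simp add: sum.distrib)
    finally have eq: "(\<Sum>p\<in>A \<times> B. f p - E \<xi> p) = (\<Sum>p\<in>X. (E \<xi>' p - E \<xi> p) * of_bool (p \<in> A \<times> B))" .
    \<comment> \<open>Cauchy-Schwarz turns a cut discrepancy above \<open>\<delta> * n^2\<close>
      into an energy gain of at least \<open>\<delta>^2 * n^2\<close>. The energy never exceeds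
      \<open>n^2\<close>, so fewer than \<open>L\<close> refinements succeed.\<close>
    have "(\<delta> * n\<^sup>2)\<^sup>2 \<le> (\<Sum>p\<in>A \<times> B. f p - E \<xi> p)\<^sup>2"
      using AB \<delta> by (intro abs_le_square_iff[THEN iffD1]) (simp add: abs_mult)
    also have "\<dots> \<le> (\<Sum>p\<in>X. (E \<xi>' p - E \<xi> p)\<^sup>2) * (\<Sum>p\<in>X. (of_bool (p \<in> A \<times> B))\<^sup>2)"
      unfolding eq by (rule Cauchy_Schwarz_ineq_sum)
    also have "\<dots> \<le> (\<Sum>p\<in>X. (E \<xi>' p - E \<xi> p)\<^sup>2) * (\<Sum>p\<in>X. 1)"
      by (intro mult_left_mono sum_mono sum_nonneg) auto
    also have "\<dots> = (en \<xi>' - en \<xi>) * n\<^sup>2"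
      using cexp_pythagoras[OF finX, of "\<kappa> \<xi>" r "\<kappa> \<xi>'" f] r cardX by (simp add: E_def en_def)
    finally have "(\<delta> * n\<^sup>2)\<^sup>2 \<le> (en \<xi>' - en \<xi>) * n\<^sup>2" .
    moreover have "(\<delta> * n\<^sup>2)\<^sup>2 = \<delta>\<^sup>2 * n\<^sup>2 * n\<^sup>2"
      by (simp only: power2_eq_square mult_ac)
    ultimately have "\<delta>\<^sup>2 * n\<^sup>2 * n\<^sup>2 \<le> (en \<xi>' - en \<xi>) * n\<^sup>2" by linarith
    then have "\<delta>\<^sup>2 * n\<^sup>2 \<le> en \<xi>' - en \<xi>" using n by (simp only: mult_le_cancel_right_pos zero_less_power)
    moreover have "\<xi>' v < 4 * m" for v using rng[rule_format, of v] by (simp add: \<xi>'_def)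
    ultimately show ?thesis by (intro exI[of _ \<xi>']) auto
  qed
  have main: "\<exists>\<xi>. (\<forall>v. \<xi> v < 4 ^ j) \<and> (good \<xi> \<or> en \<xi> \<ge> real j * \<delta>\<^sup>2 * n\<^sup>2)" for j
  proof (induction j)
    case 0
    show ?case by (intro exI[of _ "\<lambda>_. 0"]) (simp add: en_def sum_nonneg)
  next
    case (Suc j)
    then obtain \<xi> where \<xi>: "\<forall>v. \<xi> v < 4 ^ j" "good \<xi> \<or> en \<xi> \<ge> real j * \<delta>\<^sup>2 * n\<^sup>2" by blast
    show ?case
    proof (cases "good \<xi>")
      case True
      have "\<xi> v < 4 ^ Suc j" for v using \<xi>(1)[rule_format, of v] by simp
      then show ?thesis using True by blast
    next
      case False
      then obtain \<xi>' where "\<forall>v. \<xi>' v < 4 * 4 ^ j" "en \<xi>' \<ge> en \<xi> + \<delta>\<^sup>2 * n\<^sup>2"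
        using step \<xi>(1) by blast
      moreover have "real (Suc j) * \<delta>\<^sup>2 * n\<^sup>2 = real j * \<delta>\<^sup>2 * n\<^sup>2 + \<delta>\<^sup>2 * n\<^sup>2"
        by (simp add: distrib_right)
      ultimately have "(\<forall>v. \<xi>' v < 4 ^ Suc j) \<and> en \<xi>' \<ge> real (Suc j) * \<delta>\<^sup>2 * n\<^sup>2"
        using \<xi>(2) False by simp
      then show ?thesis by blast
    qed
  qed
  obtain \<xi> where \<xi>: "\<forall>v. \<xi> v < 4 ^ L" "good \<xi> \<or> en \<xi> \<ge> real L * \<delta>\<^sup>2 * n\<^sup>2" using main[of L] by blast
  have good: "good \<xi>"
  proof (cases "n = 0")
    case True
    then have "V = {}" using V by (simp add: n_def)
    then show ?thesis by (auto simp: good_def True)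
  next
    case False
    then have "real L * \<delta>\<^sup>2 * n\<^sup>2 > n\<^sup>2" using L by simp
    then show ?thesis using \<xi>(2) en_le[of \<xi>] by linarith
  qed
  define w where "w = (\<lambda>c c' b. cexp X (\<kappa> \<xi>) f (c, c', b))"
  have Ew: "E \<xi> (u, v) = w (\<xi> u) (\<xi> v) (g u v)" for u v by (simp add: E_def w_def \<kappa>_def)
  have fuv: "f (u, v) = of_bool (h u v)" for u v by (simp add: f_def)
  show ?thesis
  proof (rule that[of \<xi> w])
    show "\<xi> v < 4 ^ L" for v using \<xi> by blast
    show "w c c' b = w c' c b" for c c' b
    proof -
      let ?S = "\<lambda>c c'. {p\<in>X. \<kappa> \<xi> p = (c, c', b)}"
      have "(\<Sum>p\<in>?S c c'. F p) = (\<Sum>p\<in>?S c' c. F (prod.swap p))" for F :: "'v \<times> 'v \<Rightarrow> real"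
        by (rule sum.reindex_bij_witness[where i=prod.swap and j=prod.swap])
           (auto simp: X_def \<kappa>_def gs)
      from this[of f] this[of "\<lambda>_. 1"] show ?thesis
        by (simp add: w_def cexp_def avg_def) (simp add: f_def hs)
    qed
    show "0 \<le> w c c' b" "w c c' b \<le> 1" for c c' b
      using cexp_bounds[of X f "\<kappa> \<xi>"] f01 finX by (auto simp: w_def)
    show "\<bar>\<Sum>u\<in>A. \<Sum>v\<in>B. of_bool (h u v) - w (\<xi> u) (\<xi> v) (g u v)\<bar> \<le> \<delta> * (real (card V))\<^sup>2"
      if "A \<subseteq> V" "B \<subseteq> V" for A B
      using good that by (simp add: good_def n_def sum.cartesian_product' Ew fuv)
    show "(\<Sum>u\<in>V. \<Sum>v\<in>V. (of_bool (h u v) - w (\<xi> u) (\<xi> v) (g u v)) * of_bool (g u v = b)) = 0" for b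
    proof -
      have "(\<Sum>p\<in>X. (f p - cexp X (\<kappa> \<xi>) f (\<kappa> \<xi> p)) * of_bool (snd (snd (\<kappa> \<xi> p)) = b)) = 0"
        using finX by (rule cexp_orthogonal)
      then show ?thesis
        by (simp add: X_def sum.cartesian_product' fuv w_def \<kappa>_def)
    qed
  qed
qed

section \<open>Pattern densities\<close>

definition lit :: "bool \<Rightarrow> real \<Rightarrow> real" where
  "lit b x = (if b then x else 1 - x)"

lemma lit_bounds: "0 \<le> x \<Longrightarrow> x \<le> 1 \<Longrightarrow> 0 \<le> lit b x \<and> lit b x \<le> 1"
  by (simp add: lit_def)

lemma lit_diff: "lit b x - lit b y = (if b then 1 else -1) * (x - y)"
  by (simp add: lit_def)

text \<open>Pairs in \<open>E\<close> are prescribed to be edges or non-edges according to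
  \<open>s\<close>; all other pairs are free. For kernels with values in [0, 1] this extends the
  indicator of the pattern multilinearly.\<close>

definition pat :: "(nat \<times> nat) set \<Rightarrow> (nat \<times> nat \<Rightarrow> bool) \<Rightarrow> ('v \<Rightarrow> 'v \<Rightarrow> real) \<Rightarrow> (nat \<Rightarrow> 'v) \<Rightarrow> real" where
  "pat E s Z \<phi> = (\<Prod>e\<in>E. lit (s e) (Z (\<phi> (fst e)) (\<phi> (snd e))))"

lemma prod_unit_interval:
  fixes f :: "'a \<Rightarrow> real"
  assumes "\<And>e. e \<in> F \<Longrightarrow> 0 \<le> f e \<and> f e \<le> 1"
  shows "0 \<le> prod f F \<and> prod f F \<le> 1"
  using assms by (simp add: prod_nonneg prod_le_1)

text \<open>Fix all coordinates except \<open>a\<close> and \<open>b\<close>. Every remaining pair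
  contains at most one of them, so the product splits into a weight of the vertex at
  \<open>a\<close> times a weight of the vertex at \<open>b\<close>, and the cut norm applies to the
  two free coordinates.\<close>

lemma avg_edge_times_rest:
  fixes D :: "'v \<Rightarrow> 'v \<Rightarrow> real"
  assumes V: "finite V" "V \<noteq> {}"
    and cut: "cut_small V D \<delta>"
    and F: "finite F" "\<And>e. e \<in> F \<Longrightarrow> fst e < snd e \<and> snd e < k" and ab: "a < b" "b < k" "(a, b) \<notin> F"
    and Z: "\<And>e u v. e \<in> F \<Longrightarrow> u \<in> V \<Longrightarrow> v \<in> V \<Longrightarrow> 0 \<le> Z e u v \<and> Z e u v \<le> 1"
  shows "\<bar>avg (tuples k V) (\<lambda>\<phi>. D (\<phi> a) (\<phi> b) * (\<Prod>e\<in>F. Z e (\<phi> (fst e)) (\<phi> (snd e))))\<bar> \<le> \<delta>"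
    (is "\<bar>avg _ ?f\<bar> \<le> _")
proof -
  have "avg (tuples k V) ?f = avg (tuples k V) (\<lambda>\<phi>. avg V (\<lambda>v. ?f (\<phi>(b := v))))"
    using V ab by (intro avg_resample)
  also have "\<dots> = avg (tuples k V) (\<lambda>\<phi>. avg V (\<lambda>u. avg V (\<lambda>v. ?f (\<phi>(a := u, b := v)))))"
    using V ab by (subst avg_resample[of V a k]) auto
  also have "\<bar>\<dots>\<bar> \<le> \<delta>"
  proof (rule abs_avg_upper)
    fix \<phi> assume \<phi>: "\<phi> \<in> tuples k V"
    define Fa where "Fa = {e\<in>F. fst e = a \<or> snd e = a}"
    define \<alpha> where "\<alpha> = (\<lambda>u. \<Prod>e\<in>Fa. Z e ((\<phi>(a := u)) (fst e)) ((\<phi>(a := u)) (snd e)))"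
    define \<beta> where "\<beta> = (\<lambda>v. \<Prod>e\<in>F - Fa. Z e ((\<phi>(b := v)) (fst e)) ((\<phi>(b := v)) (snd e)))"
    have FaF: "Fa \<subseteq> F" by (auto simp: Fa_def)
    have lt: "fst e < k" "snd e < k" if "e \<in> F" for e using F(2)[OF that] by auto
    have "?f (\<phi>(a := u, b := v)) = D u v * (\<alpha> u * \<beta> v)" for u v
    proof -
      have "(\<Prod>e\<in>Fa. Z e ((\<phi>(a := u, b := v)) (fst e)) ((\<phi>(a := u, b := v)) (snd e))) = \<alpha> u"
        unfolding \<alpha>_def
      proof (rule prod.cong)
        fix e assume "e \<in> Fa"
        moreover have "fst e < snd e" "e \<noteq> (a, b)" using \<open>e \<in> Fa\<close> F(2)[of e] ab by (auto simp: Fa_def)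
        ultimately have "fst e \<noteq> b" "snd e \<noteq> b" using ab by (auto simp: Fa_def prod_eq_iff)
        then show "Z e ((\<phi>(a := u, b := v)) (fst e)) ((\<phi>(a := u, b := v)) (snd e))
          = Z e ((\<phi>(a := u)) (fst e)) ((\<phi>(a := u)) (snd e))" by simp
      qed simp
      moreover have "(\<Prod>e\<in>F - Fa. Z e ((\<phi>(a := u, b := v)) (fst e)) ((\<phi>(a := u, b := v)) (snd e))) = \<beta> v"
        unfolding \<beta>_def by (rule prod.cong) (auto simp: Fa_def)
      ultimately show ?thesis
        using prod.subset_diff[OF FaF F(1), of "\<lambda>e. Z e ((\<phi>(a := u, b := v)) (fst e)) ((\<phi>(a := u, b := v)) (snd e))"] ab
        by (simp add: mult.commute)
    qed
    moreover have "\<bar>avg V (\<lambda>u. avg V (\<lambda>v. D u v * (\<alpha> u * \<beta> v)))\<bar> \<le> \<delta>"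
    proof (rule cut[unfolded cut_small_def, rule_format])
      show "0 \<le> \<alpha> u \<and> \<alpha> u \<le> 1" if "u \<in> V" for u
        unfolding \<alpha>_def using FaF lt ab
        by (intro prod_unit_interval Z tuples_mem[OF tuples_upd[OF \<phi> _ that]]) auto
      show "0 \<le> \<beta> u \<and> \<beta> u \<le> 1" if "u \<in> V" for u
        unfolding \<beta>_def using lt ab
        by (intro prod_unit_interval Z tuples_mem[OF tuples_upd[OF \<phi> _ that]]) auto
    qed
    ultimately show "\<bar>avg V (\<lambda>u. avg V (\<lambda>v. ?f (\<phi>(a := u, b := v))))\<bar> \<le> \<delta>" by simp
  qed (use V in auto)
  finally show ?thesis .
qed

text \<open>Telescoping: \<open>X\<close> is exchanged for \<open>Y\<close> on one pair at a time. A
  single exchange leaves \<open>X - Y\<close> at that pair times bounded factors at the others, so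
  it costs at most the cut norm.\<close>

lemma counting_lemma:
  fixes X Y :: "'v \<Rightarrow> 'v \<Rightarrow> real"
  assumes V: "finite V" "V \<noteq> {}"
    and cut: "cut_small V (\<lambda>u v. X u v - Y u v) \<delta>"
    and E: "finite E" "\<And>e. e \<in> E \<Longrightarrow> fst e < snd e \<and> snd e < k"
    and X: "\<And>u v. u \<in> V \<Longrightarrow> v \<in> V \<Longrightarrow> 0 \<le> X u v \<and> X u v \<le> 1"
    and Y: "\<And>u v. u \<in> V \<Longrightarrow> v \<in> V \<Longrightarrow> 0 \<le> Y u v \<and> Y u v \<le> 1"
  shows "\<bar>avg (tuples k V) (pat E s X) - avg (tuples k V) (pat E s Y)\<bar> \<le> real (card E) * \<delta>"
proof -
  define Z where "Z = (\<lambda>E1 e u v. lit (s e) (if e \<in> E1 then Y u v else X u v))"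
  define A where "A = (\<lambda>E1. avg (tuples k V) (\<lambda>\<phi>. \<Prod>e\<in>E. Z E1 e (\<phi> (fst e)) (\<phi> (snd e))))"
  have Z01: "0 \<le> Z E1 e u v \<and> Z E1 e u v \<le> 1" if "u \<in> V" "v \<in> V" for E1 e u v
    using X[OF that] Y[OF that] by (auto simp: Z_def intro!: lit_bounds)
  have "\<bar>A {} - A E1\<bar> \<le> real (card E1) * \<delta>" if "finite E1" "E1 \<subseteq> E" for E1
    using that
  proof (induction E1 rule: finite_induct)
    case (insert e E1)
    obtain a b where e: "e = (a, b)" by (cases e)
    have ab: "a < b" "b < k" using E(2)[of e] insert.prems by (auto simp: e)
    define \<sigma> where "\<sigma> = (if s e then 1 else -1 :: real)"
    have \<sigma>: "\<bar>\<sigma>\<bar> = 1" by (simp add: \<sigma>_def)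
    let ?R = "\<lambda>\<phi>. \<Prod>e'\<in>E - {e}. Z E1 e' (\<phi> (fst e')) (\<phi> (snd e'))"
    have "(\<Prod>e'\<in>E. Z E1 e' (\<phi> (fst e')) (\<phi> (snd e'))) - (\<Prod>e'\<in>E. Z (insert e E1) e' (\<phi> (fst e')) (\<phi> (snd e')))
        = \<sigma> * ((X (\<phi> a) (\<phi> b) - Y (\<phi> a) (\<phi> b)) * ?R \<phi>)" for \<phi>
    proof -
      have eE: "e \<in> E" using insert.prems by simp
      have "(\<Prod>e'\<in>E - {e}. Z (insert e E1) e' (\<phi> (fst e')) (\<phi> (snd e'))) = ?R \<phi>"
        by (intro prod.cong) (auto simp: Z_def)
      then have "(\<Prod>e'\<in>E. Z E1 e' (\<phi> (fst e')) (\<phi> (snd e'))) - (\<Prod>e'\<in>E. Z (insert e E1) e' (\<phi> (fst e')) (\<phi> (snd e')))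
         = (Z E1 e (\<phi> a) (\<phi> b) - Z (insert e E1) e (\<phi> a) (\<phi> b)) * ?R \<phi>"
        by (simp add: prod.remove[OF E(1) eE] e algebra_simps)
      then show ?thesis using insert.hyps by (simp add: Z_def lit_diff \<sigma>_def)
    qed
    then have "A E1 - A (insert e E1) = \<sigma> * avg (tuples k V) (\<lambda>\<phi>. (X (\<phi> a) (\<phi> b) - Y (\<phi> a) (\<phi> b)) * ?R \<phi>)"
      by (simp add: A_def avg_diff [symmetric] avg_cmult)
    moreover have "\<bar>avg (tuples k V) (\<lambda>\<phi>. (X (\<phi> a) (\<phi> b) - Y (\<phi> a) (\<phi> b)) * ?R \<phi>)\<bar> \<le> \<delta>"
      using ab E Z01 by (intro avg_edge_times_rest[where D="\<lambda>u v. X u v - Y u v"] V cut) (auto simp: e)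
    ultimately have "\<bar>A E1 - A (insert e E1)\<bar> \<le> \<delta>" using \<sigma> by (simp add: abs_mult)
    moreover have "\<bar>A {} - A E1\<bar> \<le> real (card E1) * \<delta>" using insert by auto
    ultimately show ?case using insert.hyps by (simp add: distrib_right)
  qed simp
  from this[of E] have "\<bar>A {} - A E\<bar> \<le> real (card E) * \<delta>" using E by simp
  moreover have "A {} = avg (tuples k V) (pat E s X)"
    by (auto simp: A_def Z_def pat_def intro!: avg_cong prod.cong)
  moreover have "A E = avg (tuples k V) (pat E s Y)"
    by (auto simp: A_def Z_def pat_def intro!: avg_cong prod.cong)
  ultimately show ?thesis by simp
qed

text \<open>Abstracts the acceptance probability of a tester: \<open>c\<close> weighs the accepting
  leaves, each of which is a pattern with at most \<open>q\<close> pairs on \<open>k\<close>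
  positions. Errors are measured by the total weight \<open>Q\<close>, since the number of patterns
  may grow with the graph. The bound \<open>4 \<le> k\<close> reserves two disjoint pairs of
  positions for the distance penalty.\<close>

locale pattern_family =
  fixes k :: nat and I :: "'i set" and c :: "'i \<Rightarrow> real" and E :: "'i \<Rightarrow> (nat \<times> nat) set"
    and s :: "'i \<Rightarrow> nat \<times> nat \<Rightarrow> bool" and Q :: real and q :: nat
  assumes k4: "4 \<le> k" and finI: "finite I" and c_nonneg: "\<And>i. i \<in> I \<Longrightarrow> 0 \<le> c i"
    and c_sum: "sum c I \<le> Q" and E_sub: "\<And>i e. i \<in> I \<Longrightarrow> e \<in> E i \<Longrightarrow> fst e < snd e \<and> snd e < k"
    and E_card: "\<And>i. i \<in> I \<Longrightarrow> card (E i) \<le> q" and Q1: "1 \<le> Q"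
begin

definition dens :: "('v \<Rightarrow> 'v \<Rightarrow> real) \<Rightarrow> (nat \<Rightarrow> 'v) \<Rightarrow> real" where
  "dens Z \<phi> = (\<Sum>i\<in>I. c i * pat (E i) (s i) Z \<phi>)"

lemma E_fin: "i \<in> I \<Longrightarrow> finite (E i)"
  by (rule finite_subset[of _ "{..<k} \<times> {..<k}"]) (use E_sub in fastforce)+

lemma pat_bounds:
  assumes "i \<in> I" "\<And>a b. a < b \<Longrightarrow> b < k \<Longrightarrow> 0 \<le> Z (\<phi> a) (\<phi> b) \<and> Z (\<phi> a) (\<phi> b) \<le> 1"
  shows "0 \<le> pat (E i) (s i) Z \<phi> \<and> pat (E i) (s i) Z \<phi> \<le> 1"
  unfolding pat_def using assms E_sub[OF assms(1)] by (intro prod_unit_interval lit_bounds) auto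

lemma dens_bounds:
  assumes "\<And>a b. a < b \<Longrightarrow> b < k \<Longrightarrow> 0 \<le> Z (\<phi> a) (\<phi> b) \<and> Z (\<phi> a) (\<phi> b) \<le> 1"
  shows "0 \<le> dens Z \<phi> \<and> dens Z \<phi> \<le> Q"
proof
  show "0 \<le> dens Z \<phi>" unfolding dens_def
    using pat_bounds[of _ Z \<phi>] assms c_nonneg by (intro sum_nonneg mult_nonneg_nonneg) auto
  have "dens Z \<phi> \<le> (\<Sum>i\<in>I. c i * 1)" unfolding dens_def
    using pat_bounds[of _ Z \<phi>] assms c_nonneg by (intro sum_mono mult_left_mono) auto
  then show "dens Z \<phi> \<le> Q" using c_sum by simp
qed

lemma dens_cong:
  assumes "\<And>a b. a < b \<Longrightarrow> b < k \<Longrightarrow> Z (\<phi> a) (\<phi> b) = Z' (\<phi>' a) (\<phi>' b)"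
  shows "dens Z \<phi> = dens Z' \<phi>'"
  unfolding dens_def pat_def
  by (intro sum.cong refl arg_cong2[where f="(*)"] prod.cong) (use assms E_sub in auto)

lemma dens_counting:
  fixes X Y :: "'v \<Rightarrow> 'v \<Rightarrow> real"
  assumes V: "finite V" "V \<noteq> {}"
    and cut: "cut_small V (\<lambda>u v. X u v - Y u v) \<delta>"
    and \<delta>: "\<delta> \<ge> 0"
    and X: "\<And>u v. u \<in> V \<Longrightarrow> v \<in> V \<Longrightarrow> 0 \<le> X u v \<and> X u v \<le> 1"
    and Y: "\<And>u v. u \<in> V \<Longrightarrow> v \<in> V \<Longrightarrow> 0 \<le> Y u v \<and> Y u v \<le> 1"
  shows "\<bar>avg (tuples k V) (dens X) - avg (tuples k V) (dens Y)\<bar> \<le> Q * (real q * \<delta>)"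
proof -
  have "avg (tuples k V) (dens Z) = (\<Sum>i\<in>I. c i * avg (tuples k V) (pat (E i) (s i) Z))"
    for Z :: "'v \<Rightarrow> 'v \<Rightarrow> real"
    unfolding dens_def by (simp only: avg_sum avg_cmult)
  then have "avg (tuples k V) (dens X) - avg (tuples k V) (dens Y)
    = (\<Sum>i\<in>I. c i * (avg (tuples k V) (pat (E i) (s i) X) - avg (tuples k V) (pat (E i) (s i) Y)))"
    by (simp add: sum_subtractf right_diff_distrib)
  also have "\<bar>\<dots>\<bar> \<le> (\<Sum>i\<in>I. \<bar>c i * (avg (tuples k V) (pat (E i) (s i) X) - avg (tuples k V) (pat (E i) (s i) Y))\<bar>)"
    by (rule sum_abs)
  also have "\<dots> \<le> (\<Sum>i\<in>I. c i * (real q * \<delta>))"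
  proof (rule sum_mono)
    fix i assume i: "i \<in> I"
    have "\<bar>avg (tuples k V) (pat (E i) (s i) X) - avg (tuples k V) (pat (E i) (s i) Y)\<bar> \<le> real (card (E i)) * \<delta>"
      using E_fin[OF i] E_sub[OF i] by (intro counting_lemma V cut X Y) auto
    also have "\<dots> \<le> real q * \<delta>" using E_card[OF i] \<delta> by (intro mult_right_mono) auto
    finally show "\<bar>c i * (avg (tuples k V) (pat (E i) (s i) X) - avg (tuples k V) (pat (E i) (s i) Y))\<bar> \<le> c i * (real q * \<delta>)"
      using c_nonneg[OF i] by (simp add: abs_mult mult_left_mono)
  qed
  also have "\<dots> \<le> Q * (real q * \<delta>)"
    using c_sum \<delta> by (simp add: sum_distrib_right [symmetric] mult_right_mono)
  finally show ?thesis .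
qed

end

section \<open>Decision trees as pattern densities\<close>

lemma permutes_extending:
  assumes S: "finite S" "K \<subseteq> S" and \<sigma>: "inj_on \<sigma> K" "\<sigma> ` K \<subseteq> S"
  obtains \<theta> where "\<theta> permutes S" "\<And>x. x \<in> K \<Longrightarrow> \<theta> x = \<sigma> x"
proof -
  have "card (S - K) = card (S - \<sigma> ` K)"
    using assms by (simp add: card_Diff_subset card_image finite_subset)
  then obtain f where f: "bij_betw f (S - K) (S - \<sigma> ` K)"
    using S finite_same_card_bij[of "S - K" "S - \<sigma> ` K"] by auto
  define \<theta> where "\<theta> = (\<lambda>x. if x \<in> K then \<sigma> x else if x \<in> S then f x else x)"
  have "bij_betw \<theta> K (\<sigma> ` K)"
    using bij_betw_imageI[OF \<sigma>(1) refl] by (rule bij_betw_cong[THEN iffD1, rotated]) (simp add: \<theta>_def)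
  moreover have "bij_betw \<theta> (S - K) (S - \<sigma> ` K)"
    using f by (rule bij_betw_cong[THEN iffD1, rotated]) (simp add: \<theta>_def)
  ultimately have "bij_betw \<theta> (K \<union> (S - K)) (\<sigma> ` K \<union> (S - \<sigma> ` K))"
    by (rule bij_betw_combine) auto
  moreover have "K \<union> (S - K) = S" "\<sigma> ` K \<union> (S - \<sigma> ` K) = S" using assms by auto
  ultimately have "bij_betw \<theta> S S" by simp
  then have "\<theta> permutes S" by (rule bij_imp_permutes) (use S in \<open>auto simp: \<theta>_def\<close>)
  then show ?thesis by (rule that) (simp add: \<theta>_def)
qed

text \<open>Composing the tuples with a permutation \<open>\<pi>\<close> does not change their
  average, so \<open>\<pi>\<close> may be averaged over as well. If \<open>\<phi>\<close> is
  injective, \<open>\<phi> \<circ> \<iota>\<close> extends from \<open>K\<close> to a permutation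
  \<open>\<theta>\<close>, and \<open>\<pi> \<circ> \<theta>\<close> is again uniform; the inner
  average is then the one over permutations. Only tuples with a repetition contribute an
  error.\<close>

lemma avg_tuples_vs_permutations:
  fixes f :: "(nat \<Rightarrow> nat) \<Rightarrow> real"
  assumes n: "n \<ge> 1" and K: "K \<subseteq> {..<n}" and \<iota>: "inj_on \<iota> K" "\<iota> ` K \<subseteq> {..<k}"
    and f01: "\<And>\<psi>. 0 \<le> f \<psi> \<and> f \<psi> \<le> 1"
    and fK: "\<And>\<psi> \<psi>'. (\<And>x. x \<in> K \<Longrightarrow> \<psi> x = \<psi>' x) \<Longrightarrow> f \<psi> = f \<psi>'"
  shows "\<bar>avg (tuples k {..<n}) (\<lambda>\<phi>. f (\<phi> \<circ> \<iota>)) - avg {\<pi>. \<pi> permutes {..<n}} f\<bar> \<le> real (k\<^sup>2) / real n"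
proof -
  let ?T = "tuples k {..<n}" and ?P = "{\<pi>. \<pi> permutes {..<n}}"
  have n0: "{..<n} \<noteq> {}" using n by (simp add: lessThan_empty_iff)
  have T: "finite ?T" "?T \<noteq> {}" using n0 by auto
  have P: "finite ?P" "?P \<noteq> {}" using permutes_id[of "{..<n}"] by (simp add: finite_permutations, blast)
  have "avg ?T (\<lambda>\<phi>. f (\<phi> \<circ> \<iota>)) = avg ?T (\<lambda>\<phi>. f (\<pi> \<circ> (\<phi> \<circ> \<iota>)))" if "\<pi> \<in> ?P" for \<pi>
  proof -
    have \<pi>: "\<pi> permutes {..<n}" using that by simp
    have "bij_betw (\<lambda>\<phi>. restrict (\<pi> \<circ> \<phi>) {..<k}) ?T ?T"
    proof (rule bij_betw_byWitness[where f' = "\<lambda>\<phi>. restrict (inv \<pi> \<circ> \<phi>) {..<k}"])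
      show "\<forall>\<phi>\<in>?T. restrict (inv \<pi> \<circ> restrict (\<pi> \<circ> \<phi>) {..<k}) {..<k} = \<phi>"
        using permutes_inverses[OF \<pi>] by (auto simp: tuples_def PiE_iff extensional_def restrict_def)
      show "\<forall>\<phi>\<in>?T. restrict (\<pi> \<circ> restrict (inv \<pi> \<circ> \<phi>) {..<k}) {..<k} = \<phi>"
        using permutes_inverses[OF \<pi>] by (auto simp: tuples_def PiE_iff extensional_def restrict_def)
      show "(\<lambda>\<phi>. restrict (\<pi> \<circ> \<phi>) {..<k}) ` ?T \<subseteq> ?T"
        using permutes_in_image[OF \<pi>] by (auto simp: tuples_def PiE_iff)
      show "(\<lambda>\<phi>. restrict (inv \<pi> \<circ> \<phi>) {..<k}) ` ?T \<subseteq> ?T"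
        using permutes_in_image[OF permutes_inv[OF \<pi>]] by (auto simp: tuples_def PiE_iff)
    qed
    then have "avg ?T (\<lambda>\<phi>. f (\<phi> \<circ> \<iota>)) = avg ?T (\<lambda>\<phi>. f (restrict (\<pi> \<circ> \<phi>) {..<k} \<circ> \<iota>))"
      by (rule avg_reindex[symmetric])
    also have "\<dots> = avg ?T (\<lambda>\<phi>. f (\<pi> \<circ> (\<phi> \<circ> \<iota>)))"
      using \<iota> by (intro avg_cong fK) auto
    finally show ?thesis .
  qed
  then have "avg ?P (\<lambda>_. avg ?T (\<lambda>\<phi>. f (\<phi> \<circ> \<iota>))) = avg ?P (\<lambda>\<pi>. avg ?T (\<lambda>\<phi>. f (\<pi> \<circ> (\<phi> \<circ> \<iota>))))"
    by (rule avg_cong)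
  then have "avg ?T (\<lambda>\<phi>. f (\<phi> \<circ> \<iota>)) = avg ?P (\<lambda>\<pi>. avg ?T (\<lambda>\<phi>. f (\<pi> \<circ> (\<phi> \<circ> \<iota>))))"
    by (simp only: avg_const[OF P])
  also have "\<dots> = avg ?T (\<lambda>\<phi>. avg ?P (\<lambda>\<pi>. f (\<pi> \<circ> (\<phi> \<circ> \<iota>))))" by (rule avg_swap)
  finally have "\<bar>avg ?T (\<lambda>\<phi>. f (\<phi> \<circ> \<iota>)) - avg ?P f\<bar>
      = \<bar>avg ?T (\<lambda>\<phi>. avg ?P (\<lambda>\<pi>. f (\<pi> \<circ> (\<phi> \<circ> \<iota>))) - avg ?P f)\<bar>"
    by (simp only: avg_diff avg_const[OF T])
  also have "\<dots> \<le> avg ?T (\<lambda>\<phi>. \<bar>avg ?P (\<lambda>\<pi>. f (\<pi> \<circ> (\<phi> \<circ> \<iota>))) - avg ?P f\<bar>)" by (rule abs_avg_le)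
  also have "\<dots> \<le> avg ?T (\<lambda>\<phi>. of_bool (\<not> inj_on (\<lambda>a. id (\<phi> a)) {..<k}))"
  proof (rule avg_mono)
    fix \<phi> assume \<phi>: "\<phi> \<in> ?T"
    show "\<bar>avg ?P (\<lambda>\<pi>. f (\<pi> \<circ> (\<phi> \<circ> \<iota>))) - avg ?P f\<bar> \<le> of_bool (\<not> inj_on (\<lambda>a. id (\<phi> a)) {..<k})"
    proof (cases "inj_on \<phi> {..<k}")
      case True
      have a: "inj_on (\<phi> \<circ> \<iota>) K" by (rule comp_inj_on[OF \<iota>(1) inj_on_subset[OF True \<iota>(2)]])
      have b: "(\<phi> \<circ> \<iota>) ` K \<subseteq> {..<n}" using \<iota> tuples_mem[OF \<phi>] by (auto simp: image_subset_iff)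
      obtain \<theta> where \<theta>: "\<theta> permutes {..<n}" "\<And>x. x \<in> K \<Longrightarrow> \<theta> x = (\<phi> \<circ> \<iota>) x"
        using permutes_extending[OF finite_lessThan K a b] by metis
      have "bij_betw (\<lambda>\<pi>. \<pi> \<circ> \<theta>) ?P ?P"
      proof (rule bij_betw_byWitness[where f' = "\<lambda>\<pi>. \<pi> \<circ> inv \<theta>"])
        show "\<forall>\<pi>\<in>?P. \<pi> \<circ> \<theta> \<circ> inv \<theta> = \<pi>" "\<forall>\<pi>\<in>?P. \<pi> \<circ> inv \<theta> \<circ> \<theta> = \<pi>"
          by (simp_all add: comp_assoc permutes_inv_o[OF \<theta>(1)])
        show "(\<lambda>\<pi>. \<pi> \<circ> \<theta>) ` ?P \<subseteq> ?P" "(\<lambda>\<pi>. \<pi> \<circ> inv \<theta>) ` ?P \<subseteq> ?P"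
          using permutes_compose[OF \<theta>(1)] permutes_compose[OF permutes_inv[OF \<theta>(1)]] by blast+
      qed
      then have "avg ?P (\<lambda>\<pi>. f (\<pi> \<circ> \<theta>)) = avg ?P f" by (rule avg_reindex)
      moreover have "avg ?P (\<lambda>\<pi>. f (\<pi> \<circ> \<theta>)) = avg ?P (\<lambda>\<pi>. f (\<pi> \<circ> (\<phi> \<circ> \<iota>)))"
        using \<theta>(2) by (intro avg_cong fK) auto
      ultimately show ?thesis using True by simp
    next
      case False
      have "0 \<le> avg ?P (\<lambda>\<pi>. f (\<pi> \<circ> (\<phi> \<circ> \<iota>)))" "avg ?P (\<lambda>\<pi>. f (\<pi> \<circ> (\<phi> \<circ> \<iota>))) \<le> 1"
        "0 \<le> avg ?P f" "avg ?P f \<le> 1"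
        using P f01 by (auto intro!: avg_lower avg_upper)
      then show ?thesis using False by simp
    qed
  qed
  also have "\<dots> \<le> real (k\<^sup>2) * (1 / real n)"
  proof (rule avg_not_inj_le)
    fix z
    have "{v \<in> {..<n}. id v = z} \<subseteq> {z}" by auto
    from card_mono[OF _ this] show "real (card {v \<in> {..<n}. id v = z}) \<le> 1 / real n * real (card {..<n})"
      using n by simp
  qed (use n0 in auto)
  finally show ?thesis by simp
qed

section \<open>Accepting leaves of decision trees as certificates\<close>

definition adj :: "sgraph \<Rightarrow> nat \<Rightarrow> nat \<Rightarrow> bool" where
  "adj G u v \<longleftrightarrow> {u, v} \<in> edges G"

lemma adj_sym: "adj G u v = adj G v u"
  by (simp add: adj_def insert_commute)

text \<open>A leaf of the tree up to the order and the repetition of its queries: the pairs found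
  adjacent and those found non-adjacent on the path of \<open>G\<close>.\<close>

definition trace :: "'r qtree \<Rightarrow> sgraph \<Rightarrow> nat set set \<times> nat set set" where
  "trace t G = ({{u, v} |u v. (u, v) \<in> set (queries G t) \<and> {u, v} \<in> edges G},
                {{u, v} |u v. (u, v) \<in> set (queries G t) \<and> {u, v} \<notin> edges G})"

definition holds :: "nat set set \<times> nat set set \<Rightarrow> sgraph \<Rightarrow> (nat \<Rightarrow> nat) \<Rightarrow> bool" where
  "holds x G \<psi> \<longleftrightarrow> (\<forall>e\<in>fst x. \<psi> ` e \<in> edges G) \<and> (\<forall>e\<in>snd x. \<psi> ` e \<notin> edges G)"

lemma holds_trace: "holds (trace t G) G id"
  by (auto simp: holds_def trace_def)

lemma holds_trace_iff:
  "holds (trace t G) G' id \<longleftrightarrow>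
    (\<forall>u v. (u, v) \<in> set (queries G t) \<longrightarrow> ({u, v} \<in> edges G' \<longleftrightarrow> {u, v} \<in> edges G))"
  unfolding holds_def trace_def by simp blast

lemma queries_result_cong:
  assumes "\<And>u v. (u, v) \<in> set (queries G t) \<Longrightarrow> {u, v} \<in> edges G' \<longleftrightarrow> {u, v} \<in> edges G"
  shows "queries G' t = queries G t \<and> result G' t = result G t"
  using assms
proof (induction t)
  case (Query u v s t)
  have "{u, v} \<in> edges G' \<longleftrightarrow> {u, v} \<in> edges G" using Query.prems by simp
  then show ?case using Query by (cases "{u, v} \<in> edges G") simp_all
qed simp

text \<open>A graph that agrees with the answers on a path follows that path. Hence among the traces
  of a tree a graph satisfies only its own.\<close>

lemma holds_trace_imp:
  assumes "holds (trace t G) G' id"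
  shows "queries G' t = queries G t" "result G' t = result G t" "trace t G = trace t G'"
proof -
  have e: "{u, v} \<in> edges G' \<longleftrightarrow> {u, v} \<in> edges G" if "(u, v) \<in> set (queries G t)" for u v
    using assms that unfolding holds_trace_iff by blast
  from queries_result_cong[of G t G', OF e]
  show q: "queries G' t = queries G t" and "result G' t = result G t" by blast+
  show "trace t G = trace t G'" unfolding trace_def q using e by (intro arg_cong2[where f=Pair]) blast+
qed

definition answers :: "sgraph \<Rightarrow> 'r qtree \<Rightarrow> bool list" where
  "answers G t = map (\<lambda>(u, v). {u, v} \<in> edges G) (queries G t)"

lemma answers_eq_imp_trace_eq:
  assumes "answers G t = answers G' t"
  shows "trace t G = trace t G'"
proof -
  have q: "queries G t = queries G' t"
    using assms
  proof (induction t)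
    case (Query u v s t)
    then show ?case by (cases "{u, v} \<in> edges G") (auto simp: answers_def split: if_splits)
  qed simp
  have "map (\<lambda>(u, v). {u, v} \<in> edges G) (queries G t) = map (\<lambda>(u, v). {u, v} \<in> edges G') (queries G t)"
    using assms q by (simp add: answers_def)
  then have e: "{u, v} \<in> edges G \<longleftrightarrow> {u, v} \<in> edges G'" if "(u, v) \<in> set (queries G t)" for u v
    using that unfolding map_eq_conv by fastforce
  show ?thesis unfolding trace_def q[symmetric] using e by (intro arg_cong2[where f=Pair]) blast+
qed

definition certs :: "nat \<Rightarrow> decision qtree \<Rightarrow> (nat set set \<times> nat set set) set" where
  "certs n t = {trace t G | G. simple_graph G \<and> nverts G = n \<and> result G t = Accept}"

text \<open>A trace is determined by the list of answers, and there are fewer than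
  \<open>2 ^ (q + 1)\<close> lists of at most \<open>q\<close> bits. The number of vertices does not
  enter.\<close>

lemma certs_card:
  assumes "\<And>G. simple_graph G \<Longrightarrow> nverts G = n \<Longrightarrow> length (queries G t) \<le> q"
  shows "finite (certs n t) \<and> card (certs n t) \<le> 2 ^ (q + 1)"
proof -
  define B where "B = {bs :: bool list. set bs \<subseteq> UNIV \<and> length bs \<le> q}"
  define pick where "pick = (\<lambda>bs. SOME G. simple_graph G \<and> nverts G = n \<and> answers G t = bs)"
  have sub: "certs n t \<subseteq> (\<lambda>bs. trace t (pick bs)) ` B"
  proof
    fix x assume "x \<in> certs n t"
    then obtain G where G: "x = trace t G" "simple_graph G" "nverts G = n" by (auto simp: certs_def)
    have "answers (pick (answers G t)) t = answers G t"
      unfolding pick_def using someI[of "\<lambda>G'. simple_graph G' \<and> nverts G' = n \<and> answers G' t = answers G t" G] G by simp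
    then have "x = trace t (pick (answers G t))" using answers_eq_imp_trace_eq G(1) by metis
    moreover have "answers G t \<in> B" using assms[OF G(2,3)] by (simp add: B_def answers_def)
    ultimately show "x \<in> (\<lambda>bs. trace t (pick bs)) ` B" by blast
  qed
  have finB: "finite B" unfolding B_def by (rule finite_lists_length_le) simp
  have "card B = (\<Sum>i\<le>q. 2 ^ i)" unfolding B_def by (subst card_lists_length_le) (simp_all add: card_UNIV_bool)
  also have "\<dots> = (\<Sum>i=0..<Suc q. 2 ^ i)" by (intro sum.cong) auto
  also have "\<dots> \<le> 2 ^ (q + 1)" by (simp add: sum_power2)
  finally have "card B \<le> 2 ^ (q + 1)" .
  moreover have "card (certs n t) \<le> card B" using surj_card_le[OF finB sub] .
  ultimately show ?thesis using finite_surj[OF finB sub] by linarith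
qed

text \<open>A finite index set common to all trees, so that the expectation over the random tree can
  be exchanged with a finite sum. Its size depends on \<open>n\<close>; only the total weight
  carried by it is bounded independently of \<open>n\<close>.\<close>

definition cert_index :: "nat \<Rightarrow> nat \<Rightarrow> (nat set set \<times> nat set set) set" where
  "cert_index n q = {(A, B). A \<union> B \<subseteq> {e. e \<subseteq> {..<n} \<and> card e = 2} \<and> A \<inter> B = {} \<and> card (A \<union> B) \<le> q}"

lemma finite_cert_index: "finite (cert_index n q)"
  by (rule finite_subset[of _ "Pow (Pow {..<n}) \<times> Pow (Pow {..<n})"]) (auto simp: cert_index_def)

lemma trace_in_cert_index:
  assumes "\<forall>(u, v)\<in>set (queries G t). u < n \<and> v < n \<and> u \<noteq> v" "length (queries G t) \<le> q"
  shows "trace t G \<in> cert_index n q"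
proof -
  have U: "fst (trace t G) \<union> snd (trace t G) = (\<lambda>(u, v). {u, v}) ` set (queries G t)"
    by (auto simp: trace_def)
  have "card (fst (trace t G) \<union> snd (trace t G)) \<le> length (queries G t)"
    unfolding U using card_image_le[of "set (queries G t)"] card_length[of "queries G t"] by (meson List.finite_set order_trans)
  moreover have "fst (trace t G) \<union> snd (trace t G) \<subseteq> {e. e \<subseteq> {..<n} \<and> card e = 2}"
    unfolding U using assms(1) by (fastforce simp: card_insert_if)
  moreover have "fst (trace t G) \<inter> snd (trace t G) = {}" by (auto simp: trace_def)
  ultimately show ?thesis using assms(2) by (simp add: cert_index_def case_prod_beta)
qed

text \<open>For a fixed tree the only accepting certificate that can hold in \<open>G\<close> is the
  trace of \<open>G\<close>. The indicator of acceptance is therefore a sum over certificates, and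
  expectations are taken termwise.\<close>

lemma prob_accept_eq_certs:
  fixes D :: "decision qtree pmf"
  assumes D: "\<And>t G. t \<in> set_pmf D \<Longrightarrow> simple_graph G \<Longrightarrow> nverts G = n \<Longrightarrow>
      (\<forall>(u, v)\<in>set (queries G t). u < n \<and> v < n \<and> u \<noteq> v) \<and> length (queries G t) \<le> q"
    and G: "simple_graph G" "nverts G = n"
  shows "measure_pmf.prob D {t. result G t = Accept}
    = (\<Sum>x\<in>cert_index n q. measure_pmf.prob D {t. x \<in> certs n t} * of_bool (holds x G id))"
proof -
  have "measure_pmf.prob D {t. result G t = Accept}
      = measure_pmf.expectation D (indicator {t. result G t = Accept})" by simp
  also have "\<dots> = measure_pmf.expectation D (\<lambda>t. \<Sum>x\<in>cert_index n q. indicator {t. x \<in> certs n t} t * of_bool (holds x G id))"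
  proof (rule integral_cong_AE)
    show "AE t in D. indicator {t. result G t = Accept} t
        = (\<Sum>x\<in>cert_index n q. indicator {t. x \<in> certs n t} t * of_bool (holds x G id) :: real)"
    proof (rule AE_pmfI)
      fix t assume t: "t \<in> set_pmf D"
      have tr: "trace t G \<in> cert_index n q" using D[OF t G] by (intro trace_in_cert_index) auto
      have "indicator {t. x \<in> certs n t} t * of_bool (holds x G id)
          = (if x = trace t G then indicator {t. result G t = Accept} t else 0 :: real)" for x
      proof (cases "x \<in> certs n t \<and> holds x G id")
        case True
        then obtain G' where G': "x = trace t G'" "result G' t = Accept" by (auto simp: certs_def)
        then have "x = trace t G" "result G t = Accept"
          using True holds_trace_imp[of t G' G] by auto
        then show ?thesis using True by simp
      next
        case False
        then have "\<not> (x = trace t G \<and> result G t = Accept)"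
          using holds_trace[of t G] G by (auto simp: certs_def)
        then show ?thesis using False by (auto simp: indicator_def)
      qed
      then show "indicator {t. result G t = Accept} t
        = (\<Sum>x\<in>cert_index n q. indicator {t. x \<in> certs n t} t * of_bool (holds x G id) :: real)"
        using tr finite_cert_index[of n q] by simp
    qed
  qed auto
  also have "\<dots> = (\<Sum>x\<in>cert_index n q. measure_pmf.expectation D (\<lambda>t. indicator {t. x \<in> certs n t} t * of_bool (holds x G id)))"
    by (intro Bochner_Integration.integral_sum integrable_mult_left measure_pmf.integrable_const_bound[where B=1]) auto
  also have "\<dots> = (\<Sum>x\<in>cert_index n q. measure_pmf.prob D {t. x \<in> certs n t} * of_bool (holds x G id))"
    by (intro sum.cong) auto
  finally show ?thesis .
qed

text \<open>The left side is the expected number of accepting certificates in \<open>I\<close>, and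
  each single tree has at most \<open>2 ^ (q + 1)\<close> of them.\<close>

lemma sum_prob_certs:
  fixes D :: "decision qtree pmf"
  assumes D: "\<And>t G. t \<in> set_pmf D \<Longrightarrow> simple_graph G \<Longrightarrow> nverts G = n \<Longrightarrow> length (queries G t) \<le> q"
    and I: "finite I"
  shows "(\<Sum>x\<in>I. measure_pmf.prob D {t. x \<in> certs n t}) \<le> 2 ^ (q + 1)"
proof -
  have "(\<Sum>x\<in>I. measure_pmf.prob D {t. x \<in> certs n t})
     = (\<Sum>x\<in>I. measure_pmf.expectation D (indicator {t. x \<in> certs n t}))" by simp
  also have "\<dots> = measure_pmf.expectation D (\<lambda>t. \<Sum>x\<in>I. indicator {t. x \<in> certs n t} t)"
    by (intro Bochner_Integration.integral_sum[symmetric] measure_pmf.integrable_const_bound[where B=1]) auto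
  also have "\<dots> \<le> measure_pmf.expectation D (\<lambda>_. 2 ^ (q + 1))"
  proof (rule integral_mono_AE)
    show "AE t in D. (\<Sum>x\<in>I. indicator {t. x \<in> certs n t} t) \<le> (2 ^ (q + 1) :: real)"
    proof (rule AE_pmfI)
      fix t assume t: "t \<in> set_pmf D"
      have "(\<Sum>x\<in>I. indicator {t. x \<in> certs n t} t :: real) = real (card {x\<in>I. x \<in> certs n t})"
        using I by (simp add: indicator_def sum.If_cases Int_def)
      also have "\<dots> \<le> real (card (certs n t))"
        using certs_card[of n t q] D[OF t] by (intro of_nat_mono card_mono) auto
      also have "\<dots> \<le> 2 ^ (q + 1)" using certs_card[of n t q] D[OF t] by (metis of_nat_le_iff of_nat_numeral of_nat_power)
      finally show "(\<Sum>x\<in>I. indicator {t. x \<in> certs n t} t) \<le> (2 ^ (q + 1) :: real)" .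
    qed
    show "integrable D (\<lambda>t. \<Sum>x\<in>I. indicator {t. x \<in> certs n t} t :: real)"
      by (intro Bochner_Integration.integrable_sum measure_pmf.integrable_const_bound[where B=1]) auto
  qed auto
  finally show ?thesis by simp
qed

section \<open>Relabelling the vertices\<close>

definition perm_graph :: "(nat \<Rightarrow> nat) \<Rightarrow> sgraph \<Rightarrow> sgraph" where
  "perm_graph \<pi> G = \<lparr>nverts = nverts G,
    edges = {e. e \<subseteq> {..<nverts G} \<and> card e = 2 \<and> \<pi> ` e \<in> edges G}\<rparr>"

lemma perm_graph_nverts [simp]: "nverts (perm_graph \<pi> G) = nverts G"
  by (simp add: perm_graph_def)

lemma simple_perm_graph: "simple_graph G \<Longrightarrow> simple_graph (perm_graph \<pi> G)"
  by (auto simp: perm_graph_def simple_graph_def)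

text \<open>The relabelled graph is a pull-back along \<open>\<pi>\<close>, so checking a
  certificate in it means placing the certificate in \<open>G\<close> by \<open>\<pi>\<close>. This
  turns random relabelling into random placement.\<close>

lemma holds_perm_graph:
  assumes "x \<in> cert_index (nverts G) q"
  shows "holds x (perm_graph \<pi> G) id \<longleftrightarrow> holds x G \<pi>"
proof -
  have "e \<in> edges (perm_graph \<pi> G) \<longleftrightarrow> \<pi> ` e \<in> edges G" if "e \<in> fst x \<union> snd x" for e
    using assms that by (auto simp: cert_index_def perm_graph_def)
  then show ?thesis by (simp add: holds_def)
qed

lemma perm_graph_in_property:
  assumes P: "graph_property P" "G \<in> P" and \<pi>: "\<pi> permutes {..<nverts G}"
  shows "perm_graph \<pi> G \<in> P"
proof -
  have sG: "simple_graph G" using P by (auto simp: graph_property_def)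
  have "isomorphic G (perm_graph \<pi> G)"
    unfolding isomorphic_def
  proof (intro exI conjI allI impI)
    \<comment> \<open>A pull-back along \<open>\<pi>\<close> is an image under its inverse.\<close>
    show "bij_betw (inv \<pi>) {..<nverts G} {..<nverts (perm_graph \<pi> G)}"
      using permutes_imp_bij[OF permutes_inv[OF \<pi>]] by simp
    fix u v assume uv: "u < nverts G" "v < nverts G"
    have im: "\<pi> ` {inv \<pi> u, inv \<pi> v} = {u, v}" using permutes_inverses[OF \<pi>] by simp
    have sub: "{inv \<pi> u, inv \<pi> v} \<subseteq> {..<nverts G}"
      using uv permutes_in_image[OF permutes_inv[OF \<pi>]] by auto
    have "card {inv \<pi> u, inv \<pi> v} = card {u, v}"
      unfolding im[symmetric] using permutes_inj[OF \<pi>] by (metis card_image inj_on_subset subset_UNIV)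
    moreover have "card {u, v} = 2" if "{u, v} \<in> edges G"
      using that sG by (auto simp: simple_graph_def)
    ultimately show "{u, v} \<in> edges G \<longleftrightarrow> {inv \<pi> u, inv \<pi> v} \<in> edges (perm_graph \<pi> G)"
      using im sub by (auto simp: perm_graph_def)
  qed
  then show ?thesis
    using P simple_perm_graph[OF sG] unfolding graph_property_def by blast
qed

text \<open>Moving edges by \<open>\<pi>\<close> matches the symmetric difference of the relabelled
  graph and \<open>H\<close> with that of \<open>G\<close> and \<open>H\<close> relabelled by
  \<open>inv \<pi>\<close>, which lies in the property again.\<close>

lemma far_from_perm_graph:
  assumes P: "graph_property P" and sG: "simple_graph G" and \<pi>: "\<pi> permutes {..<nverts G}"
    and far: "far_from \<beta> P G"
  shows "far_from \<beta> P (perm_graph \<pi> G)"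
  unfolding far_from_def
proof (intro ballI impI)
  fix H assume H: "H \<in> P" "nverts H = nverts (perm_graph \<pi> G)"
  define H' where "H' = perm_graph (inv \<pi>) H"
  have nH: "nverts H = nverts G" using H by simp
  have sH: "simple_graph H" using P H by (auto simp: graph_property_def)
  have \<pi>': "inv \<pi> permutes {..<nverts H}" using permutes_inv[OF \<pi>] nH by simp
  have H'P: "H' \<in> P" unfolding H'_def by (rule perm_graph_in_property[OF P H(1) \<pi>'])
  have inj: "inj \<pi>" by (rule permutes_inj[OF \<pi>])
  have ii: "inv \<pi> ` \<pi> ` e = e" for e using permutes_inverses[OF \<pi>] by (auto simp: image_image)
  have ii': "\<pi> ` inv \<pi> ` e = e" for e using permutes_inverses[OF \<pi>] by (auto simp: image_image)
  have dom: "e \<subseteq> {..<nverts G} \<and> card e = 2 \<longleftrightarrow> \<pi> ` e \<subseteq> {..<nverts G} \<and> card (\<pi> ` e) = 2" for e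
    using permutes_in_image[OF \<pi>] card_image[OF inj_on_subset[OF inj subset_UNIV], of e]
    by (auto simp: image_subset_iff subset_iff)
  have valid: "e \<in> edges G \<Longrightarrow> e \<subseteq> {..<nverts G} \<and> card e = 2"
    "e \<in> edges H \<Longrightarrow> e \<subseteq> {..<nverts G} \<and> card e = 2" for e
    using sG sH nH by (auto simp: simple_graph_def)
  have 1: "e \<in> edges (perm_graph \<pi> G) \<longleftrightarrow> \<pi> ` e \<in> edges G" for e
    using valid(1)[of "\<pi> ` e"] dom[of e] unfolding perm_graph_def by simp blast
  have 2: "\<pi> ` e \<in> edges H' \<longleftrightarrow> e \<in> edges H" for e
    using valid(2)[of e] dom[of e] unfolding perm_graph_def H'_def by (simp add: nH ii) blast
  let ?A = "(edges (perm_graph \<pi> G) - edges H) \<union> (edges H - edges (perm_graph \<pi> G))"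
  let ?B = "(edges G - edges H') \<union> (edges H' - edges G)"
  have mem: "\<pi> ` e \<in> ?B \<longleftrightarrow> e \<in> ?A" for e using 1 2 by auto
  have "(`) \<pi> ` ?A = ?B"
  proof
    show "(`) \<pi> ` ?A \<subseteq> ?B" using mem by blast
    show "?B \<subseteq> (`) \<pi> ` ?A"
    proof
      fix e assume "e \<in> ?B"
      then have "inv \<pi> ` e \<in> ?A" using mem[of "inv \<pi> ` e"] unfolding ii' by blast
      then show "e \<in> (`) \<pi> ` ?A" using ii'[of e] by (metis imageI)
    qed
  qed
  moreover have "inj_on ((`) \<pi>) ?A" by (rule inj_on_inverseI[where g="(`) (inv \<pi>)"]) (simp add: ii)
  ultimately have "card ?A = card ?B" using card_image by metis
  then have "edit_distance (perm_graph \<pi> G) H = edit_distance G H'" by (simp add: edit_distance_def)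
  moreover have "nverts H' = nverts G" using nH by (simp add: H'_def)
  ultimately show "\<beta> * (real (nverts (perm_graph \<pi> G)))\<^sup>2 \<le> real (edit_distance (perm_graph \<pi> G) H)"
    using far H'P by (auto simp: far_from_def)
qed

section \<open>Certificates as patterns on numbered positions\<close>

definition cert_enum :: "nat set set \<times> nat set set \<Rightarrow> nat \<Rightarrow> nat" where
  "cert_enum x = (SOME h. bij_betw h {..<card (\<Union>(fst x \<union> snd x))} (\<Union>(fst x \<union> snd x)))"

definition cert_pairs :: "nat set set \<times> nat set set \<Rightarrow> (nat \<times> nat) set" where
  "cert_pairs x = {(a, b). a < b \<and> b < card (\<Union>(fst x \<union> snd x)) \<and>
     {cert_enum x a, cert_enum x b} \<in> fst x \<union> snd x}"

definition cert_sign :: "nat set set \<times> nat set set \<Rightarrow> nat \<times> nat \<Rightarrow> bool" where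
  "cert_sign x e \<longleftrightarrow> {cert_enum x (fst e), cert_enum x (snd e)} \<in> fst x"

definition edge_ind :: "sgraph \<Rightarrow> nat \<Rightarrow> nat \<Rightarrow> real" where
  "edge_ind G u v = of_bool (adj G u v)"

lemma cert_vertices:
  assumes x: "x \<in> cert_index n q"
  defines "K \<equiv> \<Union>(fst x \<union> snd x)"
  shows "K \<subseteq> {..<n}" "finite K" "card K \<le> 2 * q" "bij_betw (cert_enum x) {..<card K} K"
proof -
  show K: "K \<subseteq> {..<n}" using x by (auto simp: K_def cert_index_def)
  then show finK: "finite K" by (rule finite_subset) simp
  have fin: "finite (fst x \<union> snd x)"
    by (rule finite_subset[of _ "Pow {..<n}"]) (use x in \<open>auto simp: cert_index_def\<close>)
  have "card K \<le> (\<Sum>e\<in>fst x \<union> snd x. card e)"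
    unfolding K_def using card_UN_le[OF fin, of "\<lambda>e. e"] by simp
  also have "\<dots> = (\<Sum>e\<in>fst x \<union> snd x. 2)" using x by (intro sum.cong) (auto simp: cert_index_def)
  also have "\<dots> \<le> 2 * q" using x by (auto simp: cert_index_def)
  finally show "card K \<le> 2 * q" .
  have "\<exists>h. bij_betw h {..<card K} K" using finK ex_bij_betw_nat_finite[of K] by (simp add: atLeast0LessThan)
  then show "bij_betw (cert_enum x) {..<card K} K"
    unfolding cert_enum_def K_def by (rule someI_ex)
qed

lemma cert_pairs_card:
  assumes x: "x \<in> cert_index n q"
  shows "card (cert_pairs x) \<le> q"
proof -
  let ?K = "\<Union>(fst x \<union> snd x)" and ?h = "cert_enum x"
  have inj: "inj_on ?h {..<card ?K}" using cert_vertices(4)[OF x] by (simp add: bij_betw_def)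
  have fin: "finite (fst x \<union> snd x)"
    by (rule finite_subset[of _ "Pow {..<n}"]) (use x in \<open>auto simp: cert_index_def\<close>)
  have "inj_on (\<lambda>e. {?h (fst e), ?h (snd e)}) (cert_pairs x)"
  proof (rule inj_onI)
    fix e e' assume e: "e \<in> cert_pairs x" "e' \<in> cert_pairs x"
      and eq: "{?h (fst e), ?h (snd e)} = {?h (fst e'), ?h (snd e')}"
    have lt: "fst e < snd e" "snd e < card ?K" "fst e' < snd e'" "snd e' < card ?K"
      using e by (auto simp: cert_pairs_def)
    have "?h ` {fst e, snd e} = ?h ` {fst e', snd e'}" using eq by simp
    then have "{fst e, snd e} = {fst e', snd e'}"
      using inj lt by (subst (asm) inj_on_image_eq_iff[of ?h "{..<card ?K}"]) auto
    then show "e = e'" using lt by (auto simp: doubleton_eq_iff prod_eq_iff)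
  qed
  moreover have "(\<lambda>e. {?h (fst e), ?h (snd e)}) ` cert_pairs x \<subseteq> fst x \<union> snd x"
    by (auto simp: cert_pairs_def)
  ultimately have "card (cert_pairs x) \<le> card (fst x \<union> snd x)" using fin by (rule card_inj_on_le)
  also have "\<dots> \<le> q" using x by (auto simp: cert_index_def)
  finally show ?thesis .
qed

text \<open>\<open>cert_enum\<close> numbers the vertices of the certificate, so its inverse
  followed by \<open>\<phi>\<close> places the certificate in \<open>G\<close>. Each certified pair
  occurs once in \<open>cert_pairs\<close>, with increasing positions.\<close>

lemma cert_pat_eq_holds:
  assumes x: "x \<in> cert_index n q"
  defines "K \<equiv> \<Union>(fst x \<union> snd x)"
  shows "pat (cert_pairs x) (cert_sign x) (edge_ind G) \<phi>
    = of_bool (holds x G (\<phi> \<circ> inv_into {..<card K} (cert_enum x)))"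
proof -
  let ?h = "cert_enum x" and ?\<iota> = "inv_into {..<card K} (cert_enum x)"
  have bij: "bij_betw ?h {..<card K} K" using cert_vertices(4)[OF x] by (simp add: K_def)
  have inv: "?\<iota> (?h a) = a" if "a < card K" for a using bij that by (simp add: bij_betw_def inv_into_f_f)
  have disj: "fst x \<inter> snd x = {}" using x by (auto simp: cert_index_def)
  have fin: "finite (cert_pairs x)"
    by (rule finite_subset[of _ "{..<card K} \<times> {..<card K}"]) (auto simp: cert_pairs_def K_def)
  have "pat (cert_pairs x) (cert_sign x) (edge_ind G) \<phi>
     = (\<Prod>e\<in>cert_pairs x. of_bool (adj G (\<phi> (fst e)) (\<phi> (snd e)) = cert_sign x e))"
    unfolding pat_def by (intro prod.cong) (auto simp: lit_def edge_ind_def)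
  also have "\<dots> = of_bool (\<forall>e\<in>cert_pairs x. adj G (\<phi> (fst e)) (\<phi> (snd e)) = cert_sign x e)"
    using fin by (induction rule: finite_induct) auto
  also have "(\<forall>e\<in>cert_pairs x. adj G (\<phi> (fst e)) (\<phi> (snd e)) = cert_sign x e) \<longleftrightarrow> holds x G (\<phi> \<circ> ?\<iota>)"
  proof
    assume L: "\<forall>e\<in>cert_pairs x. adj G (\<phi> (fst e)) (\<phi> (snd e)) = cert_sign x e"
    have "(\<phi> \<circ> ?\<iota>) ` e \<in> edges G \<longleftrightarrow> e \<in> fst x" if e: "e \<in> fst x \<union> snd x" for e
    proof -
      have "card e = 2" using e x by (auto simp: cert_index_def)
      then obtain u v where uv: "e = {u, v}" "u \<noteq> v" by (auto simp: card_2_iff)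
      have "u \<in> ?h ` {..<card K}" "v \<in> ?h ` {..<card K}"
        using bij uv(1) e by (auto simp: bij_betw_def K_def)
      then obtain a b where ab: "a < card K" "b < card K" "u = ?h a" "v = ?h b" by auto
      have "a \<noteq> b" using ab uv by auto
      then obtain a' b' where ab': "a' < b'" "b' < card K" "e = {?h a', ?h b'}"
        using ab uv(1) by (metis insert_commute linorder_neqE_nat)
      then have "(a', b') \<in> cert_pairs x" using e by (auto simp: cert_pairs_def K_def)
      from bspec[OF L this] have "{\<phi> a', \<phi> b'} \<in> edges G \<longleftrightarrow> e \<in> fst x"
        using ab' by (simp add: adj_def cert_sign_def)
      moreover have "(\<phi> \<circ> ?\<iota>) ` e = {\<phi> a', \<phi> b'}" using ab' inv by simp
      ultimately show ?thesis by simp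
    qed
    then show "holds x G (\<phi> \<circ> ?\<iota>)" using disj unfolding holds_def by blast
  next
    assume R: "holds x G (\<phi> \<circ> ?\<iota>)"
    show "\<forall>e\<in>cert_pairs x. adj G (\<phi> (fst e)) (\<phi> (snd e)) = cert_sign x e"
    proof
      fix e assume e: "e \<in> cert_pairs x"
      let ?e = "{?h (fst e), ?h (snd e)}"
      have "(\<phi> \<circ> ?\<iota>) ` ?e = {\<phi> (fst e), \<phi> (snd e)}"
        using e inv by (auto simp: cert_pairs_def K_def)
      moreover have "?e \<in> fst x \<union> snd x" using e by (auto simp: cert_pairs_def)
      ultimately show "adj G (\<phi> (fst e)) (\<phi> (snd e)) = cert_sign x e"
        using R unfolding holds_def adj_def cert_sign_def by (metis Un_iff)
    qed
  qed
  finally show ?thesis .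
qed

text \<open>The patterns are the leaves of the decision trees, not the induced subgraphs seen by a
  canonical tester, which keeps their total weight at most 2^(q+1).\<close>

lemma tester_patterns:
  fixes q k n :: nat
  assumes P: "graph_property P" and T: "tester \<beta> P T" "makes_at_most_queries T (real q)"
    and n: "n \<ge> 1" and k: "4 \<le> k" "2 * q \<le> k"
  defines "e0 \<equiv> 2 ^ (q + 1) * real (k\<^sup>2) / real n"
  shows "\<exists>c. pattern_family k (cert_index n q) c cert_pairs (2 ^ (q + 1)) q \<and>
    (\<forall>G. simple_graph G \<longrightarrow> nverts G = n \<longrightarrow>
      (let p = avg (tuples k {..<n}) (pattern_family.dens (cert_index n q) c cert_pairs cert_sign (edge_ind G))
       in (G \<in> P \<longrightarrow> 2/3 - e0 \<le> p) \<and> (far_from \<beta> P G \<longrightarrow> p \<le> 1/3 + e0) \<and> p \<le> 1 + e0))"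
proof -
  define I where "I = cert_index n q"
  define c where "c = (\<lambda>x. measure_pmf.prob (T n) {t. x \<in> certs n t})"
  have D: "(\<forall>(u, v)\<in>set (queries G t). u < n \<and> v < n \<and> u \<noteq> v) \<and> length (queries G t) \<le> q"
    if "t \<in> set_pmf (T n)" "simple_graph G" "nverts G = n" for t G
  proof -
    have "\<forall>t\<in>set_pmf (T (nverts G)). (\<forall>(u, v)\<in>set (queries G t). u < nverts G \<and> v < nverts G \<and> u \<noteq> v)
        \<and> real (length (queries G t)) \<le> real q"
      by (rule T(2)[unfolded makes_at_most_queries_def, THEN spec, THEN mp, OF that(2)])
    from bspec[OF this, of t] show ?thesis using that by simp
  qed
  have c_sum: "sum c I \<le> 2 ^ (q + 1)"
    unfolding c_def I_def using D finite_cert_index by (intro sum_prob_certs) auto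
  have pf: "pattern_family k I c cert_pairs (2 ^ (q + 1)) q"
  proof
    fix i e assume i: "i \<in> I" and e: "e \<in> cert_pairs i"
    have "card (\<Union>(fst i \<union> snd i)) \<le> k" using cert_vertices(3)[of i n q] i k(2) unfolding I_def by linarith
    then show "fst e < snd e \<and> snd e < k" using e by (auto simp: cert_pairs_def)
  next
    fix i assume "i \<in> I" then show "card (cert_pairs i) \<le> q" using cert_pairs_card by (auto simp: I_def)
  next
    show "(1::real) \<le> 2 ^ (q + 1)" by (rule one_le_power) simp
  qed (use k c_sum finite_cert_index in \<open>auto simp: I_def c_def\<close>)
  interpret pattern_family k I c cert_pairs cert_sign "2 ^ (q + 1)" q by (rule pf)
  let ?P = "{\<pi>. \<pi> permutes {..<n}}"
  have finP: "finite ?P" "?P \<noteq> {}" using permutes_id[of "{..<n}"] by (simp add: finite_permutations, blast)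
  \<comment> \<open>The tester may depend on vertex names. Averaging over all relabellings removes
    this, and its guarantees survive because the property and the distance to it are
    invariant.\<close>
  define acc where "acc = (\<lambda>G. avg ?P (\<lambda>\<pi>. prob_output T (perm_graph \<pi> G) Accept))"
  have close: "\<bar>avg (tuples k {..<n}) (dens (edge_ind G)) - acc G\<bar> \<le> e0"
    if G: "simple_graph G" "nverts G = n" for G
  proof -
    have "acc G = avg ?P (\<lambda>\<pi>. \<Sum>x\<in>I. c x * of_bool (holds x G \<pi>))"
      unfolding acc_def
    proof (rule avg_cong)
      fix \<pi>
      have sp: "simple_graph (perm_graph \<pi> G)" "nverts (perm_graph \<pi> G) = n"
        using simple_perm_graph[OF G(1)] G(2) by auto
      have "prob_output T (perm_graph \<pi> G) Accept = (\<Sum>x\<in>I. c x * of_bool (holds x (perm_graph \<pi> G) id))"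
        unfolding prob_output_def c_def I_def sp(2) by (rule prob_accept_eq_certs[OF D sp])
      also have "\<dots> = (\<Sum>x\<in>I. c x * of_bool (holds x G \<pi>))"
        using holds_perm_graph[of _ G q] G(2) by (intro sum.cong) (auto simp: I_def)
      finally show "prob_output T (perm_graph \<pi> G) Accept = (\<Sum>x\<in>I. c x * of_bool (holds x G \<pi>))" .
    qed
    also have "\<dots> = (\<Sum>x\<in>I. c x * avg ?P (\<lambda>\<pi>. of_bool (holds x G \<pi>)))"
      by (simp only: avg_sum avg_cmult)
    finally have 1: "acc G = (\<Sum>x\<in>I. c x * avg ?P (\<lambda>\<pi>. of_bool (holds x G \<pi>)))" .
    have "avg (tuples k {..<n}) (dens (edge_ind G))
       = (\<Sum>x\<in>I. c x * avg (tuples k {..<n}) (pat (cert_pairs x) (cert_sign x) (edge_ind G)))"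
      unfolding dens_def by (simp only: avg_sum avg_cmult)
    then have "\<bar>avg (tuples k {..<n}) (dens (edge_ind G)) - acc G\<bar>
      = \<bar>\<Sum>x\<in>I. c x * (avg (tuples k {..<n}) (pat (cert_pairs x) (cert_sign x) (edge_ind G))
           - avg ?P (\<lambda>\<pi>. of_bool (holds x G \<pi>)))\<bar>"
      unfolding 1 by (simp add: sum_subtractf right_diff_distrib)
    also have "\<dots> \<le> (\<Sum>x\<in>I. c x * (real (k\<^sup>2) / real n))"
    proof (rule order_trans[OF sum_abs sum_mono])
      fix x assume "x \<in> I"
      then have x: "x \<in> cert_index n q" by (simp add: I_def)
      let ?K = "\<Union>(fst x \<union> snd x)"
      let ?\<iota> = "inv_into {..<card ?K} (cert_enum x)"
      have bij: "bij_betw ?\<iota> ?K {..<card ?K}" using cert_vertices(4)[OF x] by (rule bij_betw_inv_into)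
      have "\<bar>avg (tuples k {..<n}) (\<lambda>\<phi>. of_bool (holds x G (\<phi> \<circ> ?\<iota>)))
           - avg ?P (\<lambda>\<pi>. of_bool (holds x G \<pi>))\<bar> \<le> real (k\<^sup>2) / real n"
      proof (rule avg_tuples_vs_permutations[OF n cert_vertices(1)[OF x]])
        show "inj_on ?\<iota> ?K" using bij by (simp add: bij_betw_def)
        show "?\<iota> ` ?K \<subseteq> {..<k}" using bij cert_vertices(3)[OF x] k(2) by (auto simp: bij_betw_def)
        show "of_bool (holds x G \<psi>) = (of_bool (holds x G \<psi>') :: real)"
          if "\<And>y. y \<in> ?K \<Longrightarrow> \<psi> y = \<psi>' y" for \<psi> \<psi>'
        proof -
          have "\<psi> ` e = \<psi>' ` e" if "e \<in> fst x \<union> snd x" for e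
            using that \<open>\<And>y. y \<in> ?K \<Longrightarrow> \<psi> y = \<psi>' y\<close> by (intro image_cong) auto
          then show ?thesis by (simp add: holds_def)
        qed
      qed auto
      then have "\<bar>avg (tuples k {..<n}) (pat (cert_pairs x) (cert_sign x) (edge_ind G))
           - avg ?P (\<lambda>\<pi>. of_bool (holds x G \<pi>))\<bar> \<le> real (k\<^sup>2) / real n"
        unfolding cert_pat_eq_holds[OF x, abs_def] .
      then show "\<bar>c x * (avg (tuples k {..<n}) (pat (cert_pairs x) (cert_sign x) (edge_ind G))
           - avg ?P (\<lambda>\<pi>. of_bool (holds x G \<pi>)))\<bar> \<le> c x * (real (k\<^sup>2) / real n)"
        using c_nonneg[OF \<open>x \<in> I\<close>] by (simp only: abs_mult abs_of_nonneg mult_left_mono)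
    qed
    also have "\<dots> = sum c I * (real (k\<^sup>2) / real n)" by (simp only: sum_distrib_right)
    also have "\<dots> \<le> 2 ^ (q + 1) * (real (k\<^sup>2) / real n)"
      using c_sum by (intro mult_right_mono) auto
    finally show ?thesis by (simp add: e0_def)
  qed
  have compl: "prob_output T G Accept \<le> 1 - prob_output T G Reject" for G
  proof -
    have "prob_output T G Accept + prob_output T G Reject
      = measure_pmf.prob (T (nverts G)) ({t. result G t = Accept} \<union> {t. result G t = Reject})"
      unfolding prob_output_def by (intro measure_pmf.finite_measure_Union[symmetric]) auto
    then show ?thesis using measure_pmf.prob_le_1[of "T (nverts G)" "{t. result G t = Accept} \<union> {t. result G t = Reject}"] by linarith
  qed
  show ?thesis unfolding Let_def I_def[symmetric]
  proof (intro exI[of _ c] conjI allI impI, goal_cases)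
    case 1
    show ?case by (rule pf)
  next
    case (2 G)
    have "2/3 \<le> acc G" unfolding acc_def
      using perm_graph_in_property[OF P 2(3)] 2 T(1) simple_perm_graph[OF 2(1)]
      by (intro avg_lower finP) (auto simp: tester_def)
    then show ?case using close[OF 2(1,2)] by linarith
  next
    case (3 G)
    have "acc G \<le> 1/3" unfolding acc_def
    proof (intro avg_upper finP)
      fix \<pi> assume "\<pi> \<in> ?P"
      then have "far_from \<beta> P (perm_graph \<pi> G)" using far_from_perm_graph[OF P 3(1) _ 3(3)] 3(2) by simp
      then have "prob_output T (perm_graph \<pi> G) Reject \<ge> 2/3"
        using T(1) simple_perm_graph[OF 3(1)] by (auto simp: tester_def)
      then show "prob_output T (perm_graph \<pi> G) Accept \<le> 1/3" using compl[of "perm_graph \<pi> G"] by linarith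
    qed
    then show ?case using close[OF 3(1,2)] by linarith
  next
    case (4 G)
    have "acc G \<le> 1" unfolding acc_def by (intro avg_upper finP) (simp add: prob_output_def)
    then show ?case using close[OF 4(1,2)] by linarith
  qed
qed

section \<open>Greedy recolouring\<close>

text \<open>Only the sample of the vertex's own block enters. Hence at most
  \<open>N * 2 ^ (m * k)\<close> classes occur, and the class of a vertex is found by querying its
  pairs with that sample.\<close>

definition vclass :: "('v \<Rightarrow> 'v \<Rightarrow> bool) \<Rightarrow> nat \<Rightarrow> nat \<Rightarrow> nat \<Rightarrow> (nat \<Rightarrow> nat \<Rightarrow> nat \<Rightarrow> 'v) \<Rightarrow> ('v \<Rightarrow> nat) \<Rightarrow> 'v \<Rightarrow> nat \<times> (nat \<times> nat) set" where
  "vclass g N m k U r v = (r v, {(j, b). j < m \<and> b < k \<and> g v (U (r v) j b)})"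

text \<open>The choice among several maximisers depends on the function alone, so vertices with
  equal estimates receive equal colours.\<close>

definition best :: "nat \<Rightarrow> (nat \<Rightarrow> real) \<Rightarrow> nat" where
  "best T f = (SOME c. c < T \<and> (\<forall>c'<T. f c' \<le> f c))"

lemma best:
  assumes "T > 0"
  shows "best T f < T" "c < T \<Longrightarrow> f c \<le> f (best T f)"
proof -
  have "\<exists>c. c < T \<and> (\<forall>c'<T. f c' \<le> f c)"
  proof -
    have "Max (f ` {..<T}) \<in> f ` {..<T}" using assms by (intro Max_in) auto
    then obtain c where c: "c < T" "f c = Max (f ` {..<T})" by auto
    then have "\<forall>c'<T. f c' \<le> f c" by simp
    then show ?thesis using c(1) by blast
  qed
  from someI_ex[OF this] have "best T f < T \<and> (\<forall>c'<T. f c' \<le> f (best T f))" unfolding best_def .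
  then show "best T f < T" "c < T \<Longrightarrow> f c \<le> f (best T f)" by auto
qed

text \<open>An objective that averages a bounded function of k random vertices and of their colours and
  that ignores all samples with two vertices in the same block.  Recolouring one block therefore
  changes the objective linearly.\<close>

locale block_objective =
  fixes V :: "'v set" and r :: "'v \<Rightarrow> nat" and N m k T :: nat and g :: "'v \<Rightarrow> 'v \<Rightarrow> bool"
    and H :: "(nat \<Rightarrow> 'v) \<Rightarrow> (nat \<Rightarrow> nat) \<Rightarrow> real" and B \<gamma> :: real
  assumes V: "finite V" "V \<noteq> {}" and r: "\<And>v. v \<in> V \<Longrightarrow> r v < N" and m: "m > 0" and T: "T > 0"
    and B: "B > 0" and \<gamma>: "\<gamma> > 0"
    and H_bound: "\<And>\<phi> \<rho>. \<phi> \<in> tuples k V \<Longrightarrow> \<bar>H \<phi> \<rho>\<bar> \<le> B"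
    and H_blocks: "\<And>\<phi> \<rho>. \<phi> \<in> tuples k V \<Longrightarrow> \<not> inj_on (\<lambda>a. r (\<phi> a)) {..<k} \<Longrightarrow> H \<phi> \<rho> = 0"
    and H_type: "\<And>\<phi> \<rho> a v v'. \<phi> \<in> tuples k V \<Longrightarrow> a < k \<Longrightarrow> v \<in> V \<Longrightarrow> v' \<in> V \<Longrightarrow> r v = r v' \<Longrightarrow>
        (\<And>b. b < k \<Longrightarrow> g v (\<phi> b) = g v' (\<phi> b)) \<Longrightarrow> H (\<phi>(a := v)) \<rho> = H (\<phi>(a := v')) \<rho>"
    and H_cong: "\<And>\<phi> \<rho> \<rho>'. (\<And>a. a < k \<Longrightarrow> \<rho> a = \<rho>' a) \<Longrightarrow> H \<phi> \<rho> = H \<phi> \<rho>'"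
begin

definition obj :: "('v \<Rightarrow> nat) \<Rightarrow> real" where
  "obj \<xi> = avg (tuples k V) (\<lambda>\<phi>. H \<phi> (\<xi> \<circ> \<phi>))"

text \<open>The objective conditioned on position \<open>a\<close> being occupied by
  \<open>v\<close> with colour \<open>c\<close>, the other positions keeping their colours.
  Differences in \<open>c\<close> act as partial derivatives.\<close>

definition grad :: "('v \<Rightarrow> nat) \<Rightarrow> nat \<Rightarrow> 'v \<Rightarrow> nat \<Rightarrow> real" where
  "grad \<xi> a v c = avg (tuples k V) (\<lambda>\<phi>. H (\<phi>(a := v)) ((\<xi> \<circ> \<phi>)(a := c)))"

definition grad_est :: "('v \<Rightarrow> nat) \<Rightarrow> (nat \<Rightarrow> nat \<Rightarrow> 'v) \<Rightarrow> nat \<Rightarrow> 'v \<Rightarrow> nat \<Rightarrow> real" where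
  "grad_est \<xi> x a v c = avg {..<m} (\<lambda>j. H ((x j)(a := v)) ((\<xi> \<circ> x j)(a := c)))"

definition greedy :: "nat \<Rightarrow> ('v \<Rightarrow> nat) \<Rightarrow> (nat \<Rightarrow> nat \<Rightarrow> 'v) \<Rightarrow> 'v \<Rightarrow> nat" where
  "greedy i \<xi> x v = (if r v = i then best T (\<lambda>c. \<Sum>a<k. grad_est \<xi> x a v c) else \<xi> v)"

definition bad :: "('v \<Rightarrow> nat) \<Rightarrow> (nat \<Rightarrow> nat \<Rightarrow> 'v) \<Rightarrow> 'v \<Rightarrow> bool" where
  "bad \<xi> x v \<longleftrightarrow> (\<exists>a<k. \<exists>c<T. \<bar>grad_est \<xi> x a v c - grad \<xi> a v c\<bar> > \<gamma>)"

lemma tuplesV: "finite (tuples k V)" "tuples k V \<noteq> {}"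
  using V by auto

text \<open>A sample that counts has at most one vertex in block \<open>i\<close>, so at most one
  summand over the positions \<open>a\<close> is non-zero and it accounts for the whole change; all
  other samples contribute 0. Resampling position \<open>a\<close> then produces the
  gradients.\<close>

lemma recolour_block:
  assumes \<xi>': "\<And>v. r v \<noteq> i \<Longrightarrow> \<xi>' v = \<xi> v"
  shows "obj \<xi>' - obj \<xi> = avg V (\<lambda>v. of_bool (r v = i) * (\<Sum>a<k. grad \<xi> a v (\<xi>' v) - grad \<xi> a v (\<xi> v)))"
proof -
  define F where "F = (\<lambda>a \<phi>. of_bool (r (\<phi> a) = i) * (H \<phi> ((\<xi> \<circ> \<phi>)(a := \<xi>' (\<phi> a))) - H \<phi> (\<xi> \<circ> \<phi>)))"
  have pt: "H \<phi> (\<xi>' \<circ> \<phi>) - H \<phi> (\<xi> \<circ> \<phi>) = (\<Sum>a<k. F a \<phi>)" if \<phi>: "\<phi> \<in> tuples k V" for \<phi>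
  proof (cases "inj_on (\<lambda>a. r (\<phi> a)) {..<k}")
    case False
    then show ?thesis using H_blocks[OF \<phi> False] by (simp add: F_def)
  next
    case inj: True
    show ?thesis
    proof (cases "\<exists>a<k. r (\<phi> a) = i")
      case True
      then obtain a0 where a0: "a0 < k" "r (\<phi> a0) = i" by blast
      have uniq: "a = a0" if "a < k" "r (\<phi> a) = i" for a
        using inj_onD[OF inj, of a a0] that a0 by simp
      have "(\<Sum>a<k. F a \<phi>) = (\<Sum>a<k. if a = a0 then F a0 \<phi> else 0)"
        using uniq by (intro sum.cong) (auto simp: F_def)
      also have "\<dots> = H \<phi> ((\<xi> \<circ> \<phi>)(a0 := \<xi>' (\<phi> a0))) - H \<phi> (\<xi> \<circ> \<phi>)" using a0 by (simp add: F_def)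
      also have "H \<phi> ((\<xi> \<circ> \<phi>)(a0 := \<xi>' (\<phi> a0))) = H \<phi> (\<xi>' \<circ> \<phi>)"
      proof (rule H_cong)
        fix a assume a: "a < k"
        show "((\<xi> \<circ> \<phi>)(a0 := \<xi>' (\<phi> a0))) a = (\<xi>' \<circ> \<phi>) a"
          using uniq[OF a] \<xi>'[of "\<phi> a"] by (metis comp_apply fun_upd_apply)
      qed
      finally show ?thesis by (rule sym)
    next
      case False
      then have "H \<phi> (\<xi>' \<circ> \<phi>) = H \<phi> (\<xi> \<circ> \<phi>)" using \<xi>' by (intro H_cong) auto
      moreover have "(\<Sum>a<k. F a \<phi>) = 0" using False by (intro sum.neutral) (auto simp: F_def)
      ultimately show ?thesis by simp
    qed
  qed
  have res: "avg (tuples k V) (F a) = avg V (\<lambda>v. of_bool (r v = i) * (grad \<xi> a v (\<xi>' v) - grad \<xi> a v (\<xi> v)))"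
    if a: "a < k" for a
  proof -
    have upd: "\<xi> \<circ> \<phi>(a := v) = (\<xi> \<circ> \<phi>)(a := \<xi> v)" for \<phi> :: "nat \<Rightarrow> 'v" and v by (auto simp: fun_eq_iff)
    have "avg (tuples k V) (F a) = avg (tuples k V) (\<lambda>\<phi>. avg V (\<lambda>v. F a (\<phi>(a := v))))"
      using V a by (intro avg_resample)
    also have "\<dots> = avg V (\<lambda>v. avg (tuples k V) (\<lambda>\<phi>. F a (\<phi>(a := v))))" by (rule avg_swap)
    also have "\<dots> = avg V (\<lambda>v. of_bool (r v = i) * (grad \<xi> a v (\<xi>' v) - grad \<xi> a v (\<xi> v)))"
      by (simp add: F_def upd avg_cmult avg_diff grad_def)
    finally show ?thesis .
  qed
  have "obj \<xi>' - obj \<xi> = avg (tuples k V) (\<lambda>\<phi>. \<Sum>a<k. F a \<phi>)"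
    unfolding obj_def avg_diff[symmetric] using pt by (intro avg_cong)
  also have "\<dots> = (\<Sum>a<k. avg (tuples k V) (F a))" by (rule avg_sum)
  also have "\<dots> = (\<Sum>a<k. avg V (\<lambda>v. of_bool (r v = i) * (grad \<xi> a v (\<xi>' v) - grad \<xi> a v (\<xi> v))))"
    using res by (intro sum.cong) auto
  also have "\<dots> = avg V (\<lambda>v. of_bool (r v = i) * (\<Sum>a<k. grad \<xi> a v (\<xi>' v) - grad \<xi> a v (\<xi> v)))"
    by (simp only: avg_sum[symmetric] sum_distrib_left)
  finally show ?thesis .
qed

lemma greedy_less: "(\<And>v. \<xi> v < T) \<Longrightarrow> greedy i \<xi> x v < T"
  using best(1)[OF T] by (simp add: greedy_def)

text \<open>If all estimates at \<open>v\<close> are within \<open>\<gamma>\<close>, the maximiser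
  of the estimated sum loses at most \<open>2 * k * \<gamma>\<close> against the old colour. At a
  bad vertex the loss is at most \<open>2 * k * B\<close> in any case. By
  \<open>recolour_block\<close> the losses simply add up over the block.\<close>

lemma greedy_step:
  assumes \<xi>: "\<And>v. \<xi> v < T"
  shows "obj (greedy i \<xi> x) \<ge> obj \<xi> - avg V (\<lambda>v. of_bool (r v = i) * (2 * real k * \<gamma> + 2 * real k * B * of_bool (bad \<xi> x v)))"
proof -
  let ?\<xi>' = "greedy i \<xi> x"
  have grad_le: "\<bar>grad \<xi> a v c\<bar> \<le> B" if "a < k" "v \<in> V" for a v c
    unfolding grad_def by (intro abs_avg_upper tuplesV H_bound tuples_upd that)
  have "- avg V (\<lambda>v. of_bool (r v = i) * (2 * real k * \<gamma> + 2 * real k * B * of_bool (bad \<xi> x v)))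
    = avg V (\<lambda>v. - (of_bool (r v = i) * (2 * real k * \<gamma> + 2 * real k * B * of_bool (bad \<xi> x v))))"
    using avg_cmult[of V "-1"] by simp
  also have "\<dots> \<le> avg V (\<lambda>v. of_bool (r v = i) * (\<Sum>a<k. grad \<xi> a v (?\<xi>' v) - grad \<xi> a v (\<xi> v)))"
  proof (rule avg_mono)
    fix v assume v: "v \<in> V"
    have "- (2 * real k * \<gamma> + 2 * real k * B * of_bool (bad \<xi> x v))
      \<le> (\<Sum>a<k. grad \<xi> a v (?\<xi>' v) - grad \<xi> a v (\<xi> v))" if rv: "r v = i"
    proof (cases "bad \<xi> x v")
      case True
      have "(\<Sum>a<k. grad \<xi> a v (?\<xi>' v) - grad \<xi> a v (\<xi> v)) \<ge> (\<Sum>a<k. - (2 * B))"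
      proof (rule sum_mono)
        fix a assume "a \<in> {..<k}"
        then show "- (2 * B) \<le> grad \<xi> a v (?\<xi>' v) - grad \<xi> a v (\<xi> v)"
          using grad_le[of a v "?\<xi>' v"] grad_le[of a v "\<xi> v"] v by auto
      qed
      moreover have "(\<Sum>a<k. - (2 * B)) = - (2 * real k * B)" by simp
      moreover have "0 \<le> 2 * real k * \<gamma>" using \<gamma> by simp
      moreover have tb: "of_bool (bad \<xi> x v) = (1 :: real)" using True by simp
      ultimately show ?thesis unfolding tb by linarith
    next
      case False
      have close: "\<bar>grad_est \<xi> x a v c - grad \<xi> a v c\<bar> \<le> \<gamma>" if "a < k" "c < T" for a c
        using False that unfolding bad_def by (meson not_less)
      let ?L = "\<lambda>c. \<Sum>a<k. grad_est \<xi> x a v c"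
      have d: "\<bar>?L c - (\<Sum>a<k. grad \<xi> a v c)\<bar> \<le> real k * \<gamma>" if "c < T" for c
      proof -
        have "\<bar>?L c - (\<Sum>a<k. grad \<xi> a v c)\<bar> \<le> (\<Sum>a<k. \<bar>grad_est \<xi> x a v c - grad \<xi> a v c\<bar>)"
          unfolding sum_subtractf[symmetric] by (rule sum_abs)
        also have "\<dots> \<le> (\<Sum>a<k. \<gamma>)" using close that by (intro sum_mono) auto
        finally show ?thesis by simp
      qed
      have eq: "?\<xi>' v = best T ?L" using rv by (simp add: greedy_def)
      have "?L (\<xi> v) \<le> ?L (?\<xi>' v)" unfolding eq by (rule best(2)[OF T \<xi>])
      moreover have "?\<xi>' v < T" unfolding eq by (rule best(1)[OF T])
      moreover have tb: "of_bool (bad \<xi> x v) = (0 :: real)" using False by simp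
      ultimately show ?thesis using d[of "?\<xi>' v"] d[OF \<xi>[of v]]
        unfolding tb sum_subtractf by linarith
    qed
    then show "- (of_bool (r v = i) * (2 * real k * \<gamma> + 2 * real k * B * of_bool (bad \<xi> x v)))
      \<le> of_bool (r v = i) * (\<Sum>a<k. grad \<xi> a v (?\<xi>' v) - grad \<xi> a v (\<xi> v))" by auto
  qed
  also have "\<dots> = obj ?\<xi>' - obj \<xi>"
    by (rule recolour_block[symmetric]) (simp add: greedy_def)
  finally show ?thesis by linarith
qed

text \<open>Union bound over \<open>k\<close> positions and \<open>T\<close> colours with the
  two-sided tail of \<open>Hoeffding\<close>.\<close>

definition fail :: real where
  "fail = real k * (real T * (2 * exp (- (real m * \<gamma>\<^sup>2 / (16 * B\<^sup>2)))))"

lemma avg_bad: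
  assumes v: "v \<in> V"
  shows "avg (tuples m (tuples k V)) (\<lambda>x. of_bool (bad \<xi> x v)) \<le> fail"
proof -
  let ?X = "tuples m (tuples k V)"
  have "avg ?X (\<lambda>x. of_bool (bad \<xi> x v))
     \<le> avg ?X (\<lambda>x. \<Sum>a<k. \<Sum>c<T. of_bool (\<bar>grad_est \<xi> x a v c - grad \<xi> a v c\<bar> > \<gamma>))"
  proof (rule avg_mono)
    fix x
    show "of_bool (bad \<xi> x v) \<le> (\<Sum>a<k. \<Sum>c<T. of_bool (\<bar>grad_est \<xi> x a v c - grad \<xi> a v c\<bar> > \<gamma>) :: real)"
    proof (cases "bad \<xi> x v")
      case True
      then obtain a c where ac: "a < k" "c < T" "\<bar>grad_est \<xi> x a v c - grad \<xi> a v c\<bar> > \<gamma>"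
        unfolding bad_def by blast
      have "(1::real) = of_bool (\<bar>grad_est \<xi> x a v c - grad \<xi> a v c\<bar> > \<gamma>)" using ac by simp
      also have "\<dots> \<le> (\<Sum>c<T. of_bool (\<bar>grad_est \<xi> x a v c - grad \<xi> a v c\<bar> > \<gamma>))"
        using ac by (intro member_le_sum) auto
      also have "\<dots> \<le> (\<Sum>a<k. \<Sum>c<T. of_bool (\<bar>grad_est \<xi> x a v c - grad \<xi> a v c\<bar> > \<gamma>))"
        using ac by (intro member_le_sum[where f="\<lambda>a. \<Sum>c<T. of_bool (\<bar>grad_est \<xi> x a v c - grad \<xi> a v c\<bar> > \<gamma>)"] sum_nonneg) auto
      finally show ?thesis using True by simp
    qed (simp add: sum_nonneg)
  qed
  also have "\<dots> = (\<Sum>a<k. \<Sum>c<T. avg ?X (\<lambda>x. of_bool (\<bar>grad_est \<xi> x a v c - grad \<xi> a v c\<bar> > \<gamma>)))"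
    by (simp only: avg_sum)
  also have "\<dots> \<le> (\<Sum>a<k. \<Sum>c<T. 2 * exp (- (real m * \<gamma>\<^sup>2 / (16 * B\<^sup>2))))"
  proof (intro sum_mono)
    fix a c assume "a \<in> {..<k}" "c \<in> {..<T}"
    then show "avg ?X (\<lambda>x. of_bool (\<bar>grad_est \<xi> x a v c - grad \<xi> a v c\<bar> > \<gamma>)) \<le> 2 * exp (- (real m * \<gamma>\<^sup>2 / (16 * B\<^sup>2)))"
      unfolding grad_est_def grad_def using v
      by (intro Hoeffding[where f="\<lambda>\<phi>. H (\<phi>(a := v)) ((\<xi> \<circ> \<phi>)(a := c))"] tuplesV H_bound tuples_upd B \<gamma> m) auto
  qed
  also have "\<dots> = fail" by (simp add: fail_def)
  finally show ?thesis .
qed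

primrec colouring :: "('v \<Rightarrow> nat) \<Rightarrow> (nat \<Rightarrow> nat \<Rightarrow> nat \<Rightarrow> 'v) \<Rightarrow> nat \<Rightarrow> 'v \<Rightarrow> nat" where
  "colouring \<xi> U 0 = \<xi>"
| "colouring \<xi> U (Suc i) = greedy i (colouring \<xi> U i) (U i)"

lemma colouring_less: "(\<And>v. \<xi> v < T) \<Longrightarrow> colouring \<xi> U i v < T"
  by (induction i arbitrary: v) (simp_all add: greedy_less)

text \<open>The colouring before a stage is determined by the samples of earlier stages. The sample
  of the stage itself is therefore independent of it.\<close>

lemma colouring_upd: "i \<le> j \<Longrightarrow> colouring \<xi> (U(j := x)) i = colouring \<xi> U i"
  by (induction i) simp_all

definition loss :: "('v \<Rightarrow> nat) \<Rightarrow> (nat \<Rightarrow> nat \<Rightarrow> nat \<Rightarrow> 'v) \<Rightarrow> real" where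
  "loss \<xi> U = (\<Sum>i<N. avg V (\<lambda>v. of_bool (r v = i) * (2 * real k * B * of_bool (bad (colouring \<xi> U i) (U i) v))))"

lemma loss_nonneg: "0 \<le> loss \<xi> U"
  unfolding loss_def using B by (intro sum_nonneg avg_nonneg) auto

lemma sum_blocks: "v \<in> V \<Longrightarrow> (\<Sum>i<N. of_bool (r v = i) * c) = (c :: real)"
  using r[of v] by (simp add: of_bool_def if_distrib[where f="\<lambda>x. x * c"] cong: if_cong)

lemma obj_colouring:
  assumes \<xi>: "\<And>v. \<xi> v < T"
  shows "obj (colouring \<xi> U N) \<ge> obj \<xi> - 2 * real k * \<gamma> - loss \<xi> U"
proof -
  let ?A = "\<lambda>i. avg V (\<lambda>v. of_bool (r v = i) * (2 * real k * \<gamma> + 2 * real k * B * of_bool (bad (colouring \<xi> U i) (U i) v)))"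
  have "obj (colouring \<xi> U N) \<ge> obj \<xi> - (\<Sum>i<N. ?A i)"
  proof (induction N)
    case (Suc j)
    have "obj (colouring \<xi> U (Suc j)) \<ge> obj (colouring \<xi> U j) - ?A j"
      using greedy_step[of "colouring \<xi> U j" j "U j"] colouring_less[OF \<xi>] by simp
    then show ?case using Suc by simp
  qed simp
  \<comment> \<open>Every vertex lies in exactly one block, so the costs of the stages add up to one
    average over \<open>V\<close> and not to \<open>N\<close> such averages.\<close>
  moreover have "(\<Sum>i<N. ?A i) = 2 * real k * \<gamma> + loss \<xi> U"
  proof -
    have "(\<Sum>i<N. ?A i) = (\<Sum>i<N. avg V (\<lambda>v. of_bool (r v = i) * (2 * real k * \<gamma>))) + loss \<xi> U"
      unfolding loss_def by (simp only: distrib_left avg_add sum.distrib)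
    also have "(\<Sum>i<N. avg V (\<lambda>v. of_bool (r v = i) * (2 * real k * \<gamma>))) = avg V (\<lambda>v. 2 * real k * \<gamma>)"
      unfolding avg_sum[symmetric] using sum_blocks by (intro avg_cong)
    finally show ?thesis using V by (simp add: avg_const)
  qed
  ultimately show ?thesis by (simp add: algebra_simps)
qed

lemma avg_loss: "avg (tuples N (tuples m (tuples k V))) (loss \<xi>) \<le> 2 * real k * B * fail"
proof -
  let ?X = "tuples m (tuples k V)"
  have X: "finite ?X" "?X \<noteq> {}" using V by auto
  have "avg (tuples N ?X) (loss \<xi>) = (\<Sum>i<N. avg V (\<lambda>v. avg (tuples N ?X) (\<lambda>U.
      of_bool (r v = i) * (2 * real k * B * of_bool (bad (colouring \<xi> U i) (U i) v)))))"
    unfolding loss_def by (simp only: avg_sum avg_swap[of "tuples N ?X"])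
  also have "\<dots> \<le> (\<Sum>i<N. avg V (\<lambda>v. of_bool (r v = i) * (2 * real k * B * fail)))"
  proof (intro sum_mono avg_mono)
    fix i v assume i: "i \<in> {..<N}" and v: "v \<in> V"
    \<comment> \<open>Resampling coordinate \<open>i\<close> leaves the colouring before stage
      \<open>i\<close> unchanged, so \<open>avg_bad\<close> applies with that colouring
      fixed.\<close>
    have "avg (tuples N ?X) (\<lambda>U. of_bool (bad (colouring \<xi> U i) (U i) v))
      = avg (tuples N ?X) (\<lambda>U. avg ?X (\<lambda>x. of_bool (bad (colouring \<xi> U i) x v)))"
      using X i by (subst avg_resample[of ?X i]) (auto simp: colouring_upd)
    also have "\<dots> \<le> fail"
      by (rule avg_upper) (use X avg_bad[OF v] in auto)
    finally have "avg (tuples N ?X) (\<lambda>U. of_bool (bad (colouring \<xi> U i) (U i) v)) \<le> fail" .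
    then show "avg (tuples N ?X) (\<lambda>U. of_bool (r v = i) * (2 * real k * B * of_bool (bad (colouring \<xi> U i) (U i) v)))
       \<le> of_bool (r v = i) * (2 * real k * B * fail)"
      using B by (simp only: avg_cmult) (auto intro!: mult_left_mono)
  qed
  also have "\<dots> = avg V (\<lambda>v. 2 * real k * B * fail)"
    unfolding avg_sum[symmetric] using sum_blocks by (intro avg_cong)
  finally show ?thesis using V by (simp add: avg_const)
qed

text \<open>A vertex is recoloured once, at the stage of its block. The estimates used there insert
  the vertex into the samples \<open>U i j\<close>, and by \<open>H_type\<close> they see only its
  block and its adjacencies to these. The colouring reached before also enters, but it is the same
  for both vertices.\<close>

lemma colouring_vclass:
  assumes U: "U \<in> tuples N (tuples m (tuples k V))" and v: "v \<in> V" "v' \<in> V"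
    and cl: "vclass g N m k U r v = vclass g N m k U r v'"
  shows "colouring \<xi> U N v = colouring \<xi> U N v'"
proof -
  define i where "i = r v"
  have i: "i < N" "r v = i" "r v' = i" using r[OF v(1)] cl by (auto simp: i_def vclass_def)
  have adj_eq: "{(j, b). j < m \<and> b < k \<and> g v (U i j b)} = {(j, b). j < m \<and> b < k \<and> g v' (U i j b)}"
    using cl unfolding vclass_def i(2,3) by simp
  have after: "colouring \<xi> U j u = best T (\<lambda>c. \<Sum>a<k. grad_est (colouring \<xi> U i) (U i) a u c)"
    if "i < j" "r u = i" for j u
    using that
  proof (induction j)
    case (Suc j)
    then show ?case by (cases "i = j") (auto simp: greedy_def)
  qed simp
  have "grad_est \<xi>' (U i) a v c = grad_est \<xi>' (U i) a v' c" if "a < k" for a c \<xi>'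
    unfolding grad_est_def
  proof (rule avg_cong)
    fix j assume j: "j \<in> {..<m}"
    have "U i j \<in> tuples k V" using tuples_mem[OF tuples_mem[OF U i(1)], of j] j by simp
    moreover have "g v (U i j b) = g v' (U i j b)" if "b < k" for b
      using adj_eq j that unfolding set_eq_iff by auto
    ultimately show "H ((U i j)(a := v)) ((\<xi>' \<circ> U i j)(a := c)) = H ((U i j)(a := v')) ((\<xi>' \<circ> U i j)(a := c))"
      using that v i by (intro H_type) auto
  qed
  then have "(\<lambda>c. \<Sum>a<k. grad_est (colouring \<xi> U i) (U i) a v c) = (\<lambda>c. \<Sum>a<k. grad_est (colouring \<xi> U i) (U i) a v' c)"
    by (intro ext sum.cong) auto
  then show ?thesis using after[OF i(1), of v] after[OF i(1), of v'] i(2,3) by simp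
qed

end

section \<open>Rounding to a graph\<close>

definition affine_fun :: "(real \<Rightarrow> real) \<Rightarrow> bool" where
  "affine_fun f \<longleftrightarrow> (\<exists>\<alpha> \<beta>. \<forall>x. f x = \<alpha> + \<beta> * x)"

lemma affine_funI: "(\<And>x. f x = \<alpha> + \<beta> * x) \<Longrightarrow> affine_fun f"
  unfolding affine_fun_def by blast

lemma affine_fun_const: "affine_fun (\<lambda>_. c)"
  by (rule affine_funI[of _ c 0]) simp

lemma affine_fun_cmult: "affine_fun f \<Longrightarrow> affine_fun (\<lambda>x. c * f x)"
  unfolding affine_fun_def by (metis distrib_left mult.assoc)

lemma affine_fun_multc: "affine_fun f \<Longrightarrow> affine_fun (\<lambda>x. f x * c)"
  using affine_fun_cmult[of f c] by (simp add: mult.commute)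

lemma affine_fun_add:
  assumes "affine_fun f" "affine_fun g"
  shows "affine_fun (\<lambda>x. f x + g x)"
proof -
  obtain a b c d where "\<And>x. f x = a + b * x" "\<And>x. g x = c + d * x"
    using assms unfolding affine_fun_def by metis
  then show ?thesis by (intro affine_funI[of _ "a + c" "b + d"]) (simp add: algebra_simps)
qed

lemma affine_fun_diff: "affine_fun f \<Longrightarrow> affine_fun g \<Longrightarrow> affine_fun (\<lambda>x. f x - g x)"
  using affine_fun_add[of f "\<lambda>x. -1 * g x"] affine_fun_cmult[of g "-1"] by simp

lemma affine_fun_sum: "(\<And>i. i \<in> I \<Longrightarrow> affine_fun (f i)) \<Longrightarrow> affine_fun (\<lambda>x. \<Sum>i\<in>I. f i x)"
  by (induction I rule: infinite_finite_induct) (auto intro: affine_fun_const affine_fun_add)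

lemma affine_fun_avg: "(\<And>i. i \<in> I \<Longrightarrow> affine_fun (f i)) \<Longrightarrow> affine_fun (\<lambda>x. avg I (\<lambda>i. f i x))"
  unfolding avg_def divide_inverse by (intro affine_fun_multc affine_fun_sum)

lemma affine_fun_endpoint:
  assumes "affine_fun f" "0 \<le> x" "x \<le> 1"
  shows "f x \<le> f 0 \<or> f x \<le> f 1"
proof -
  obtain a b where "\<And>x. f x = a + b * x" using assms unfolding affine_fun_def by metis
  moreover have "b * x \<le> 0 \<or> b * x \<le> b"
    using assms(2,3) mult_left_le[of x b] by (cases "b \<ge> 0") (auto simp: mult_nonpos_nonneg)
  ultimately show ?thesis by auto
qed

text \<open>In each single variable an interior value is at most one of the two endpoint values, so
  the variables can be moved to 0 or 1 one after another without decreasing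
  \<open>F\<close>.\<close>

lemma multiaffine_rounding:
  fixes F :: "('k \<Rightarrow> real) \<Rightarrow> real"
  assumes F: "\<And>w \<kappa>. affine_fun (\<lambda>x. F (w(\<kappa> := x)))" and S: "finite S"
    and w: "\<And>\<kappa>. 0 \<le> w \<kappa> \<and> w \<kappa> \<le> 1"
  shows "\<exists>\<tau>\<subseteq>S. F w \<le> F (\<lambda>\<kappa>. if \<kappa> \<in> S then of_bool (\<kappa> \<in> \<tau>) else w \<kappa>)"
  using S
proof (induction S rule: finite_induct)
  case (insert \<kappa> S)
  then obtain \<tau> where \<tau>: "\<tau> \<subseteq> S" "F w \<le> F (\<lambda>\<kappa>. if \<kappa> \<in> S then of_bool (\<kappa> \<in> \<tau>) else w \<kappa>)" by blast
  define w' where "w' = (\<lambda>\<kappa>. if \<kappa> \<in> S then of_bool (\<kappa> \<in> \<tau>) else w \<kappa>)"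
  have "F (w'(\<kappa> := w' \<kappa>)) \<le> F (w'(\<kappa> := 0)) \<or> F (w'(\<kappa> := w' \<kappa>)) \<le> F (w'(\<kappa> := 1))"
    using w by (intro affine_fun_endpoint[OF F]) (auto simp: w'_def)
  then have or: "F w \<le> F (w'(\<kappa> := 0)) \<or> F w \<le> F (w'(\<kappa> := 1))" 
    using \<tau>(2) unfolding w'_def[symmetric] fun_upd_triv by (auto intro: order_trans)
  have "w'(\<kappa> := 0) = (\<lambda>\<kappa>'. if \<kappa>' \<in> insert \<kappa> S then of_bool (\<kappa>' \<in> \<tau>) else w \<kappa>')"
    "w'(\<kappa> := 1) = (\<lambda>\<kappa>'. if \<kappa>' \<in> insert \<kappa> S then of_bool (\<kappa>' \<in> insert \<kappa> \<tau>) else w \<kappa>')"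
    using insert.hyps \<tau>(1) by (auto simp: w'_def fun_eq_iff)
  then show ?case using or \<tau>(1) by (metis insert_mono subset_insertI2)
qed simp

text \<open>For 0-1 valued \<open>Z\<close> this is the indicator of disagreement with
  \<open>g\<close>; its extension to fractional \<open>Z\<close> is affine, as rounding
  requires.\<close>

definition dis :: "('v \<Rightarrow> 'v \<Rightarrow> bool) \<Rightarrow> ('v \<Rightarrow> 'v \<Rightarrow> real) \<Rightarrow> 'v \<Rightarrow> 'v \<Rightarrow> real" where
  "dis g Z u v = (if g u v then 1 - Z u v else Z u v)"

text \<open>The two classes form a set and not a pair, so that for symmetric \<open>g\<close> every
  set of keys defines a symmetric relation.\<close>

definition vkey :: "('v \<Rightarrow> 'v \<Rightarrow> bool) \<Rightarrow> ('v \<Rightarrow> 'c) \<Rightarrow> 'v \<Rightarrow> 'v \<Rightarrow> 'c set \<times> bool" where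
  "vkey g cls u v = ({cls u, cls v}, g u v)"

definition key_ind :: "('v \<Rightarrow> 'v \<Rightarrow> bool) \<Rightarrow> ('v \<Rightarrow> 'c) \<Rightarrow> ('c set \<times> bool) set \<Rightarrow> 'v \<Rightarrow> 'v \<Rightarrow> real" where
  "key_ind g cls \<tau> u v = of_bool (u \<noteq> v \<and> vkey g cls u v \<in> \<tau>)"

context pattern_family
begin

text \<open>The penalty term makes a single objective control both the pattern density and the distance:
  an average of J close to 2/3 forces a large density and a distance close to d.\<close>

definition J :: "('v \<Rightarrow> 'v \<Rightarrow> bool) \<Rightarrow> real \<Rightarrow> real \<Rightarrow> ('v \<Rightarrow> 'v \<Rightarrow> real) \<Rightarrow> (nat \<Rightarrow> 'v) \<Rightarrow> real" where
  "J g C d Z \<phi> = dens Z \<phi> - C * ((dis g Z (\<phi> 0) (\<phi> 1) - d) * (dis g Z (\<phi> 2) (\<phi> 3) - d))"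

lemma J_cong:
  assumes "\<And>a b. a < b \<Longrightarrow> b < k \<Longrightarrow> Z (\<phi> a) (\<phi> b) = Z' (\<phi>' a) (\<phi>' b)"
    and "\<And>a b. a < b \<Longrightarrow> b < k \<Longrightarrow> g (\<phi> a) (\<phi> b) = g' (\<phi>' a) (\<phi>' b)"
  shows "J g C d Z \<phi> = J g' C d Z' \<phi>'"
proof -
  have "dis g Z (\<phi> 0) (\<phi> 1) = dis g' Z' (\<phi>' 0) (\<phi>' 1)" "dis g Z (\<phi> 2) (\<phi> 3) = dis g' Z' (\<phi>' 2) (\<phi>' 3)"
    using assms[of 0 1] assms[of 2 3] k4 by (auto simp: dis_def)
  moreover have "dens Z \<phi> = dens Z' \<phi>'" using assms(1) by (rule dens_cong)
  ultimately show ?thesis by (simp add: J_def)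
qed

lemma J_bound:
  assumes Z: "\<And>a b. a < b \<Longrightarrow> b < k \<Longrightarrow> 0 \<le> Z (\<phi> a) (\<phi> b) \<and> Z (\<phi> a) (\<phi> b) \<le> 1"
    and d: "0 \<le> d" "d \<le> 1" and C: "C \<ge> 0"
  shows "\<bar>J g C d Z \<phi>\<bar> \<le> Q + C"
proof -
  have "\<bar>dis g Z (\<phi> 0) (\<phi> 1) - d\<bar> \<le> 1" "\<bar>dis g Z (\<phi> 2) (\<phi> 3) - d\<bar> \<le> 1"
    using Z[of 0 1] Z[of 2 3] k4 d by (auto simp: dis_def abs_le_iff)
  then have "\<bar>(dis g Z (\<phi> 0) (\<phi> 1) - d) * (dis g Z (\<phi> 2) (\<phi> 3) - d)\<bar> \<le> 1 * 1"
    unfolding abs_mult by (intro mult_mono) auto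
  then have "\<bar>C * ((dis g Z (\<phi> 0) (\<phi> 1) - d) * (dis g Z (\<phi> 2) (\<phi> 3) - d))\<bar> \<le> C"
    using C mult_left_mono[of _ 1 C] by (simp add: abs_mult)
  then show ?thesis using dens_bounds[of Z \<phi>] Z unfolding J_def by (smt (verit))
qed

text \<open>Positions 0, 1 and positions 2, 3 are disjoint, so the product of the two deviations
  averages to the square of the mean deviation. Squaring the deviation at a single pair would add
  its variance, which says nothing about the distance.\<close>

lemma avg_J:
  assumes V: "finite V" "V \<noteq> {}"
  shows "avg (tuples k V) (J g C d Z)
    = avg (tuples k V) (dens Z) - C * (avg V (\<lambda>u. avg V (dis g Z u)) - d)\<^sup>2"
proof -
  let ?D = "\<lambda>u v. dis g Z u v - d"
  have "avg (tuples k V) (\<lambda>\<phi>. ?D (\<phi> 0) (\<phi> 1) * ?D (\<phi> 2) (\<phi> 3))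
     = avg (tuples k V) (\<lambda>\<phi>. avg V (\<lambda>v. ?D (\<phi> 0) (\<phi> 1) * ?D (\<phi> 2) v))"
    using V k4 by (subst avg_resample[of V 3]) auto
  also have "\<dots> = avg (tuples k V) (\<lambda>\<phi>. avg V (\<lambda>u. avg V (\<lambda>v. ?D (\<phi> 0) (\<phi> 1) * ?D u v)))"
    using V k4 by (subst avg_resample[of V 2]) auto
  also have "\<dots> = avg (tuples k V) (\<lambda>\<phi>. ?D (\<phi> 0) (\<phi> 1)) * avg V (\<lambda>u. avg V (?D u))"
    by (simp only: avg_cmult avg_multc)
  also have "avg (tuples k V) (\<lambda>\<phi>. ?D (\<phi> 0) (\<phi> 1)) = avg V (\<lambda>u. avg V (?D u))"
    using V k4 by (intro avg_coord2[where f="?D"]) auto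
  also have "avg V (\<lambda>u. avg V (?D u)) = avg V (\<lambda>u. avg V (dis g Z u)) - d"
    using V by (simp add: avg_diff avg_const)
  finally have "avg (tuples k V) (\<lambda>\<phi>. ?D (\<phi> 0) (\<phi> 1) * ?D (\<phi> 2) (\<phi> 3)) = (avg V (\<lambda>u. avg V (dis g Z u)) - d)\<^sup>2"
    by (simp add: power2_eq_square)
  then show ?thesis unfolding J_def avg_diff avg_cmult by simp
qed

text \<open>With all vertices in distinct classes, different pairs of positions have different keys.
  Each table entry then occurs in at most one factor of every product, and this includes the two
  factors of the penalty.\<close>

lemma J_affine:
  fixes g :: "'v \<Rightarrow> 'v \<Rightarrow> bool"
  assumes inj: "inj_on (\<lambda>a. cls (\<phi> a)) {..<k}"
  shows "affine_fun (\<lambda>x. J g C d (\<lambda>u v. (w(\<kappa> := x)) (vkey g cls u v)) \<phi>)"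
proof -
  let ?key = "\<lambda>e. vkey g cls (\<phi> (fst e)) (\<phi> (snd e))"
  have key_inj: "e = e'" if "?key e = ?key e'" "fst e < snd e" "snd e < k" "fst e' < snd e'" "snd e' < k" for e e'
  proof -
    have "(\<lambda>a. cls (\<phi> a)) ` {fst e, snd e} = (\<lambda>a. cls (\<phi> a)) ` {fst e', snd e'}"
      using that(1) by (simp add: vkey_def)
    then have "{fst e, snd e} = {fst e', snd e'}"
      using that by (subst (asm) inj_on_image_eq_iff[OF inj]) auto
    then show ?thesis using that by (auto simp: doubleton_eq_iff prod_eq_iff)
  qed
  have pt: "affine_fun (\<lambda>x. (w(\<kappa> := x)) y)" for y
    by (cases "y = \<kappa>") (auto intro!: affine_fun_const affine_funI[of _ 0 1])
  have lit: "affine_fun (\<lambda>x. lit b (f x))" if "affine_fun f" for b f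
    using that by (cases b) (auto simp: lit_def intro!: affine_fun_diff affine_fun_const)
  have "affine_fun (\<lambda>x. pat (E i) (s i) (\<lambda>u v. (w(\<kappa> := x)) (vkey g cls u v)) \<phi>)" if i: "i \<in> I" for i
  proof (cases "\<exists>e\<in>E i. ?key e = \<kappa>")
    case True
    then obtain e where e: "e \<in> E i" "?key e = \<kappa>" by blast
    have ne: "?key e' \<noteq> \<kappa>" if "e' \<in> E i - {e}" for e'
      using key_inj[of e' e] that e E_sub[OF i] by auto
    have "pat (E i) (s i) (\<lambda>u v. (w(\<kappa> := x)) (vkey g cls u v)) \<phi>
        = lit (s i e) x * (\<Prod>e'\<in>E i - {e}. lit (s i e') (w (?key e')))" for x
      unfolding pat_def using e ne E_fin[OF i] by (subst prod.remove[of _ e]) (auto intro!: prod.cong)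
    then show ?thesis
      by (simp only:) (intro affine_fun_multc lit affine_funI[of _ 0 1], simp)
  next
    case False
    then have "pat (E i) (s i) (\<lambda>u v. (w(\<kappa> := x)) (vkey g cls u v)) \<phi>
        = (\<Prod>e\<in>E i. lit (s i e) (w (?key e)))" for x
      unfolding pat_def by (auto intro!: prod.cong)
    then show ?thesis by (simp only: affine_fun_const)
  qed
  then have 1: "affine_fun (\<lambda>x. dens (\<lambda>u v. (w(\<kappa> := x)) (vkey g cls u v)) \<phi>)"
    unfolding dens_def by (intro affine_fun_sum affine_fun_cmult)
  have dis: "affine_fun (\<lambda>x. dis g (\<lambda>u v. (w(\<kappa> := x)) (vkey g cls u v)) u v - d)" for u v
    by (cases "g u v") (simp_all only: dis_def if_True if_False, (intro affine_fun_diff affine_fun_const pt)+)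
  let ?q = "\<lambda>x. (dis g (\<lambda>u v. (w(\<kappa> := x)) (vkey g cls u v)) (\<phi> 0) (\<phi> 1) - d)
      * (dis g (\<lambda>u v. (w(\<kappa> := x)) (vkey g cls u v)) (\<phi> 2) (\<phi> 3) - d)"
  have 2: "affine_fun ?q"
  proof (cases "vkey g cls (\<phi> 0) (\<phi> 1) = \<kappa>")
    case True
    have "vkey g cls (\<phi> 2) (\<phi> 3) \<noteq> \<kappa>" using key_inj[of "(0, 1)" "(2, 3)"] True k4 by auto
    then have "?q = (\<lambda>x. (dis g (\<lambda>u v. (w(\<kappa> := x)) (vkey g cls u v)) (\<phi> 0) (\<phi> 1) - d)
      * (dis g (\<lambda>u v. w (vkey g cls u v)) (\<phi> 2) (\<phi> 3) - d))" by (simp add: dis_def fun_eq_iff)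
    then show ?thesis by (simp only:) (intro affine_fun_multc dis)
  next
    case False
    then have "?q = (\<lambda>x. (dis g (\<lambda>u v. w (vkey g cls u v)) (\<phi> 0) (\<phi> 1) - d)
      * (dis g (\<lambda>u v. (w(\<kappa> := x)) (vkey g cls u v)) (\<phi> 2) (\<phi> 3) - d))" by (simp add: dis_def fun_eq_iff)
    then show ?thesis by (simp only:) (intro affine_fun_cmult dis)
  qed
  show ?thesis unfolding J_def by (intro affine_fun_diff 1 affine_fun_cmult 2)
qed

end

definition all_keys :: "nat \<Rightarrow> nat \<Rightarrow> nat \<Rightarrow> ((nat \<times> (nat \<times> nat) set) set \<times> bool) set" where
  "all_keys N m k = (\<lambda>(c, c', b). ({c, c'}, b)) `
     (({..<N} \<times> Pow ({..<m} \<times> {..<k})) \<times> ({..<N} \<times> Pow ({..<m} \<times> {..<k})) \<times> UNIV)"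

lemma finite_all_keys: "finite (all_keys N m k)"
  by (simp add: all_keys_def)

lemma card_all_keys: "card (all_keys N m k) \<le> 2 * (N * 2 ^ (m * k))\<^sup>2"
proof -
  have "card (all_keys N m k) \<le> card (({..<N} \<times> Pow ({..<m} \<times> {..<k})) \<times> ({..<N} \<times> Pow ({..<m} \<times> {..<k})) \<times> (UNIV :: bool set))"
    unfolding all_keys_def by (intro card_image_le) simp
  also have "\<dots> = 2 * (N * 2 ^ (m * k))\<^sup>2"
    by (simp add: card_cartesian_product card_Pow card_UNIV_bool power2_eq_square)
  finally show ?thesis .
qed

lemma vkey_in_all_keys: "r u < N \<Longrightarrow> r v < N \<Longrightarrow> vkey g (vclass g N m k U r) u v \<in> all_keys N m k"
  unfolding all_keys_def
  by (rule image_eqI[where x="(vclass g N m k U r u, vclass g N m k U r v, g u v)"])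
     (auto simp: vkey_def vclass_def)

context pattern_family
begin

text \<open>Each subtracted term pays for one replacement. \<open>Q * (q * \<delta>)\<close> passes
  from \<open>h\<close> to its regular approximation, which has the same distance to
  \<open>g\<close> and so no penalty. \<open>B * (k^2 * \<rho>)\<close> is paid once for discarding
  samples with two vertices in a block and once for restoring them after rounding.
  \<open>2 * k * \<gamma> + loss U\<close> is the price of recolouring. Rounding is free. The
  conclusion mentions neither the colouring nor its table, only a set of keys.\<close>

lemma structured_approximation:
  fixes g h :: "'v \<Rightarrow> 'v \<Rightarrow> bool" and r :: "'v \<Rightarrow> nat"
  assumes V: "finite V" "V \<noteq> {}" and r: "\<And>v. v \<in> V \<Longrightarrow> r v < N"
    and fib: "\<And>z. real (card {v\<in>V. r v = z}) \<le> \<rho> * real (card V)" and \<rho>: "\<rho> \<ge> 0"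
    and gs: "\<And>u v. g u v = g v u" and hs: "\<And>u v. h u v = h v u"
    and \<delta>: "\<delta> > 0" "real L * \<delta>\<^sup>2 > 1" and C: "C \<ge> 0" and \<gamma>: "\<gamma> > 0" and m: "m > 0"
  defines "B \<equiv> Q + C" and "d \<equiv> avg V (\<lambda>u. avg V (\<lambda>v. of_bool (g u v \<noteq> h u v)))"
  shows "\<exists>loss. (\<forall>U. 0 \<le> loss U) \<and>
    avg (tuples N (tuples m (tuples k V))) loss
      \<le> 2 * real k * B * (real k * (4 ^ L * (2 * exp (- (real m * \<gamma>\<^sup>2 / (16 * B\<^sup>2)))))) \<and>
    (\<forall>U\<in>tuples N (tuples m (tuples k V)). \<exists>\<tau>\<subseteq>all_keys N m k.
      avg (tuples k V) (dens (\<lambda>u v. of_bool (h u v))) - Q * (real q * \<delta>) - 2 * B * (real (k\<^sup>2) * \<rho>) - 2 * real k * \<gamma> - loss U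
      \<le> avg (tuples k V) (dens (key_ind g (vclass g N m k U r) \<tau>))
        - C * (avg V (\<lambda>u. avg V (dis g (key_ind g (vclass g N m k U r) \<tau>) u)) - d)\<^sup>2)"
proof -
  obtain \<xi> :: "'v \<Rightarrow> nat" and w where \<xi>: "\<And>v. \<xi> v < 4 ^ L"
    and ws: "\<And>c c' b. w c c' b = w c' c b" and w0: "\<And>c c' b. 0 \<le> w c c' b" and w1: "\<And>c c' b. w c c' b \<le> 1"
    and cut: "\<And>A B. A \<subseteq> V \<Longrightarrow> B \<subseteq> V \<Longrightarrow>
      \<bar>\<Sum>u\<in>A. \<Sum>v\<in>B. of_bool (h u v) - w (\<xi> u) (\<xi> v) (g u v)\<bar> \<le> \<delta> * (real (card V))\<^sup>2"
    and orth: "\<And>b. (\<Sum>u\<in>V. \<Sum>v\<in>V. (of_bool (h u v) - w (\<xi> u) (\<xi> v) (g u v)) * of_bool (g u v = b)) = 0"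
    by (rule relative_weak_regularity[of V g h \<delta> L, OF V(1) gs hs \<delta>]) (rule that; assumption)
  define W where "W = (\<lambda>u v. w (\<xi> u) (\<xi> v) (g u v))"
  define inj where "inj = (\<lambda>\<phi>. inj_on (\<lambda>a. r (\<phi> a)) {..<k})"
  \<comment> \<open>The sample acts only through the adjacencies among its vertices, and the colours
    are passed separately. Kernels on positions, with \<open>id\<close> as the sample, make this
    visible and give the dependence on types that the locale asks for.\<close>
  define H where "H = (\<lambda>\<phi> \<rho>. if inj \<phi> then J (\<lambda>a b. g (\<phi> a) (\<phi> b)) C d (\<lambda>a b. w (\<rho> a) (\<rho> b) (g (\<phi> a) (\<phi> b))) id else 0)"
  have d: "0 \<le> d" "d \<le> 1" unfolding d_def using V by (auto intro!: avg_nonneg avg_upper)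
  have B: "B > 0" using Q1 C by (simp add: B_def)
  have T: "tuples k V \<noteq> {}" "finite (tuples k V)" using V by auto
  interpret bo: block_objective V r N m k "4 ^ L" g H B \<gamma>
  proof
    fix \<phi> \<rho>
    show "\<bar>H \<phi> \<rho>\<bar> \<le> B"
      using B J_bound[of "\<lambda>a b. w (\<rho> a) (\<rho> b) (g (\<phi> a) (\<phi> b))" id d C] d C w0 w1 by (simp add: H_def B_def)
    show "\<not> inj_on (\<lambda>a. r (\<phi> a)) {..<k} \<Longrightarrow> H \<phi> \<rho> = 0" by (simp add: H_def inj_def)
  next
    fix \<phi> :: "nat \<Rightarrow> 'v" and \<rho> a v v'
    assume a: "a < k" and rv: "r v = r v'" and gv: "\<And>b. b < k \<Longrightarrow> g v (\<phi> b) = g v' (\<phi> b)"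
    have "inj (\<phi>(a := v)) = inj (\<phi>(a := v'))"
    proof -
      have "(\<lambda>b. r ((\<phi>(a := v)) b)) = (\<lambda>b. r ((\<phi>(a := v')) b))" using rv by (auto simp: fun_eq_iff)
      then show ?thesis by (simp add: inj_def)
    qed
    moreover have "g ((\<phi>(a := v)) b) ((\<phi>(a := v)) c) = g ((\<phi>(a := v')) b) ((\<phi>(a := v')) c)" if "b < c" "c < k" for b c
    proof (cases "b = a \<or> c = a")
      case True
      then show ?thesis using that gv[of b] gv[of c] a gs by auto
    qed simp
    then have "J (\<lambda>b c. g ((\<phi>(a := v)) b) ((\<phi>(a := v)) c)) C d (\<lambda>b c. w (\<rho> b) (\<rho> c) (g ((\<phi>(a := v)) b) ((\<phi>(a := v)) c))) id
      = J (\<lambda>b c. g ((\<phi>(a := v')) b) ((\<phi>(a := v')) c)) C d (\<lambda>b c. w (\<rho> b) (\<rho> c) (g ((\<phi>(a := v')) b) ((\<phi>(a := v')) c))) id"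
      by (intro J_cong) (simp_all only: id_apply)
    ultimately show "H (\<phi>(a := v)) \<rho> = H (\<phi>(a := v')) \<rho>" by (simp only: H_def)
  next
    fix \<phi> :: "nat \<Rightarrow> 'v" and \<rho> \<rho>' :: "nat \<Rightarrow> nat"
    assume "\<And>a. a < k \<Longrightarrow> \<rho> a = \<rho>' a"
    then have "J (\<lambda>a b. g (\<phi> a) (\<phi> b)) C d (\<lambda>a b. w (\<rho> a) (\<rho> b) (g (\<phi> a) (\<phi> b))) id
      = J (\<lambda>a b. g (\<phi> a) (\<phi> b)) C d (\<lambda>a b. w (\<rho>' a) (\<rho>' b) (g (\<phi> a) (\<phi> b))) id"
      by (intro J_cong) simp_all
    then show "H \<phi> \<rho> = H \<phi> \<rho>'" by (simp add: H_def)
  qed (use V r m B \<gamma> in auto)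
  have not_inj: "avg (tuples k V) (\<lambda>\<phi>. of_bool (\<not> inj \<phi>)) \<le> real (k\<^sup>2) * \<rho>"
    unfolding inj_def by (rule avg_not_inj_le[OF V \<rho> fib])
  have dropB: "\<bar>avg (tuples k V) (\<lambda>\<phi>. if inj \<phi> then f \<phi> else 0) - avg (tuples k V) f\<bar> \<le> B * (real (k\<^sup>2) * \<rho>)"
    if f: "\<And>\<phi>. \<bar>f \<phi>\<bar> \<le> B" for f
  proof -
    have "\<bar>avg (tuples k V) (\<lambda>\<phi>. if inj \<phi> then f \<phi> else 0) - avg (tuples k V) f\<bar>
        \<le> avg (tuples k V) (\<lambda>\<phi>. B * of_bool (\<not> inj \<phi>))"
      unfolding avg_diff[symmetric] using f by (intro order_trans[OF abs_avg_le avg_mono]) auto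
    also have "\<dots> \<le> B * (real (k\<^sup>2) * \<rho>)" unfolding avg_cmult using not_inj B by (intro mult_left_mono) auto
    finally show ?thesis .
  qed
  have dens_W: "\<bar>avg (tuples k V) (dens (\<lambda>u v. of_bool (h u v))) - avg (tuples k V) (dens W)\<bar> \<le> Q * (real q * \<delta>)"
  proof (rule dens_counting[OF V])
    show "cut_small V (\<lambda>u v. of_bool (h u v) - W u v) \<delta>"
      using cut \<delta> unfolding W_def by (intro cut_smallI V) auto
  qed (use \<delta> w0 w1 in \<open>auto simp: W_def\<close>)
  \<comment> \<open>\<open>dis\<close> has slope -1 on the edges and 1 on the non-edges of
    \<open>g\<close>, and the regular approximation preserves the density on each of the two sets.
    So the penalty vanishes at \<open>W\<close>.\<close>
  have dis_W: "avg V (\<lambda>u. avg V (dis g W u)) = d"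
  proof -
    have "d - avg V (\<lambda>u. avg V (dis g W u)) = avg V (\<lambda>u. avg V (\<lambda>v. of_bool (g u v \<noteq> h u v) - dis g W u v))"
      by (simp only: d_def avg_diff)
    also have "\<dots> = avg V (\<lambda>u. avg V (\<lambda>v. (of_bool (h u v) - W u v) * of_bool (g u v = False)
        - (of_bool (h u v) - W u v) * of_bool (g u v = True)))"
      by (intro avg_cong) (auto simp: dis_def)
    also have "\<dots> = 0"
      using orth[of True] orth[of False] unfolding avg_diff
      by (simp add: avg_def sum_divide_distrib[symmetric] W_def)
    finally show ?thesis by simp
  qed
  have obj_\<xi>: "bo.obj \<xi> \<ge> avg (tuples k V) (dens W) - B * (real (k\<^sup>2) * \<rho>)"
  proof -
    have "bo.obj \<xi> = avg (tuples k V) (\<lambda>\<phi>. if inj \<phi> then J g C d W \<phi> else 0)"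
      unfolding bo.obj_def
    proof (rule avg_cong)
      fix \<phi>
      have "J (\<lambda>a b. g (\<phi> a) (\<phi> b)) C d (\<lambda>a b. w ((\<xi> \<circ> \<phi>) a) ((\<xi> \<circ> \<phi>) b) (g (\<phi> a) (\<phi> b))) id = J g C d W \<phi>"
        by (rule J_cong) (simp_all add: W_def)
      then show "H \<phi> (\<xi> \<circ> \<phi>) = (if inj \<phi> then J g C d W \<phi> else 0)" by (simp only: H_def)
    qed
    moreover have "\<bar>J g C d W \<phi>\<bar> \<le> B" for \<phi>
      unfolding B_def using w0 w1 d C by (intro J_bound) (auto simp: W_def)
    ultimately show ?thesis using dropB[of "J g C d W"] avg_J[OF V, of g C d W] dis_W by simp
  qed
  show ?thesis
  proof (intro exI[of _ "bo.loss \<xi>"] conjI allI ballI, goal_cases)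
    case 1
    show ?case by (rule bo.loss_nonneg)
  next
    case 2
    show ?case using bo.avg_loss[of \<xi>] by (simp add: bo.fail_def)
  next
    case U: (3 U)
    define cls where "cls = vclass g N m k U r"
    define \<xi>' where "\<xi>' = bo.colouring \<xi> U N"
    have \<xi>'_cls: "\<xi>' u = \<xi>' v" if "u \<in> V" "v \<in> V" "cls u = cls v" for u v
      using bo.colouring_vclass[OF U that(1,2)] that(3) by (simp add: \<xi>'_def cls_def)
    \<comment> \<open>By \<open>\<xi>'_cls\<close> the table entry agrees on all pairs with the same
      key, up to the order of the colours, which the symmetry of \<open>w\<close> makes irrelevant.
      It can thus be read off any representative pair.\<close>
    define pick where "pick = (\<lambda>\<kappa>. SOME p. fst p \<in> V \<and> snd p \<in> V \<and> vkey g cls (fst p) (snd p) = \<kappa>)"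
    define w' where "w' = (\<lambda>\<kappa>. w (\<xi>' (fst (pick \<kappa>))) (\<xi>' (snd (pick \<kappa>))) (snd \<kappa>))"
    have w': "w' (vkey g cls u v) = w (\<xi>' u) (\<xi>' v) (g u v)" if uv: "u \<in> V" "v \<in> V" for u v
    proof -
      obtain u' v' where p: "pick (vkey g cls u v) = (u', v')" by (metis surj_pair)
      have "\<exists>p. fst p \<in> V \<and> snd p \<in> V \<and> vkey g cls (fst p) (snd p) = vkey g cls u v"
        using uv by (intro exI[of _ "(u, v)"]) simp
      from someI_ex[OF this] have p': "u' \<in> V" "v' \<in> V" "{cls u', cls v'} = {cls u, cls v}"
        using p by (auto simp: pick_def vkey_def)
      have "(cls u' = cls u \<and> cls v' = cls v) \<or> (cls u' = cls v \<and> cls v' = cls u)"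
        using p'(3) by (simp add: doubleton_eq_iff)
      then have or: "(\<xi>' u' = \<xi>' u \<and> \<xi>' v' = \<xi>' v) \<or> (\<xi>' u' = \<xi>' v \<and> \<xi>' v' = \<xi>' u)"
        using \<xi>'_cls[of u' u] \<xi>'_cls[of v' v] \<xi>'_cls[of u' v] \<xi>'_cls[of v' u] uv p'(1,2) by blast
      have "w' (vkey g cls u v) = w (\<xi>' u') (\<xi>' v') (snd (vkey g cls u v))"
        by (simp only: w'_def p fst_conv snd_conv)
      also have "snd (vkey g cls u v) = g u v" by (simp add: vkey_def)
      also have "w (\<xi>' u') (\<xi>' v') (g u v) = w (\<xi>' u) (\<xi>' v) (g u v)"
        using or ws[of "\<xi>' u" "\<xi>' v" "g u v"] by (elim disjE conjE) (simp_all only:)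
      finally show ?thesis .
    qed
    define F where "F = (\<lambda>w0. avg (tuples k V) (\<lambda>\<phi>. if inj \<phi> then J g C d (\<lambda>u v. w0 (vkey g cls u v)) \<phi> else 0))"
    have F_obj: "F w' = bo.obj \<xi>'"
      unfolding F_def bo.obj_def
    proof (rule avg_cong)
      fix \<phi> assume \<phi>: "\<phi> \<in> tuples k V"
      have "J g C d (\<lambda>u v. w' (vkey g cls u v)) \<phi>
        = J (\<lambda>a b. g (\<phi> a) (\<phi> b)) C d (\<lambda>a b. w ((\<xi>' \<circ> \<phi>) a) ((\<xi>' \<circ> \<phi>) b) (g (\<phi> a) (\<phi> b))) id"
        using tuples_mem[OF \<phi>] w' by (intro J_cong) simp_all
      then show "(if inj \<phi> then J g C d (\<lambda>u v. w' (vkey g cls u v)) \<phi> else 0) = H \<phi> (\<xi>' \<circ> \<phi>)"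
        by (simp only: H_def)
    qed
    have "\<exists>\<tau>\<subseteq>all_keys N m k. F w' \<le> F (\<lambda>\<kappa>. if \<kappa> \<in> all_keys N m k then of_bool (\<kappa> \<in> \<tau>) else w' \<kappa>)"
    proof (rule multiaffine_rounding[OF _ finite_all_keys])
      show "0 \<le> w' \<kappa> \<and> w' \<kappa> \<le> 1" for \<kappa> using w0 w1 by (simp add: w'_def)
      fix w0 :: "(nat \<times> (nat \<times> nat) set) set \<times> bool \<Rightarrow> real" and \<kappa>
      show "affine_fun (\<lambda>x. F (w0(\<kappa> := x)))" unfolding F_def
      proof (rule affine_fun_avg)
        fix \<phi>
        show "affine_fun (\<lambda>x. if inj \<phi> then J g C d (\<lambda>u v. (w0(\<kappa> := x)) (vkey g cls u v)) \<phi> else 0)"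
        proof (cases "inj \<phi>")
          case True
          have "inj_on (\<lambda>a. cls (\<phi> a)) {..<k}"
          proof (rule inj_onI)
            fix a b assume ab: "a \<in> {..<k}" "b \<in> {..<k}" "cls (\<phi> a) = cls (\<phi> b)"
            then have "r (\<phi> a) = r (\<phi> b)" by (simp add: cls_def vclass_def)
            then show "a = b" using True ab by (auto simp: inj_def inj_on_def)
          qed
          then have "affine_fun (\<lambda>x. J g C d (\<lambda>u v. (w0(\<kappa> := x)) (vkey g cls u v)) \<phi>)"
            by (rule J_affine[where cls=cls and \<phi>=\<phi>])
          then show ?thesis using True by (simp only: if_True)
        next
          case False
          then show ?thesis by (simp only: if_False affine_fun_const)
        qed
      qed
    qed
    then obtain \<tau> where \<tau>: "\<tau> \<subseteq> all_keys N m k"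
      "F w' \<le> F (\<lambda>\<kappa>. if \<kappa> \<in> all_keys N m k then of_bool (\<kappa> \<in> \<tau>) else w' \<kappa>)" by blast
    define Z where "Z = key_ind g cls \<tau>"
    have "F (\<lambda>\<kappa>. if \<kappa> \<in> all_keys N m k then of_bool (\<kappa> \<in> \<tau>) else w' \<kappa>)
       = avg (tuples k V) (\<lambda>\<phi>. if inj \<phi> then J g C d Z \<phi> else 0)"
      unfolding F_def
    proof (rule avg_cong)
      fix \<phi> assume \<phi>: "\<phi> \<in> tuples k V"
      have "J g C d (\<lambda>u v. if vkey g cls u v \<in> all_keys N m k then of_bool (vkey g cls u v \<in> \<tau>) else w' (vkey g cls u v)) \<phi>
        = J g C d Z \<phi>" if "inj \<phi>"
      proof (rule J_cong)
        fix a b :: nat assume ab: "a < b" "b < k"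
        then have "\<phi> a \<in> V" "\<phi> b \<in> V" using tuples_mem[OF \<phi>] by auto
        then have "vkey g cls (\<phi> a) (\<phi> b) \<in> all_keys N m k"
          using r unfolding cls_def by (intro vkey_in_all_keys) auto
        \<comment> \<open>Distinct blocks force distinct vertices, so setting the diagonal of
          \<open>Z\<close> to 0 has no effect on the samples that count.\<close>
        moreover have "\<phi> a \<noteq> \<phi> b"
        proof
          assume "\<phi> a = \<phi> b"
          then show False using inj_onD[OF that[unfolded inj_def], of a b] ab by simp
        qed
        ultimately show "(if vkey g cls (\<phi> a) (\<phi> b) \<in> all_keys N m k then of_bool (vkey g cls (\<phi> a) (\<phi> b) \<in> \<tau>) else w' (vkey g cls (\<phi> a) (\<phi> b))) = Z (\<phi> a) (\<phi> b)"
          by (simp add: Z_def key_ind_def)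
      qed simp
      then show "(if inj \<phi> then J g C d (\<lambda>u v. if vkey g cls u v \<in> all_keys N m k then of_bool (vkey g cls u v \<in> \<tau>) else w' (vkey g cls u v)) \<phi> else 0)
        = (if inj \<phi> then J g C d Z \<phi> else 0)" by (simp only: cong: if_cong)
    qed
    also have "\<dots> \<le> avg (tuples k V) (J g C d Z) + B * (real (k\<^sup>2) * \<rho>)"
    proof -
      have bd: "\<bar>J g C d Z \<phi>\<bar> \<le> B" for \<phi>
        unfolding B_def using d C by (intro J_bound) (auto simp: Z_def key_ind_def)
      show ?thesis using dropB[of "J g C d Z", OF bd] by linarith
    qed
    finally have "F w' \<le> avg (tuples k V) (J g C d Z) + B * (real (k\<^sup>2) * \<rho>)" using \<tau>(2) by linarith
    then show ?case
      using obj_\<xi> bo.obj_colouring[of \<xi> U, OF \<xi>] dens_W \<tau>(1)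
      unfolding F_obj \<xi>'_def avg_J[OF V] abs_le_iff Z_def cls_def
      by (intro exI[of _ \<tau>] conjI) linarith+
  qed
qed

end

section \<open>Sampling and edit distance\<close>

primrec query_list :: "(nat \<times> nat) list \<Rightarrow> (nat set set \<Rightarrow> 'r) \<Rightarrow> 'r qtree" where
  "query_list [] D = Output (D {})"
| "query_list (p # ps) D = Query (fst p) (snd p)
     (query_list ps (\<lambda>E. D (insert {fst p, snd p} E))) (query_list ps D)"

lemma queries_query_list [simp]: "queries G (query_list ps D) = ps"
  by (induction ps arbitrary: D) auto

lemma result_query_list:
  "result G (query_list ps D) = D {e \<in> edges G. \<exists>p\<in>set ps. e = {fst p, snd p}}"
proof (induction ps arbitrary: D)
  case (Cons p ps)
  have "{e \<in> edges G. \<exists>p'\<in>set (p # ps). e = {fst p', snd p'}}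
    = (if {fst p, snd p} \<in> edges G then {{fst p, snd p}} else {}) \<union> {e \<in> edges G. \<exists>p'\<in>set ps. e = {fst p', snd p'}}"
    by auto
  then show ?case using Cons by simp
qed simp

definition pair_list :: "nat set \<Rightarrow> (nat \<times> nat) list" where
  "pair_list S = filter (\<lambda>p. fst p < snd p) (List.product (sorted_list_of_set S) (sorted_list_of_set S))"

lemma set_pair_list: "finite S \<Longrightarrow> set (pair_list S) = {p \<in> S \<times> S. fst p < snd p}"
  by (auto simp: pair_list_def)

lemma length_pair_list: "finite S \<Longrightarrow> length (pair_list S) \<le> (card S)\<^sup>2"
  unfolding pair_list_def
  by (rule order_trans[OF length_filter_le]) (simp add: power2_eq_square)

lemma revealed_edges:
  assumes "simple_graph G" "finite S"
  shows "{e \<in> edges G. \<exists>p\<in>set (pair_list S). e = {fst p, snd p}} = {e \<in> edges G. e \<subseteq> S}"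
proof -
  have "\<exists>p\<in>set (pair_list S). e = {fst p, snd p}" if e: "e \<in> edges G" "e \<subseteq> S" for e
  proof -
    have "card e = 2" using assms(1) e(1) by (auto simp: simple_graph_def)
    then obtain u v where uv: "e = {u, v}" "u \<noteq> v" by (auto simp: card_2_iff)
    show ?thesis
    proof (cases "u < v")
      case True
      then show ?thesis using uv e assms(2) by (intro bexI[of _ "(u, v)"]) (auto simp: set_pair_list)
    next
      case False
      then show ?thesis using uv e assms(2) by (intro bexI[of _ "(v, u)"]) (auto simp: set_pair_list)
    qed
  qed
  moreover have "e \<subseteq> S" if "\<exists>p\<in>set (pair_list S). e = {fst p, snd p}" for e
    using that assms(2) by (auto simp: set_pair_list)
  ultimately show ?thesis by blast
qed

text \<open>\<open>\<omega>\<close> carries all the randomness. Since it is uniform on a finite set,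
  output probabilities become averages over \<open>\<Omega>\<close>.\<close>

definition sample_algorithm :: "'w set \<Rightarrow> ('w \<Rightarrow> nat set) \<Rightarrow> ('w \<Rightarrow> nat set set \<Rightarrow> 'r) \<Rightarrow> 'r qtree pmf" where
  "sample_algorithm \<Omega> S D = map_pmf (\<lambda>\<omega>. query_list (pair_list (S \<omega>)) (D \<omega>)) (pmf_of_set \<Omega>)"

lemma sample_algorithm_queries:
  assumes "finite \<Omega>" "\<Omega> \<noteq> {}" and S: "\<And>\<omega>. \<omega> \<in> \<Omega> \<Longrightarrow> S \<omega> \<subseteq> {..<n} \<and> card (S \<omega>) \<le> b"
    and t: "t \<in> set_pmf (sample_algorithm \<Omega> S D)"
  shows "(\<forall>(u, v)\<in>set (queries G t). u < n \<and> v < n \<and> u \<noteq> v) \<and> length (queries G t) \<le> b\<^sup>2"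
proof -
  obtain \<omega> where \<omega>: "\<omega> \<in> \<Omega>" "t = query_list (pair_list (S \<omega>)) (D \<omega>)"
    using t assms(1,2) by (auto simp: sample_algorithm_def)
  have fin: "finite (S \<omega>)" using S[OF \<omega>(1)] finite_subset by blast
  have "length (pair_list (S \<omega>)) \<le> b\<^sup>2"
    using length_pair_list[OF fin] S[OF \<omega>(1)] by (meson order_trans power_mono zero_le)
  moreover have "\<forall>(u, v)\<in>set (pair_list (S \<omega>)). u < n \<and> v < n \<and> u \<noteq> v"
    using S[OF \<omega>(1)] unfolding set_pair_list[OF fin] by auto
  ultimately show ?thesis unfolding \<omega>(2) queries_query_list by blast
qed

lemma sample_algorithm_prob:
  assumes "finite \<Omega>" "\<Omega> \<noteq> {}" and S: "\<And>\<omega>. \<omega> \<in> \<Omega> \<Longrightarrow> finite (S \<omega>)" and G: "simple_graph G"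
  shows "measure_pmf.prob (sample_algorithm \<Omega> S D) {t. result G t = x}
    = avg \<Omega> (\<lambda>\<omega>. of_bool (D \<omega> {e \<in> edges G. e \<subseteq> S \<omega>} = x))"
proof -
  have "measure_pmf.prob (sample_algorithm \<Omega> S D) {t. result G t = x}
    = measure_pmf.prob (pmf_of_set \<Omega>) {\<omega>. result G (query_list (pair_list (S \<omega>)) (D \<omega>)) = x}"
    by (simp add: sample_algorithm_def vimage_def)
  also have "\<dots> = card {\<omega>\<in>\<Omega>. result G (query_list (pair_list (S \<omega>)) (D \<omega>)) = x} / card \<Omega>"
    using assms(1,2) by (simp add: measure_pmf_of_set Int_def)
  also have "{\<omega>\<in>\<Omega>. result G (query_list (pair_list (S \<omega>)) (D \<omega>)) = x}
      = {\<omega>\<in>\<Omega>. D \<omega> {e \<in> edges G. e \<subseteq> S \<omega>} = x}"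
    using revealed_edges[OF G S] by (auto simp: result_query_list)
  finally show ?thesis using assms(1) by (simp add: avg_card)
qed

section \<open>Edit distance as an average over pairs, and vertex blocks\<close>

lemma edit_distance_sum:
  assumes G: "simple_graph G" "nverts G = n" and H: "simple_graph H" "nverts H = n"
  shows "2 * real (edit_distance G H) = (\<Sum>u<n. \<Sum>v<n. of_bool (adj G u v \<noteq> adj H u v))"
proof -
  define D where "D = (edges G - edges H) \<union> (edges H - edges G)"
  have D: "e \<subseteq> {..<n} \<and> card e = 2" if "e \<in> D" for e
    using that G H by (auto simp: D_def simple_graph_def)
  have finD: "finite D" by (rule finite_subset[of _ "Pow {..<n}"]) (use D in auto)
  define X where "X = {p \<in> {..<n} \<times> {..<n}. {fst p, snd p} \<in> D}"
  have finX: "finite X" by (simp add: X_def)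
  have "(\<Sum>u<n. \<Sum>v<n. of_bool (adj G u v \<noteq> adj H u v)) = (\<Sum>u<n. \<Sum>v<n. of_bool ({u, v} \<in> D) :: real)"
    by (intro sum.cong refl arg_cong[where f=of_bool]) (auto simp: D_def adj_def)
  also have "\<dots> = (\<Sum>p\<in>{..<n} \<times> {..<n}. of_bool ({fst p, snd p} \<in> D) :: real)"
    by (simp only: sum.cartesian_product' fst_conv snd_conv)
  also have "\<dots> = real (card X)" by (simp add: X_def of_bool_def sum.If_cases Int_def)
  also have "card X = (\<Sum>e\<in>(\<lambda>p. {fst p, snd p}) ` X. card {p\<in>X. {fst p, snd p} = e})"
    using sum.image_gen[OF finX, of "\<lambda>_. 1::nat" "\<lambda>p. {fst p, snd p}"] by simp
  also have "(\<lambda>p. {fst p, snd p}) ` X = D"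
  proof
    show "D \<subseteq> (\<lambda>p. {fst p, snd p}) ` X"
    proof
      fix e assume e: "e \<in> D"
      then obtain u v where "e = {u, v}" using D[OF e] by (auto simp: card_2_iff)
      then show "e \<in> (\<lambda>p. {fst p, snd p}) ` X" using D[OF e] e by (intro image_eqI[of _ _ "(u, v)"]) (auto simp: X_def)
    qed
  qed (auto simp: X_def)
  also have "(\<Sum>e\<in>D. card {p\<in>X. {fst p, snd p} = e}) = (\<Sum>e\<in>D. 2)"
  proof (rule sum.cong)
    fix e assume e: "e \<in> D"
    then obtain u v where uv: "e = {u, v}" "u \<noteq> v" using D[OF e] by (auto simp: card_2_iff)
    have "{p\<in>X. {fst p, snd p} = e} = {(u, v), (v, u)}"
      using D[OF e] e uv by (auto simp: X_def doubleton_eq_iff insert_commute)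
    then show "card {p\<in>X. {fst p, snd p} = e} = 2" using uv by simp
  qed simp
  finally show ?thesis by (simp add: edit_distance_def D_def)
qed

text \<open>Ordered pairs count every changed edge twice, hence the factor 1/2; later thresholds on
  the average involve \<open>2 * \<alpha>\<close> for this reason.\<close>

lemma edit_distance_avg:
  assumes G: "simple_graph G" "nverts G = n" and H: "simple_graph H" "nverts H = n"
  shows "real (edit_distance G H) = avg {..<n} (\<lambda>u. avg {..<n} (\<lambda>v. of_bool (adj G u v \<noteq> adj H u v))) / 2 * (real n)\<^sup>2"
proof -
  have "n \<ge> 1" using G by (auto simp: simple_graph_def)
  then show ?thesis
    using edit_distance_sum[OF G H] by (simp add: avg_def sum_divide_distrib[symmetric] power2_eq_square)
qed

lemma edit_distance_triangle:
  assumes "simple_graph G" "simple_graph H" "simple_graph K"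
  shows "edit_distance G H \<le> edit_distance G K + edit_distance K H"
proof -
  have fin: "finite (edges G)" if "simple_graph G" for G
    by (rule finite_subset[of _ "Pow {..<nverts G}"]) (use that in \<open>auto simp: simple_graph_def\<close>)
  have "(edges G - edges H) \<union> (edges H - edges G)
      \<subseteq> ((edges G - edges K) \<union> (edges K - edges G)) \<union> ((edges K - edges H) \<union> (edges H - edges K))" by auto
  then have "edit_distance G H \<le> card (((edges G - edges K) \<union> (edges K - edges G)) \<union> ((edges K - edges H) \<union> (edges H - edges K)))"
    unfolding edit_distance_def using fin assms by (intro card_mono) auto
  also have "\<dots> \<le> edit_distance G K + edit_distance K H"
    unfolding edit_distance_def by (rule card_Un_le)
  finally show ?thesis .
qed

text \<open>Residues modulo \<open>N\<close> serve as blocks: they are known without queries and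
  almost equal in size. Division by \<open>N\<close> is injective on a block and takes at most
  \<open>n div N + 1\<close> values.\<close>

lemma card_residue_class:
  assumes "N > 0" "n > 0"
  shows "real (card {v\<in>{..<n}. v mod N = z}) \<le> (1 / real N + 1 / real n) * real (card {..<n})"
proof -
  have "inj_on (\<lambda>v. v div N) {v\<in>{..<n}. v mod N = z}"
    by (rule inj_onI) (metis (mono_tags, lifting) div_mult_mod_eq mem_Collect_eq)
  moreover have "(\<lambda>v. v div N) ` {v\<in>{..<n}. v mod N = z} \<subseteq> {..n div N}"
    by (auto intro: div_le_mono)
  ultimately have "card {v\<in>{..<n}. v mod N = z} \<le> n div N + 1"
    using card_inj_on_le[of "\<lambda>v. v div N" _ "{..n div N}"] by simp
  then have "real (card {v\<in>{..<n}. v mod N = z}) \<le> real (n div N) + 1" by linarith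
  also have "\<dots> \<le> real n / real N + 1" using of_nat_div_le_of_nat[of n N] by simp
  also have "\<dots> = (1 / real N + 1 / real n) * real (card {..<n})" using assms by (simp add: field_simps)
  finally show ?thesis .
qed

text \<open>A key is an unordered pair of vertex classes together with the adjacency in G; the set \<open>\<tau>\<close>
  of keys is the table that decides which pairs become edges.\<close>

definition key_graph :: "sgraph \<Rightarrow> nat \<Rightarrow> nat \<Rightarrow> nat \<Rightarrow> (nat \<Rightarrow> nat \<Rightarrow> nat \<Rightarrow> nat) \<Rightarrow>
    ((nat \<times> (nat \<times> nat) set) set \<times> bool) set \<Rightarrow> sgraph" where
  "key_graph G N m k U \<tau> = \<lparr>nverts = nverts G, edges = {{u, v} |u v. u < nverts G \<and> v < nverts G \<and> u \<noteq> v \<and>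
     vkey (adj G) (vclass (adj G) N m k U (\<lambda>v. v mod N)) u v \<in> \<tau>}\<rparr>"

lemma key_graph_simple: "simple_graph G \<Longrightarrow> simple_graph (key_graph G N m k U \<tau>)"
  by (auto simp: key_graph_def simple_graph_def)

lemma key_graph_nverts [simp]: "nverts (key_graph G N m k U \<tau>) = nverts G"
  by (simp add: key_graph_def)

lemma adj_key_graph:
  assumes "u < nverts G" "v < nverts G"
  shows "adj (key_graph G N m k U \<tau>) u v \<longleftrightarrow>
    u \<noteq> v \<and> vkey (adj G) (vclass (adj G) N m k U (\<lambda>v. v mod N)) u v \<in> \<tau>"
proof -
  have "vkey (adj G) c u v = vkey (adj G) c v u" for c :: "nat \<Rightarrow> nat \<times> (nat \<times> nat) set" and u v
    by (simp add: vkey_def insert_commute adj_sym)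
  then show ?thesis using assms unfolding adj_def key_graph_def by (auto simp: doubleton_eq_iff)
qed

text \<open>Both classes and the adjacency of two vertices of \<open>S\<close> are determined by the
  edges inside \<open>S\<close>, because the classifying samples lie in \<open>S\<close>. So the
  algorithm can evaluate any key graph on its sample although most of \<open>G\<close> is
  unseen.\<close>

lemma adj_key_graph_revealed:
  assumes G: "simple_graph G" and S: "S \<subseteq> {..<nverts G}"
    and U: "\<And>i j b. i < N \<Longrightarrow> j < m \<Longrightarrow> b < k \<Longrightarrow> U i j b \<in> S" and N: "N > 0"
    and uv: "u \<in> S" "v \<in> S"
  defines "G' \<equiv> \<lparr>nverts = nverts G, edges = {e \<in> edges G. e \<subseteq> S}\<rparr>"
  shows "adj (key_graph G' N m k U \<tau>) u v = adj (key_graph G N m k U \<tau>) u v" "adj G' u v = adj G u v"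
proof -
  have a: "adj G' x y = adj G x y" if "x \<in> S" "y \<in> S" for x y
    using that by (simp add: adj_def G'_def)
  then show "adj G' u v = adj G u v" using uv .
  have "vclass (adj G') N m k U (\<lambda>v. v mod N) x = vclass (adj G) N m k U (\<lambda>v. v mod N) x" if x: "x \<in> S" for x
    unfolding vclass_def using a[OF x U] N by auto
  then have "vkey (adj G') (vclass (adj G') N m k U (\<lambda>v. v mod N)) u v = vkey (adj G) (vclass (adj G) N m k U (\<lambda>v. v mod N)) u v"
    using uv a unfolding vkey_def by simp
  then show "adj (key_graph G' N m k U \<tau>) u v = adj (key_graph G N m k U \<tau>) u v"
    using uv S by (subst (1 2) adj_key_graph) (auto simp: G'_def)
qed

section \<open>The estimator for large graphs\<close>

lemma edge_ind_bounds: "0 \<le> edge_ind G u v \<and> edge_ind G u v \<le> 1"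
  by (simp add: edge_ind_def)

definition edge_dist :: "sgraph \<Rightarrow> sgraph \<Rightarrow> nat \<Rightarrow> nat \<Rightarrow> real" where
  "edge_dist G K u v = of_bool (adj G u v \<noteq> adj K u v)"

lemma dis_edge_ind: "dis (adj G) (edge_ind K) u v = edge_dist G K u v"
  by (simp add: dis_def edge_ind_def edge_dist_def)

lemma prob_ge_two_thirds:
  assumes "finite \<Omega>" "\<Omega> \<noteq> {}" "avg \<Omega> (\<lambda>\<omega>. of_bool (\<not> R \<omega>)) \<le> 1 / 3"
  shows "2 / 3 \<le> avg \<Omega> (\<lambda>\<omega>. of_bool (R \<omega>))"
proof -
  have "avg \<Omega> (\<lambda>\<omega>. of_bool (R \<omega>)) = avg \<Omega> (\<lambda>\<omega>. 1 - of_bool (\<not> R \<omega>))"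
    by (intro avg_cong) auto
  also have "\<dots> = 1 - avg \<Omega> (\<lambda>\<omega>. of_bool (\<not> R \<omega>))" using assms by (simp add: avg_diff avg_const)
  finally show ?thesis using assms(3) by linarith
qed

text \<open>Five errors of at most 1/60 each, from relabelling, regularity, block collisions,
  gradient estimates and \<open>loss\<close>, lower 2/3 to 7/12; sampling costs 1/12 more, which
  explains the threshold 1/2. The loss reaches 1/60 with probability at most 60/360 = 1/6 by Markov,
  and the estimates fail with probability at most 1/6. The value of \<open>C\<close> makes a penalty
  of at most 1/2 mean a deviation in distance of at most \<open>\<epsilon> / 4\<close>.\<close>

lemma estimator_large_graphs:
  fixes P :: "sgraph set" and q n k N m M L :: nat and \<epsilon> \<gamma> \<delta> :: real
  assumes P: "graph_property P" and T: "tester (\<epsilon> / 2) P T" "makes_at_most_queries T (real q)"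
    and \<epsilon>: "\<epsilon> > 0" and n: "n \<ge> 1" and k: "4 \<le> k" "2 * q \<le> k"
  defines "Q \<equiv> 2 ^ (q + 1) :: real" and "C \<equiv> 8 / \<epsilon>\<^sup>2"
  defines "B \<equiv> Q + C"
  assumes e0: "Q * real (k\<^sup>2) / real n \<le> 1 / 60"
    and \<delta>: "\<delta> > 0" "real L * \<delta>\<^sup>2 > 1" "Q * (real q * \<delta>) \<le> 1 / 60"
    and N: "N > 0" "2 * B * (real (k\<^sup>2) * (1 / real N + 1 / real n)) \<le> 1 / 60"
    and \<gamma>: "\<gamma> > 0" "2 * real k * \<gamma> \<le> 1 / 60"
    and m: "m > 0" "2 * real k * B * (real k * (4 ^ L * (2 * exp (- (real m * \<gamma>\<^sup>2 / (16 * B\<^sup>2)))))) \<le> 1 / 360"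
    and M: "M > 0" "2 ^ (2 * (N * 2 ^ (m * k))\<^sup>2)
      * (2 * exp (- (real M * (1 / 12)\<^sup>2 / (16 * Q\<^sup>2))) + 2 * exp (- (real M * (\<epsilon> / 4)\<^sup>2 / (16 * 1\<^sup>2)))) \<le> 1 / 6"
  obtains A :: "real \<Rightarrow> verdict qtree pmf" where
    "\<And>\<alpha> t G. t \<in> set_pmf (A \<alpha>) \<Longrightarrow> (\<forall>(u, v)\<in>set (queries G t). u < n \<and> v < n \<and> u \<noteq> v)
      \<and> length (queries G t) \<le> (N * m * k + M * k)\<^sup>2"
    "\<And>\<alpha> G. simple_graph G \<Longrightarrow> nverts G = n \<Longrightarrow> close_to (\<alpha> - \<epsilon>) P G \<Longrightarrow>
      2 / 3 \<le> measure_pmf.prob (A \<alpha>) {t. result G t = Close}"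
    "\<And>\<alpha> G. simple_graph G \<Longrightarrow> nverts G = n \<Longrightarrow> far_from \<alpha> P G \<Longrightarrow>
      2 / 3 \<le> measure_pmf.prob (A \<alpha>) {t. result G t = Far}"
proof -
  define V where "V = {..<n}"
  have V: "finite V" "V \<noteq> {}" using n by (auto simp: V_def lessThan_empty_iff)
  define e where "e = Q * real (k\<^sup>2) / real n"
  obtain c where pf: "pattern_family k (cert_index n q) c cert_pairs Q q" and
    dP: "\<forall>G. simple_graph G \<longrightarrow> nverts G = n \<longrightarrow>
      (let p = avg (tuples k V) (pattern_family.dens (cert_index n q) c cert_pairs cert_sign (edge_ind G))
       in (G \<in> P \<longrightarrow> 2/3 - e \<le> p) \<and> (far_from (\<epsilon> / 2) P G \<longrightarrow> p \<le> 1/3 + e) \<and> p \<le> 1 + e)"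
    using tester_patterns[OF P T n k] unfolding Q_def e_def V_def by blast
  interpret pattern_family k "cert_index n q" c cert_pairs cert_sign Q q by (rule pf)
  have e60: "e \<le> 1 / 60" using e0 by (simp add: e_def)
  define p where "p = (\<lambda>G. avg (tuples k V) (dens (edge_ind G)))"
  have p_mem: "G \<in> P \<Longrightarrow> 2/3 - e \<le> p G" and p_far: "far_from (\<epsilon> / 2) P G \<Longrightarrow> p G \<le> 1/3 + e"
    and p_le: "p G \<le> 1 + e" if "simple_graph G" "nverts G = n" for G
    using dP[rule_format, OF that] unfolding p_def Let_def by blast+
  define dd where "dd = (\<lambda>G K. avg V (\<lambda>u. avg V (edge_dist G K u)))"
  have edit: "real (edit_distance G K) = dd G K / 2 * (real n)\<^sup>2"
    if "simple_graph G" "nverts G = n" "simple_graph K" "nverts K = n" for G K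
    using edit_distance_avg[OF that] by (simp add: dd_def V_def edge_dist_def[abs_def])
  have Cpos: "C \<ge> 0" using \<epsilon> by (simp add: C_def)
  have Q1: "1 \<le> Q" unfolding Q_def by (rule one_le_power) simp
  define X where "X = tuples N (tuples m (tuples k V))"
  define Y where "Y = tuples M (tuples k V)"
  define \<Omega> where "\<Omega> = X \<times> Y"
  have X: "finite X" "X \<noteq> {}" and Y: "finite Y" "Y \<noteq> {}" using V by (auto simp: X_def Y_def)
  then have \<Omega>: "finite \<Omega>" "\<Omega> \<noteq> {}" by (auto simp: \<Omega>_def)
  define S where "S = (\<lambda>\<omega> :: (nat \<Rightarrow> nat \<Rightarrow> nat \<Rightarrow> nat) \<times> (nat \<Rightarrow> nat \<Rightarrow> nat).
    (\<lambda>x. fst \<omega> (fst x) (fst (snd x)) (snd (snd x))) ` ({..<N} \<times> {..<m} \<times> {..<k})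
    \<union> (\<lambda>x. snd \<omega> (fst x) (snd x)) ` ({..<M} \<times> {..<k}))"
  have S_U: "fst \<omega> i j b \<in> S \<omega>" if "i < N" "j < m" "b < k" for \<omega> i j b
    unfolding S_def using that by (intro UnI1 image_eqI[of _ _ "(i, j, b)"]) auto
  have S_\<psi>: "snd \<omega> j b \<in> S \<omega>" if "j < M" "b < k" for \<omega> j b
    unfolding S_def using that by (intro UnI2 image_eqI[of _ _ "(j, b)"]) auto
  have S_V: "S \<omega> \<subseteq> {..<n}" if "\<omega> \<in> \<Omega>" for \<omega>
  proof -
    have "fst \<omega> \<in> X" "snd \<omega> \<in> Y" using that by (auto simp: \<Omega>_def)
    then have "fst \<omega> i j b \<in> V" "snd \<omega> j' b \<in> V" if "i < N" "j < m" "b < k" "j' < M" for i j j' b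
      using that tuples_mem[OF tuples_mem[OF tuples_mem[of "fst \<omega>"]]] tuples_mem[OF tuples_mem[of "snd \<omega>"]]
      unfolding X_def Y_def by blast+
    then show ?thesis using N m(1) M(1) unfolding S_def V_def by auto
  qed
  have S_card: "card (S \<omega>) \<le> N * m * k + M * k" for \<omega>
  proof -
    have "card (S \<omega>) \<le> card ({..<N} \<times> {..<m} \<times> {..<k}) + card ({..<M} \<times> {..<k})"
      unfolding S_def by (intro order_trans[OF card_Un_le] add_mono card_image_le) auto
    then show ?thesis by (simp add: card_cartesian_product mult.assoc)
  qed
  have S_fin: "finite (S \<omega>)" for \<omega> by (simp add: S_def)
  define KG where "KG = (\<lambda>G U \<tau>. key_graph G N m k U \<tau>)"
  have KG: "simple_graph (KG G U \<tau>)" "nverts (KG G U \<tau>) = n" if "simple_graph G" "nverts G = n" for G U \<tau>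
    using that key_graph_simple[of G] by (simp_all add: KG_def)
  define ep where "ep = (\<lambda>K \<psi>. avg {..<M} (\<lambda>j. dens (edge_ind K) (\<psi> j)))"
  define ed where "ed = (\<lambda>G K \<psi>. avg {..<M} (\<lambda>j. edge_dist G K (\<psi> j 0) (\<psi> j (1::nat))))"
  \<comment> \<open>For a close \<open>G\<close> some key graph has average distance at most
    \<open>2 * (\<alpha> - \<epsilon>) + \<epsilon> / 4\<close>, and the estimate may add another
    \<open>\<epsilon> / 4\<close>.\<close>
  define accept where "accept = (\<lambda>\<alpha> G \<omega>. \<exists>\<tau>\<subseteq>all_keys N m k.
    1 / 2 \<le> ep (KG G (fst \<omega>) \<tau>) (snd \<omega>) \<and> ed G (KG G (fst \<omega>) \<tau>) (snd \<omega>) \<le> 2 * \<alpha> - 3 * \<epsilon> / 2)"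
  define D where "D = (\<lambda>\<alpha> \<omega> E. if accept \<alpha> \<lparr>nverts = n, edges = E\<rparr> \<omega> then Close else Far)"
  have revealed: "accept \<alpha> \<lparr>nverts = n, edges = {e \<in> edges G. e \<subseteq> S \<omega>}\<rparr> \<omega> = accept \<alpha> G \<omega>"
    if \<omega>: "\<omega> \<in> \<Omega>" and G: "simple_graph G" "nverts G = n" for \<alpha> G \<omega>
  proof -
    define G' where "G' = \<lparr>nverts = nverts G, edges = {e \<in> edges G. e \<subseteq> S \<omega>}\<rparr>"
    have adj': "adj (KG G' (fst \<omega>) \<tau>) u v = adj (KG G (fst \<omega>) \<tau>) u v" "adj G' u v = adj G u v"
      if "u \<in> S \<omega>" "v \<in> S \<omega>" for u v \<tau>
      using adj_key_graph_revealed[OF G(1), of "S \<omega>" N m k "fst \<omega>", OF _ S_U N(1) that] S_V[OF \<omega>] G(2)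
      unfolding KG_def G'_def by simp_all
    have "ep (KG G' (fst \<omega>) \<tau>) (snd \<omega>) = ep (KG G (fst \<omega>) \<tau>) (snd \<omega>)" for \<tau>
      unfolding ep_def using adj'(1)[OF S_\<psi> S_\<psi>] by (intro avg_cong dens_cong) (auto simp: edge_ind_def)
    moreover have "ed G' (KG G' (fst \<omega>) \<tau>) (snd \<omega>) = ed G (KG G (fst \<omega>) \<tau>) (snd \<omega>)" for \<tau>
    proof -
      have "0 < k" "1 < k" using k by auto
      then show ?thesis
        unfolding ed_def using adj'[OF S_\<psi> S_\<psi>] by (intro avg_cong) (auto simp: edge_dist_def)
    qed
    ultimately have "accept \<alpha> G' \<omega> = accept \<alpha> G \<omega>" unfolding accept_def by simp
    then show ?thesis using G(2) by (simp add: G'_def)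
  qed
  define A where "A = (\<lambda>\<alpha>. sample_algorithm \<Omega> S (D \<alpha>))"
  have probA: "measure_pmf.prob (A \<alpha>) {t. result G t = x} = avg \<Omega> (\<lambda>\<omega>. of_bool ((if accept \<alpha> G \<omega> then Close else Far) = x))"
    if G: "simple_graph G" "nverts G = n" for \<alpha> G x
    unfolding A_def sample_algorithm_prob[OF \<Omega> S_fin G(1)]
    by (intro avg_cong) (simp add: D_def revealed G)
  \<comment> \<open>The estimates must be right for all tables at once, since the table is selected
    after the sample is seen. \<open>U\<close> is fixed while \<open>\<psi>\<close> is drawn, so the
    key graphs do not depend on \<open>\<psi>\<close>.\<close>
  define bad where "bad = (\<lambda>G U \<psi>. \<exists>\<tau>\<subseteq>all_keys N m k.
    \<bar>ep (KG G U \<tau>) \<psi> - p (KG G U \<tau>)\<bar> > 1 / 12 \<or> \<bar>ed G (KG G U \<tau>) \<psi> - dd G (KG G U \<tau>)\<bar> > \<epsilon> / 4)"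
  have avg_bad: "avg Y (\<lambda>\<psi>. of_bool (bad G U \<psi>)) \<le> 1 / 6" for G U
  proof -
    let ?p = "\<lambda>\<tau> \<psi>. of_bool (\<bar>ep (KG G U \<tau>) \<psi> - p (KG G U \<tau>)\<bar> > 1 / 12) :: real"
    let ?d = "\<lambda>\<tau> \<psi>. of_bool (\<bar>ed G (KG G U \<tau>) \<psi> - dd G (KG G U \<tau>)\<bar> > \<epsilon> / 4) :: real"
    let ?h = "2 * exp (- (real M * (1 / 12)\<^sup>2 / (16 * Q\<^sup>2))) + 2 * exp (- (real M * (\<epsilon> / 4)\<^sup>2 / (16 * 1\<^sup>2)))"
    have T: "finite (tuples k V)" "tuples k V \<noteq> {}" using V by auto
    have "avg Y (\<lambda>\<psi>. of_bool (bad G U \<psi>)) \<le> avg Y (\<lambda>\<psi>. \<Sum>\<tau>\<in>Pow (all_keys N m k). ?p \<tau> \<psi> + ?d \<tau> \<psi>)"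
    proof (rule avg_mono)
      fix \<psi>
      show "of_bool (bad G U \<psi>) \<le> (\<Sum>\<tau>\<in>Pow (all_keys N m k). ?p \<tau> \<psi> + ?d \<tau> \<psi>)"
      proof (cases "bad G U \<psi>")
        case True
        then obtain \<tau> where \<tau>: "\<tau> \<in> Pow (all_keys N m k)" "1 \<le> ?p \<tau> \<psi> + ?d \<tau> \<psi>"
          unfolding bad_def by (auto simp: of_bool_def split: if_splits)
        have "?p \<tau> \<psi> + ?d \<tau> \<psi> \<le> (\<Sum>\<tau>\<in>Pow (all_keys N m k). ?p \<tau> \<psi> + ?d \<tau> \<psi>)"
          using \<tau>(1) finite_all_keys by (intro member_le_sum[where f="\<lambda>\<tau>. ?p \<tau> \<psi> + ?d \<tau> \<psi>"]) auto
        then show ?thesis using True \<tau>(2) by simp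
      qed (simp add: sum_nonneg)
    qed
    also have "\<dots> = (\<Sum>\<tau>\<in>Pow (all_keys N m k). avg Y (?p \<tau>) + avg Y (?d \<tau>))"
      by (simp only: avg_sum avg_add)
    also have "\<dots> \<le> (\<Sum>\<tau>\<in>Pow (all_keys N m k). ?h)"
    proof (intro sum_mono add_mono)
      fix \<tau>
      show "avg Y (?p \<tau>) \<le> 2 * exp (- (real M * (1 / 12)\<^sup>2 / (16 * Q\<^sup>2)))"
        unfolding Y_def ep_def p_def
        using Q1 M(1) dens_bounds[of "edge_ind (KG G U \<tau>)"] edge_ind_bounds
        by (intro Hoeffding[OF T]) auto
      have "dd G (KG G U \<tau>) = avg (tuples k V) (\<lambda>\<phi>. edge_dist G (KG G U \<tau>) (\<phi> 0) (\<phi> 1))"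
        unfolding dd_def using V k by (intro avg_coord2[symmetric]) auto
      then show "avg Y (?d \<tau>) \<le> 2 * exp (- (real M * (\<epsilon> / 4)\<^sup>2 / (16 * 1\<^sup>2)))"
        unfolding Y_def ed_def using \<epsilon> M(1)
        by (simp only:) (intro Hoeffding[where f="\<lambda>\<phi>. edge_dist G (KG G U \<tau>) (\<phi> 0) (\<phi> 1)", OF T], auto simp: edge_dist_def)
    qed
    also have "\<dots> = 2 ^ card (all_keys N m k) * ?h" using finite_all_keys by (simp add: card_Pow)
    also have "\<dots> \<le> 2 ^ (2 * (N * 2 ^ (m * k))\<^sup>2) * ?h"
      by (intro mult_right_mono power_increasing card_all_keys) auto
    also have "\<dots> \<le> 1 / 6" by (rule M(2))
    finally show ?thesis .
  qed
  have avg_bad_\<Omega>: "avg \<Omega> (\<lambda>\<omega>. of_bool (bad G (fst \<omega>) (snd \<omega>))) \<le> 1 / 6" for G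
    unfolding \<Omega>_def avg_Times[where f="\<lambda>U \<psi>. of_bool (bad G U \<psi>)"] by (rule avg_upper[OF X avg_bad])
  show ?thesis
  proof (rule that[of A])
    show "(\<forall>(u, v)\<in>set (queries G t). u < n \<and> v < n \<and> u \<noteq> v) \<and> length (queries G t) \<le> (N * m * k + M * k)\<^sup>2"
      if "t \<in> set_pmf (A \<alpha>)" for \<alpha> t G
      by (rule sample_algorithm_queries[OF \<Omega> _ that[unfolded A_def]]) (use S_V S_card in blast)
    fix \<alpha> G assume G: "simple_graph G" "nverts G = n"
    show "2 / 3 \<le> measure_pmf.prob (A \<alpha>) {t. result G t = Close}" if close: "close_to (\<alpha> - \<epsilon>) P G"
    proof -
      from close obtain G' where G': "G' \<in> P" "nverts G' = n" "real (edit_distance G G') < (\<alpha> - \<epsilon>) * (real n)\<^sup>2"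
        using G(2) by (auto simp: close_to_def far_from_def not_le)
      have sG': "simple_graph G'" using P G'(1) by (auto simp: graph_property_def)
      have n2: "(real n)\<^sup>2 > 0" using n by simp
      have dG': "dd G G' < 2 * (\<alpha> - \<epsilon>)"
        using G'(3) n2 unfolding edit[OF G sG' G'(2)] by simp
      have ddG': "dd G G' = avg V (\<lambda>u. avg V (\<lambda>v. of_bool (adj G u v \<noteq> adj G' u v)))"
        by (simp add: dd_def edge_dist_def[abs_def])
      have "\<exists>loss. (\<forall>U. 0 \<le> loss U) \<and> avg X loss
          \<le> 2 * real k * B * (real k * (4 ^ L * (2 * exp (- (real m * \<gamma>\<^sup>2 / (16 * B\<^sup>2)))))) \<and>
        (\<forall>U\<in>X. \<exists>\<tau>\<subseteq>all_keys N m k. p G' - Q * (real q * \<delta>)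
          - 2 * B * (real (k\<^sup>2) * (1 / real N + 1 / real n)) - 2 * real k * \<gamma> - loss U
          \<le> p (KG G U \<tau>) - C * (dd G (KG G U \<tau>) - dd G G')\<^sup>2)"
      proof -
        have Z: "edge_ind (KG G U \<tau>) u v = key_ind (adj G) (vclass (adj G) N m k U (\<lambda>v. v mod N)) \<tau> u v"
          if "u \<in> V" "v \<in> V" for U \<tau> u v
          using that G(2) by (simp add: edge_ind_def KG_def adj_key_graph V_def key_ind_def)
        have 1: "p (KG G U \<tau>) = avg (tuples k V) (dens (key_ind (adj G) (vclass (adj G) N m k U (\<lambda>v. v mod N)) \<tau>))" for U \<tau>
          unfolding p_def using tuples_mem by (intro avg_cong dens_cong Z) force+
        have 2: "dd G (KG G U \<tau>) = avg V (\<lambda>u. avg V (dis (adj G) (key_ind (adj G) (vclass (adj G) N m k U (\<lambda>v. v mod N)) \<tau>) u))" for U \<tau>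
          unfolding dd_def dis_edge_ind[symmetric] by (intro avg_cong) (simp add: dis_def Z)
        have 3: "p G' = avg (tuples k V) (dens (\<lambda>u v. of_bool (adj G' u v)))"
          unfolding p_def by (intro avg_cong dens_cong) (simp add: edge_ind_def)
        show ?thesis unfolding 1 2 3 ddG' B_def X_def
          by (rule structured_approximation)
            (use V N(1) m(1) \<gamma>(1) \<delta> Cpos adj_sym card_residue_class[of N n] n in \<open>auto simp: V_def\<close>)
      qed
      then obtain loss where loss: "\<forall>U. 0 \<le> loss U" "avg X loss \<le> 1 / 360"
        "\<forall>U\<in>X. \<exists>\<tau>\<subseteq>all_keys N m k. p G' - Q * (real q * \<delta>)
          - 2 * B * (real (k\<^sup>2) * (1 / real N + 1 / real n)) - 2 * real k * \<gamma> - loss U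
          \<le> p (KG G U \<tau>) - C * (dd G (KG G U \<tau>) - dd G G')\<^sup>2"
        using m(2) order_trans unfolding B_def by blast
      have acc: "accept \<alpha> G \<omega>" if \<omega>: "\<omega> \<in> \<Omega>" and nb: "\<not> bad G (fst \<omega>) (snd \<omega>)" and ls: "\<not> loss (fst \<omega>) \<ge> 1 / 60" for \<omega>
      proof -
        define U where "U = fst \<omega>"
        have "U \<in> X" using \<omega> by (auto simp: U_def \<Omega>_def)
        then obtain \<tau> where \<tau>: "\<tau> \<subseteq> all_keys N m k"
          "p G' - Q * (real q * \<delta>) - 2 * B * (real (k\<^sup>2) * (1 / real N + 1 / real n)) - 2 * real k * \<gamma> - loss U
          \<le> p (KG G U \<tau>) - C * (dd G (KG G U \<tau>) - dd G G')\<^sup>2" using loss(3) by blast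
        have J: "7 / 12 \<le> p (KG G U \<tau>) - C * (dd G (KG G U \<tau>) - dd G G')\<^sup>2"
          using \<tau>(2) p_mem[OF sG' G'(2,1)] e60 \<delta>(3) N(2) \<gamma>(2) ls unfolding U_def[symmetric] by linarith
        have "0 \<le> C * (dd G (KG G U \<tau>) - dd G G')\<^sup>2" using Cpos by simp
        then have p7: "7 / 12 \<le> p (KG G U \<tau>)" using J by linarith
        \<comment> \<open>The density is at most 61/60, so a penalised value of at least 7/12 leaves
          a penalty of at most 26/60.\<close>
        have "p (KG G U \<tau>) \<le> 1 + e" by (rule p_le[OF KG[OF G]])
        then have "C * (dd G (KG G U \<tau>) - dd G G')\<^sup>2 \<le> 1 / 2" using J e60 by linarith
        then have "(dd G (KG G U \<tau>) - dd G G')\<^sup>2 \<le> (\<epsilon> / 4)\<^sup>2"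
          using \<epsilon> by (simp add: C_def field_simps power2_eq_square)
        then have "\<bar>dd G (KG G U \<tau>) - dd G G'\<bar> \<le> \<bar>\<epsilon> / 4\<bar>" by (simp only: abs_le_square_iff)
        then have dK: "dd G (KG G U \<tau>) \<le> 2 * (\<alpha> - \<epsilon>) + \<epsilon> / 4" using dG' \<epsilon> by linarith
        have "\<bar>ep (KG G U \<tau>) (snd \<omega>) - p (KG G U \<tau>)\<bar> \<le> 1 / 12"
          and ed: "\<bar>ed G (KG G U \<tau>) (snd \<omega>) - dd G (KG G U \<tau>)\<bar> \<le> \<epsilon> / 4"
          using nb \<tau>(1) unfolding bad_def U_def[symmetric] by (meson not_le)+
        then have "1 / 2 \<le> ep (KG G U \<tau>) (snd \<omega>)" using p7 by linarith
        moreover have "ed G (KG G U \<tau>) (snd \<omega>) \<le> 2 * \<alpha> - 3 * \<epsilon> / 2"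
          using ed[unfolded abs_le_iff] dK by argo
        ultimately show ?thesis unfolding accept_def U_def[symmetric] using \<tau>(1) by blast
      qed
      have "avg \<Omega> (\<lambda>\<omega>. of_bool (\<not> accept \<alpha> G \<omega>))
        \<le> avg \<Omega> (\<lambda>\<omega>. of_bool (loss (fst \<omega>) \<ge> 1 / 60) + of_bool (bad G (fst \<omega>) (snd \<omega>)))"
      proof (rule avg_mono)
        fix \<omega> assume "\<omega> \<in> \<Omega>"
        then show "(of_bool (\<not> accept \<alpha> G \<omega>) :: real) \<le> of_bool (loss (fst \<omega>) \<ge> 1 / 60) + of_bool (bad G (fst \<omega>) (snd \<omega>))"
          using acc[of \<omega>] by (auto simp: of_bool_def)
      qed
      then have "avg \<Omega> (\<lambda>\<omega>. of_bool (\<not> accept \<alpha> G \<omega>))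
        \<le> avg \<Omega> (\<lambda>\<omega>. of_bool (loss (fst \<omega>) \<ge> 1 / 60)) + avg \<Omega> (\<lambda>\<omega>. of_bool (bad G (fst \<omega>) (snd \<omega>)))"
        unfolding avg_add .
      moreover have "avg \<Omega> (\<lambda>\<omega>. of_bool (loss (fst \<omega>) \<ge> 1 / 60)) = avg X (\<lambda>U. of_bool (loss U \<ge> 1 / 60))"
        unfolding \<Omega>_def avg_Times[where f="\<lambda>U \<psi>. of_bool (loss U \<ge> 1 / 60)"] avg_const[OF Y] ..
      moreover have "avg X (\<lambda>U. of_bool (loss U \<ge> 1 / 60)) \<le> 60 * avg X loss"
        using Markov_avg[of X loss "1 / 60"] loss(1) by simp
      ultimately have "avg \<Omega> (\<lambda>\<omega>. of_bool (\<not> accept \<alpha> G \<omega>)) \<le> 1 / 3"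
        using loss(2) avg_bad_\<Omega>[of G] by linarith
      then have "2 / 3 \<le> avg \<Omega> (\<lambda>\<omega>. of_bool (accept \<alpha> G \<omega>))" by (rule prob_ge_two_thirds[OF \<Omega>])
      also have "\<dots> = measure_pmf.prob (A \<alpha>) {t. result G t = Close}"
        unfolding probA[OF G] by (intro avg_cong) simp
      finally show ?thesis .
    qed
    show "2 / 3 \<le> measure_pmf.prob (A \<alpha>) {t. result G t = Far}" if far: "far_from \<alpha> P G"
    proof -
      have rej: "\<not> accept \<alpha> G \<omega>" if nb: "\<not> bad G (fst \<omega>) (snd \<omega>)" for \<omega>
      proof
        assume "accept \<alpha> G \<omega>"
        then obtain \<tau> where \<tau>: "\<tau> \<subseteq> all_keys N m k" "1 / 2 \<le> ep (KG G (fst \<omega>) \<tau>) (snd \<omega>)"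
          "ed G (KG G (fst \<omega>) \<tau>) (snd \<omega>) \<le> 2 * \<alpha> - 3 * \<epsilon> / 2" unfolding accept_def by blast
        define K where "K = KG G (fst \<omega>) \<tau>"
        have K: "simple_graph K" "nverts K = n" using KG[OF G] by (simp_all add: K_def)
        have "\<bar>ep K (snd \<omega>) - p K\<bar> \<le> 1 / 12" "\<bar>ed G K (snd \<omega>) - dd G K\<bar> \<le> \<epsilon> / 4"
          using nb \<tau>(1) unfolding bad_def K_def by (meson not_le)+
        \<comment> \<open>The density is at least 5/12, above the value 1/3 + 1/60 possible for far
          graphs, so \<open>K\<close> is \<open>\<epsilon> / 2\<close>-close to the property.
          Through \<open>K\<close> the graph \<open>G\<close> has distance below
          \<open>\<alpha> - 5 * \<epsilon> / 8 + \<epsilon> / 2\<close>, and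
          \<open>\<epsilon> / 8\<close> is left over.\<close>
        then have pK: "p K > 1 / 3 + e" and dK: "dd G K \<le> 2 * \<alpha> - 5 * \<epsilon> / 4"
          using \<tau>(2,3) e60 unfolding K_def[symmetric] by linarith+
        have "\<not> far_from (\<epsilon> / 2) P K" using p_far[OF K] pK by linarith
        then obtain H where H: "H \<in> P" "nverts H = n" "real (edit_distance K H) < \<epsilon> / 2 * (real n)\<^sup>2"
          using K(2) by (auto simp: far_from_def not_le)
        have sH: "simple_graph H" using P H(1) by (auto simp: graph_property_def)
        have n2: "(real n)\<^sup>2 > 0" using n by simp
        have "real (edit_distance G H) \<le> real (edit_distance G K) + real (edit_distance K H)"
          using edit_distance_triangle[OF G(1) sH K(1)] by linarith
        also have "\<dots> < (\<alpha> - 5 * \<epsilon> / 8) * (real n)\<^sup>2 + \<epsilon> / 2 * (real n)\<^sup>2"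
        proof (rule add_le_less_mono)
          show "real (edit_distance G K) \<le> (\<alpha> - 5 * \<epsilon> / 8) * (real n)\<^sup>2"
            unfolding edit[OF G K] using dK by (intro mult_right_mono) auto
        qed (rule H(3))
        also have "\<dots> = (\<alpha> - \<epsilon> / 8) * (real n)\<^sup>2" by (simp add: algebra_simps)
        also have "\<dots> \<le> \<alpha> * (real n)\<^sup>2" using \<epsilon> by (intro mult_right_mono) auto
        finally show False using far H(1,2) G(2) by (auto simp: far_from_def not_le)
      qed
      have "avg \<Omega> (\<lambda>\<omega>. of_bool (\<not> \<not> accept \<alpha> G \<omega>)) \<le> avg \<Omega> (\<lambda>\<omega>. of_bool (bad G (fst \<omega>) (snd \<omega>)))"
        using rej by (intro avg_mono) (auto simp: of_bool_def)
      then have "avg \<Omega> (\<lambda>\<omega>. of_bool (\<not> \<not> accept \<alpha> G \<omega>)) \<le> 1 / 3"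
        using avg_bad_\<Omega>[of G] by linarith
      then have "2 / 3 \<le> avg \<Omega> (\<lambda>\<omega>. of_bool (\<not> accept \<alpha> G \<omega>))" by (rule prob_ge_two_thirds[OF \<Omega>])
      also have "\<dots> = measure_pmf.prob (A \<alpha>) {t. result G t = Far}"
        unfolding probA[OF G] by (intro avg_cong) simp
      finally show ?thesis .
    qed
  qed
qed

section \<open>Parameters\<close>

text \<open>The choices of sample size and accuracy together with \<open>B \<le> R ^ 3\<close> make
  the Hoeffding exponent at least \<open>R ^ 8\<close>. The number of colours is
  \<open>4 ^ (R ^ 7) \<le> exp (2 * R ^ 7)\<close>, with an exponent one power of \<open>R\<close>
  lower, so the tail wins.\<close>

lemma failure_bound:
  fixes R k :: nat and B :: real
  assumes R: "R \<ge> 60" and k: "k \<le> R" and B: "0 < B" "B \<le> real R ^ 3"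
  shows "2 * real k * B * (real k * (4 ^ (R ^ 7) * (2 * exp (- (real (16 * R ^ 20) * (1 / real R ^ 3)\<^sup>2 / (16 * B\<^sup>2)))))) \<le> 1 / 360"
proof -
  have R0: "real R > 0" "real R \<ge> 60" using R by auto
  have "B\<^sup>2 \<le> (real R ^ 3)\<^sup>2" using B by (intro power_mono) auto
  then have B2: "B\<^sup>2 \<le> real R ^ 6" by (simp add: power_mult[symmetric])
  have "real R ^ 8 * (16 * B\<^sup>2) \<le> real R ^ 8 * (16 * real R ^ 6)" using B2 by (intro mult_left_mono) auto
  also have "\<dots> = real (16 * R ^ 20) * (1 / real R ^ 3)\<^sup>2"
    using R0 by (simp add: power_divide field_simps power_add[symmetric] power_mult[symmetric])
  finally have t: "real R ^ 8 \<le> real (16 * R ^ 20) * (1 / real R ^ 3)\<^sup>2 / (16 * B\<^sup>2)"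
    using B by (simp add: le_divide_eq)
  have e2: "(4::real) \<le> exp 2"
  proof -
    have "(2::real) * 2 \<le> exp 1 * exp 1" using exp_ge_add_one_self[of 1] by (intro mult_mono) auto
    then show ?thesis by (simp add: exp_add[symmetric])
  qed
  have "1440 * real R ^ 5 * 4 ^ (R ^ 7) \<le> exp (real R ^ 8 - 2 * real R ^ 7) * exp (2 * real R ^ 7)"
  proof (intro mult_mono)
    have "1440 * real R ^ 5 \<le> 58 * (60 * 60) * real R ^ 5" by simp
    also have "\<dots> \<le> 58 * (real R * real R) * real R ^ 5"
      using R0 by (intro mult_right_mono mult_left_mono mult_mono) auto
    also have "\<dots> = (60 - 2) * real R ^ 7" by (simp add: power_numeral_reduce)
    also have "\<dots> \<le> (real R - 2) * real R ^ 7" using R0 by (intro mult_right_mono) auto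
    also have "\<dots> = real R ^ 8 - 2 * real R ^ 7" by (simp add: algebra_simps power_numeral_reduce)
    also have "\<dots> \<le> exp (real R ^ 8 - 2 * real R ^ 7)"
      using exp_ge_add_one_self[of "real R ^ 8 - 2 * real R ^ 7"] by linarith
    finally show "1440 * real R ^ 5 \<le> exp (real R ^ 8 - 2 * real R ^ 7)" .
    have "(4::real) ^ (R ^ 7) \<le> exp 2 ^ (R ^ 7)" using e2 by (intro power_mono) auto
    then show "(4::real) ^ (R ^ 7) \<le> exp (2 * real R ^ 7)"
      by (simp add: exp_of_nat_mult[symmetric] mult.commute)
  qed auto
  then have E: "1440 * real R ^ 5 * 4 ^ (R ^ 7) \<le> exp (real R ^ 8)" by (simp add: exp_add[symmetric])
  have "2 * real k * B * (real k * (4 ^ (R ^ 7) * (2 * exp (- (real (16 * R ^ 20) * (1 / real R ^ 3)\<^sup>2 / (16 * B\<^sup>2))))))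
    \<le> 2 * real R * real R ^ 3 * (real R * (4 ^ (R ^ 7) * (2 * exp (- (real R ^ 8)))))"
    using k B t by (intro mult_mono) auto
  also have "\<dots> = 1440 * real R ^ 5 * 4 ^ (R ^ 7) * exp (- (real R ^ 8)) / 360"
    by (simp add: power_numeral_reduce)
  also have "\<dots> \<le> exp (real R ^ 8) * exp (- (real R ^ 8)) / 360"
    using E by (intro divide_right_mono mult_right_mono) auto
  also have "\<dots> = 1 / 360" by (simp add: exp_add[symmetric])
  finally show ?thesis .
qed

text \<open>The factor \<open>2304 = 12^2 * 16\<close> cancels the constants of the first exponent,
  and \<open>R^2\<close> dominates both \<open>Q^2\<close> and \<open>1 / \<epsilon>^2\<close>, so
  both exponents are at least \<open>W + 24\<close>. The summand 24 serves to bring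
  \<open>4 * 2 ^ W * exp (- W)\<close> below 1/6.\<close>

lemma union_bound:
  fixes R W :: nat and Q \<epsilon> :: real
  assumes R: "R \<ge> 60" and Q: "1 \<le> Q" "Q \<le> real R" and \<epsilon>: "0 < \<epsilon>" "1 / \<epsilon> \<le> real R"
  defines "M \<equiv> 2304 * R\<^sup>2 * (W + 24)"
  shows "2 ^ W * (2 * exp (- (real M * (1 / 12)\<^sup>2 / (16 * Q\<^sup>2))) + 2 * exp (- (real M * (\<epsilon> / 4)\<^sup>2 / (16 * 1\<^sup>2)))) \<le> 1 / 6"
proof -
  define t where "t = real (W + 24)"
  have R0: "real R > 0" using R by simp
  have Q2: "Q\<^sup>2 \<le> (real R)\<^sup>2" using Q by (intro power_mono) auto
  have M: "real M = 2304 * (real R)\<^sup>2 * t" by (simp add: M_def t_def)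
  have t0: "t \<ge> 0" by (simp add: t_def)
  have "t * (16 * Q\<^sup>2) \<le> t * (16 * (real R)\<^sup>2)" using Q2 t0 by (intro mult_left_mono) auto
  also have "\<dots> = real M * (1 / 12)\<^sup>2" by (simp add: M power2_eq_square)
  finally have 1: "t \<le> real M * (1 / 12)\<^sup>2 / (16 * Q\<^sup>2)" using Q by (simp add: le_divide_eq)
  have "1 \<le> real R * \<epsilon>" using \<epsilon> by (simp add: field_simps)
  then have "1 * 1 \<le> (real R * \<epsilon>) * (real R * \<epsilon>)" by (intro mult_mono) auto
  then have "9 * t * 1 \<le> 9 * t * ((real R * \<epsilon>) * (real R * \<epsilon>))" using t0 by (intro mult_left_mono) auto
  also have "\<dots> = real M * (\<epsilon> / 4)\<^sup>2 / (16 * 1\<^sup>2)" by (simp add: M power2_eq_square)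
  finally have 2: "t \<le> real M * (\<epsilon> / 4)\<^sup>2 / (16 * 1\<^sup>2)" using t0 by linarith
  have e1: "(2::real) \<le> exp 1" using exp_ge_add_one_self[of 1] by simp
  have "(2::real) ^ W * 24 \<le> exp 1 ^ W * exp 24"
    using e1 exp_ge_add_one_self[of "24::real"] by (intro mult_mono power_mono) auto
  also have "\<dots> = exp t" by (simp add: t_def exp_add exp_of_nat_mult[symmetric] mult.commute)
  finally have 3: "2 ^ W * 24 \<le> exp t" .
  have "2 ^ W * (2 * exp (- (real M * (1 / 12)\<^sup>2 / (16 * Q\<^sup>2))) + 2 * exp (- (real M * (\<epsilon> / 4)\<^sup>2 / (16 * 1\<^sup>2))))
    \<le> 2 ^ W * (2 * exp (- t) + 2 * exp (- t))"
    using 1 2 by (intro mult_left_mono add_mono) auto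
  also have "\<dots> = 2 ^ W * 24 * exp (- t) / 6" by simp
  also have "\<dots> \<le> exp t * exp (- t) / 6" using 3 by (intro divide_right_mono mult_right_mono) auto
  also have "\<dots> = 1 / 6" by (simp add: exp_add[symmetric])
  finally show ?thesis .
qed

text \<open>Everything is bounded by powers of two through \<open>R \<le> 2 ^ R\<close>. The
  dominating factor is \<open>W\<close>, with exponent about \<open>32 * R ^ 21\<close> since
  \<open>m * k \<le> 16 * R ^ 21\<close>. Squaring doubles the exponent, and
  \<open>60 * 60 \<le> R^2\<close> absorbs the constants.\<close>

lemma query_bound:
  fixes R k :: nat
  assumes R: "R \<ge> 60" and k: "k \<le> R"
  defines "W \<equiv> 2 * (R ^ 8 * 2 ^ ((16 * R ^ 20) * k))\<^sup>2"
  shows "(R ^ 8 * (16 * R ^ 20) * k + (2304 * R\<^sup>2 * (W + 24)) * k)\<^sup>2 \<le> 2 ^ (R ^ 24)"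
proof -
  have R2: "R \<le> 2 ^ R" using less_exp[of R] by simp
  have Rp: "R ^ j \<le> 2 ^ (R * j)" for j using power_mono[OF R2, of j] by (simp add: power_mult)
  have "W \<le> 2 * (2 ^ (R * 8) * 2 ^ (16 * R ^ 20 * R))\<^sup>2"
    unfolding W_def using Rp[of 8] k by (intro mult_le_mono power_mono power_increasing) auto
  also have "\<dots> = 2 ^ (1 + 16 * R + 32 * R ^ 21)"
  proof -
    have "2 * (2 ^ a * 2 ^ b)\<^sup>2 = (2::nat) ^ (1 + 2 * a + 2 * b)" for a b
      by (simp add: power_mult_distrib power_add power_mult[symmetric] mult.commute)
    moreover have "1 + 2 * (R * 8) + 2 * (16 * R ^ 20 * R) = 1 + 16 * R + 32 * R ^ 21"
      using power_add[of R 20 1] by simp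
    ultimately show ?thesis by metis
  qed
  finally have W: "W \<le> 2 ^ (1 + 16 * R + 32 * R ^ 21)" .
  have W1: "1 \<le> W" using R by (simp add: W_def Suc_le_eq)
  have "(2304 * R\<^sup>2 * (W + 24)) * k \<le> (2 ^ 12 * R\<^sup>2 * (2 ^ 5 * W)) * R"
    using W1 k by (intro mult_le_mono) auto
  also have "\<dots> = 2 ^ 17 * R ^ 3 * W" by (simp add: power_numeral_reduce)
  also have "\<dots> \<le> 2 ^ 17 * 2 ^ (R * 3) * 2 ^ (1 + 16 * R + 32 * R ^ 21)"
    using Rp[of 3] W by (intro mult_le_mono) auto
  also have "\<dots> = 2 ^ (17 + R * 3 + (1 + 16 * R + 32 * R ^ 21))" by (simp only: power_add)
  also have "17 + R * 3 + (1 + 16 * R + 32 * R ^ 21) = 18 + 19 * R + 32 * R ^ 21" by simp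
  finally have 1: "(2304 * R\<^sup>2 * (W + 24)) * k \<le> 2 ^ (18 + 19 * R + 32 * R ^ 21)" .
  have "R ^ 8 * (16 * R ^ 20) * k \<le> R ^ 8 * (16 * R ^ 20) * R" using k by simp
  also have "\<dots> = 2 ^ 4 * R ^ 29" by (simp add: power_numeral_reduce)
  also have "\<dots> \<le> 2 ^ 4 * 2 ^ (R * 29)" using Rp[of 29] by (intro mult_le_mono) auto
  also have "\<dots> = 2 ^ (4 + 29 * R)" by (simp add: power_add mult.commute)
  finally have 2: "R ^ 8 * (16 * R ^ 20) * k \<le> 2 ^ (4 + 29 * R)" .
  have RR: "R * j \<le> R ^ 21 * j" "j \<le> R ^ 21 * j" for j
    using R power_increasing[of 1 21 R] by simp_all
  have "2 * (19 + 29 * R + 32 * R ^ 21) \<le> R ^ 21 * 60 * 60"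
  proof -
    have "2 * (19 + 29 * R + 32 * X) \<le> X * 60 * 60" if "R \<le> X" "1 \<le> X" for X
    proof -
      have "38 + 58 * R + 64 * X \<le> 3600 * X" using that by linarith
      then show ?thesis by simp
    qed
    from this[of "R ^ 21"] show ?thesis using RR(1)[of 1] RR(2)[of 1] by simp
  qed
  also have "\<dots> \<le> R ^ 21 * R * R" using R by (intro mult_le_mono) auto
  also have "\<dots> = R ^ 23" by (simp add: power_numeral_reduce)
  also have "\<dots> \<le> R ^ 24" using R by (intro power_increasing) auto
  finally have ex: "2 * (19 + 29 * R + 32 * R ^ 21) \<le> R ^ 24" .
  have "R ^ 8 * (16 * R ^ 20) * k + (2304 * R\<^sup>2 * (W + 24)) * k
     \<le> 2 ^ (18 + 29 * R + 32 * R ^ 21) + 2 ^ (18 + 29 * R + 32 * R ^ 21)"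
  proof (rule add_mono)
    show "R ^ 8 * (16 * R ^ 20) * k \<le> 2 ^ (18 + 29 * R + 32 * R ^ 21)"
      by (rule order_trans[OF 2 power_increasing]) auto
    show "2304 * R\<^sup>2 * (W + 24) * k \<le> 2 ^ (18 + 29 * R + 32 * R ^ 21)"
      by (rule order_trans[OF 1 power_increasing]) auto
  qed
  also have "\<dots> = 2 ^ Suc (18 + 29 * R + 32 * R ^ 21)" by (simp only: power_Suc mult_2)
  also have "Suc (18 + 29 * R + 32 * R ^ 21) = 19 + 29 * R + 32 * R ^ 21" by simp
  finally have "(R ^ 8 * (16 * R ^ 20) * k + (2304 * R\<^sup>2 * (W + 24)) * k)\<^sup>2 \<le> (2 ^ (19 + 29 * R + 32 * R ^ 21))\<^sup>2"
    by (rule power_mono) simp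
  also have "\<dots> = 2 ^ (2 * (19 + 29 * R + 32 * R ^ 21))" by (simp only: power_mult[symmetric] mult.commute)
  also have "\<dots> \<le> 2 ^ (R ^ 24)" using ex by (intro power_increasing) auto
  finally show ?thesis .
qed

text \<open>One integer above 60, the total pattern weight \<open>2 ^ (q + 1)\<close>, the number
  \<open>2 * q + 4\<close> of positions and \<open>1 / \<epsilon>\<close>, so that every parameter
  can be a power of it times a constant.\<close>

definition scale :: "nat \<Rightarrow> real \<Rightarrow> nat" where
  "scale q \<epsilon> = 60 * 2 ^ q * nat \<lceil>1 / \<epsilon>\<rceil>"

lemma scale_bounds:
  assumes "0 < \<epsilon>" "\<epsilon> < 1 / 2"
  shows "60 \<le> scale q \<epsilon>" "2 ^ (q + 1) \<le> scale q \<epsilon>" "2 * q + 4 \<le> scale q \<epsilon>" "1 / \<epsilon> \<le> real (scale q \<epsilon>)"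
    "real (scale q \<epsilon>) \<le> (1 / \<epsilon>) ^ 8 * 2 ^ q"
proof -
  have x: "2 < 1 / \<epsilon>" using assms by (simp add: field_simps)
  define y where "y = nat \<lceil>1 / \<epsilon>\<rceil>"
  have y: "1 / \<epsilon> \<le> real y" "real y \<le> 1 / \<epsilon> + 1" using x unfolding y_def by linarith+
  have y1: "1 \<le> y" using x y(1) by linarith
  have q: "q < 2 ^ q" by (rule less_exp)
  have "60 * 1 * 1 \<le> 60 * 2 ^ q * y" using y1 by (intro mult_le_mono) auto
  then show "60 \<le> scale q \<epsilon>" by (simp add: scale_def y_def)
  have *: "60 * 2 ^ q * 1 \<le> scale q \<epsilon>" using y1 unfolding scale_def y_def[symmetric] by (intro mult_le_mono) auto
  then show "2 ^ (q + 1) \<le> scale q \<epsilon>" by simp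
  show "2 * q + 4 \<le> scale q \<epsilon>" using * q by linarith
  have "1 * real y \<le> (60 * 2 ^ q) * real y"
  proof (rule mult_right_mono)
    have "(1::real) \<le> 2 ^ q" by simp
    then show "(1::real) \<le> 60 * 2 ^ q" by linarith
  qed simp
  then show "1 / \<epsilon> \<le> real (scale q \<epsilon>)" using y(1) unfolding scale_def y_def[symmetric] by simp
  have "real (scale q \<epsilon>) = 60 * 2 ^ q * real y" by (simp add: scale_def y_def)
  \<comment> \<open>Here \<open>60 \<le> 2 ^ 6\<close> and the rounded-up
    \<open>1 / \<epsilon>\<close> is at most twice \<open>1 / \<epsilon>\<close>; the resulting
    \<open>2 ^ 7\<close> is then absorbed by \<open>(1 / \<epsilon>) ^ 7\<close>, as
    \<open>1 / \<epsilon> > 2\<close>.\<close>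
  also have "\<dots> \<le> 2 ^ 6 * 2 ^ q * (2 * (1 / \<epsilon>))" using y x by (intro mult_mono) auto
  also have "\<dots> = 2 ^ 7 * (1 / \<epsilon>) * 2 ^ q" by simp
  also have "\<dots> \<le> (1 / \<epsilon>) ^ 7 * (1 / \<epsilon>) * 2 ^ q" using x assms by (intro mult_right_mono power_mono) auto
  also have "\<dots> = (1 / \<epsilon>) ^ 8 * 2 ^ q" by (simp add: power_numeral_reduce)
  finally show "real (scale q \<epsilon>) \<le> (1 / \<epsilon>) ^ 8 * 2 ^ q" .
qed

text \<open>The 24th power of the scale is at most
  \<open>(1 / \<epsilon>) ^ 192 * 2 ^ (24 * q)\<close>. For \<open>q \<ge> 2\<close> the power
  \<open>q ^ 216\<close> exceeds \<open>24 * q\<close>. For \<open>q = 1\<close> powers of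
  \<open>q\<close> do not grow, so \<open>2 ^ 24\<close> has to be absorbed by
  \<open>(1 / \<epsilon>) ^ 24\<close>; this gives the exponent 216 = 192 + 24.\<close>

lemma scale_final_bound:
  assumes \<epsilon>: "0 < \<epsilon>" "\<epsilon> < 1 / 2"
  shows "2 ^ (scale q \<epsilon> ^ 24) \<le> 2 powr ((1 / \<epsilon>) powr 216 * 2 powr (real q powr 216))"
proof -
  define x where "x = 1 / \<epsilon>"
  have x: "x > 2" using \<epsilon> by (simp add: x_def field_simps)
  have "real (scale q \<epsilon> ^ 24) \<le> (x ^ 8 * 2 ^ q) ^ 24"
    using scale_bounds(5)[OF \<epsilon>, of q] unfolding x_def of_nat_power by (intro power_mono) auto
  also have "\<dots> = x ^ 192 * 2 ^ (q * 24)" by (simp add: power_mult_distrib power_mult[symmetric])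
  also have "\<dots> \<le> x powr 216 * 2 powr (real q powr 216)"
  proof -
    have p: "x powr 216 = x ^ 216" "real q powr 216 = real q ^ 216" if "q > 0"
      using x that by (simp_all add: powr_numeral)
    consider "q = 0" | "q = 1" | "q \<ge> 2" by linarith
    then show ?thesis
    proof cases
      case 1
      have "x ^ 192 \<le> x ^ 216" using x by (intro power_increasing) auto
      then show ?thesis using 1 x by (simp add: powr_numeral)
    next
      case 2
      have "x ^ 192 * 2 ^ (q * 24) \<le> x ^ 192 * x ^ 24" using 2 x power_mono[of 2 x 24] by (intro mult_left_mono) auto
      also have "\<dots> = x ^ 216 * 1" by (simp add: power_add[symmetric])
      also have "\<dots> \<le> x ^ 216 * 2 powr (real q powr 216)" using 2 x by (intro mult_left_mono) auto
      finally show ?thesis using p 2 by simp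
    next
      case 3
      have "q * 24 \<le> q * 2 ^ 215" by simp
      also have "\<dots> \<le> q * q ^ 215" using 3 by (intro mult_le_mono power_mono) auto
      also have "\<dots> = q ^ 216" by (simp add: power_Suc[symmetric] del: power_Suc)
      finally have "(2::real) ^ (q * 24) \<le> 2 ^ (q ^ 216)" by (intro power_increasing) auto
      also have "\<dots> = 2 powr (real (q ^ 216))" by (simp only: powr_realpow)
      also have "real (q ^ 216) = real q powr 216" using p 3 by simp
      finally have "(2::real) ^ (q * 24) \<le> 2 powr (real q powr 216)" .
      moreover have "x ^ 192 \<le> x ^ 216" using x by (intro power_increasing) auto
      ultimately show ?thesis using p 3 x by (intro mult_mono) auto
    qed
  qed
  finally have "2 powr real (scale q \<epsilon> ^ 24) \<le> 2 powr (x powr 216 * 2 powr (real q powr 216))" by simp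
  then show ?thesis unfolding x_def by (simp only: powr_realpow)
qed

text \<open>The guarantee for one fixed number of vertices. An algorithm is a separate tree
  distribution for each \<open>n\<close>, so these can be chosen independently and
  assembled.\<close>

definition estimates :: "real \<Rightarrow> real \<Rightarrow> sgraph set \<Rightarrow> nat \<Rightarrow> nat \<Rightarrow> verdict qtree pmf \<Rightarrow> bool" where
  "estimates \<alpha> \<epsilon> P n b A \<longleftrightarrow>
    (\<forall>t\<in>set_pmf A. \<forall>G. simple_graph G \<longrightarrow> nverts G = n \<longrightarrow>
      (\<forall>(u, v)\<in>set (queries G t). u < n \<and> v < n \<and> u \<noteq> v) \<and> length (queries G t) \<le> b) \<and>
    (\<forall>G. simple_graph G \<longrightarrow> nverts G = n \<longrightarrow>
      (close_to (\<alpha> - \<epsilon>) P G \<longrightarrow> 2 / 3 \<le> measure_pmf.prob A {t. result G t = Close}) \<and>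
      (far_from \<alpha> P G \<longrightarrow> 2 / 3 \<le> measure_pmf.prob A {t. result G t = Far}))"

lemma algorithm_of_estimates:
  assumes "\<And>n. n \<ge> 1 \<Longrightarrow> estimates \<alpha> \<epsilon> P n b (A n)" "real b \<le> c"
  shows "makes_at_most_queries A c \<and> distinguishes \<alpha> \<epsilon> P A"
proof
  have e: "estimates \<alpha> \<epsilon> P (nverts G) b (A (nverts G))" if "simple_graph G" for G
    using assms(1) that by (auto simp: simple_graph_def)
  show "makes_at_most_queries A c"
    unfolding makes_at_most_queries_def
  proof (intro allI impI ballI)
    fix G t assume G: "simple_graph G" and t: "t \<in> set_pmf (A (nverts G))"
    have "(\<forall>(u, v)\<in>set (queries G t). u < nverts G \<and> v < nverts G \<and> u \<noteq> v) \<and> length (queries G t) \<le> b"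
      using e[OF G] G t unfolding estimates_def by blast
    then show "(\<forall>(u, v)\<in>set (queries G t). u < nverts G \<and> v < nverts G \<and> u \<noteq> v) \<and> real (length (queries G t)) \<le> c"
      using assms(2) by linarith
  qed
  show "distinguishes \<alpha> \<epsilon> P A"
    unfolding distinguishes_def prob_output_def
  proof (intro allI impI)
    fix G assume G: "simple_graph G"
    show "(close_to (\<alpha> - \<epsilon>) P G \<longrightarrow> 2 / 3 \<le> measure_pmf.prob (A (nverts G)) {t. result G t = Close}) \<and>
      (far_from \<alpha> P G \<longrightarrow> 2 / 3 \<le> measure_pmf.prob (A (nverts G)) {t. result G t = Far})"
      using e[OF G] G unfolding estimates_def by blast
  qed
qed

lemma far_from_mono: "far_from \<beta> P G \<Longrightarrow> \<beta>' \<le> \<beta> \<Longrightarrow> far_from \<beta>' P G"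
  unfolding far_from_def by (meson mult_right_mono order_trans zero_le_power2)

text \<open>An edit distance between graphs on n vertices is less than n^2/2, so for \<epsilon> \<ge> 1/2 only the
  existence of a graph on n vertices in the property matters.\<close>

lemma estimates_large_epsilon:
  assumes P: "graph_property P" and \<epsilon>: "\<epsilon> \<ge> 1 / 2"
  shows "estimates \<alpha> \<epsilon> P n 0 (return_pmf (Output (if \<alpha> > \<epsilon> \<and> (\<exists>H\<in>P. nverts H = n) then Close else Far)))"
    (is "estimates _ _ _ _ _ ?A")
  unfolding estimates_def
proof (intro conjI ballI allI impI)
  fix G assume G: "simple_graph G" "nverts G = n"
  have n: "n \<ge> 1" using G by (auto simp: simple_graph_def)
  {
    assume "close_to (\<alpha> - \<epsilon>) P G"
    then obtain H where H: "H \<in> P" "nverts H = n" "real (edit_distance G H) < (\<alpha> - \<epsilon>) * (real n)\<^sup>2"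
      using G by (auto simp: close_to_def far_from_def not_le)
    then have "0 < (\<alpha> - \<epsilon>) * (real n)\<^sup>2" by (meson of_nat_0_le_iff order_le_less_trans)
    then have "\<alpha> > \<epsilon>" by (simp add: zero_less_mult_iff)
    then show "2 / 3 \<le> measure_pmf.prob ?A {t. result G t = Close}"
      using H by auto
  }
  assume far: "far_from \<alpha> P G"
  have "\<not> (\<alpha> > \<epsilon> \<and> (\<exists>H\<in>P. nverts H = n))"
  proof
    assume a: "\<alpha> > \<epsilon> \<and> (\<exists>H\<in>P. nverts H = n)"
    then obtain H where H: "H \<in> P" "nverts H = n" by blast
    have sH: "simple_graph H" using P H by (auto simp: graph_property_def)
    have "edit_distance G H \<le> card {e. e \<subseteq> {..<n} \<and> card e = 2}"
      unfolding edit_distance_def using G sH H(2) by (intro card_mono) (auto simp: simple_graph_def)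
    also have "\<dots> = n choose 2" using n_subsets[of "{..<n}" 2] by simp
    finally have "2 * edit_distance G H \<le> n * (n - 1)" by (simp add: choose_two)
    also have "\<dots> < n * n" using n by simp
    finally have "2 * real (edit_distance G H) < real n * real n" by (metis of_nat_less_iff of_nat_mult of_nat_numeral)
    moreover have "1 / 2 * (real n)\<^sup>2 \<le> \<alpha> * (real n)\<^sup>2" using a \<epsilon> by (intro mult_right_mono) auto
    ultimately show False using far H G(2) by (auto simp: far_from_def power2_eq_square)
  qed
  then show "2 / 3 \<le> measure_pmf.prob ?A {t. result G t = Far}"
    by auto
qed auto

text \<open>With few vertices the errors of order \<open>1 / n\<close> are too large for sampling,
  but the whole graph can be read. The verdict is then exact, since a graph that is
  \<open>\<alpha>\<close>-far is also \<open>(\<alpha> - \<epsilon>)\<close>-far and hence not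
  close.\<close>

lemma estimates_query_all:
  assumes "\<epsilon> > 0"
  shows "estimates \<alpha> \<epsilon> P n (n\<^sup>2) (return_pmf (query_list (pair_list {..<n})
    (\<lambda>E. if close_to (\<alpha> - \<epsilon>) P \<lparr>nverts = n, edges = E\<rparr> then Close else Far)))"
    (is "estimates _ _ _ _ _ (return_pmf ?t)")
proof -
  have res: "result G ?t = (if close_to (\<alpha> - \<epsilon>) P G then Close else Far)" if G: "simple_graph G" "nverts G = n" for G
  proof -
    have "{e \<in> edges G. e \<subseteq> {..<n}} = edges G" using G by (auto simp: simple_graph_def)
    then have "result G ?t = (if close_to (\<alpha> - \<epsilon>) P \<lparr>nverts = n, edges = edges G\<rparr> then Close else Far)"
      by (simp add: result_query_list revealed_edges[OF G(1)])
    moreover have "\<lparr>nverts = n, edges = edges G\<rparr> = G" using G(2) by simp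
    ultimately show ?thesis by simp
  qed
  have notclose: "\<not> close_to (\<alpha> - \<epsilon>) P G" if "far_from \<alpha> P G" for G
    using far_from_mono[OF that] assms by (simp add: close_to_def)
  have "length (pair_list {..<n}) \<le> n\<^sup>2" using length_pair_list[of "{..<n}"] by simp
  then show ?thesis
    unfolding estimates_def using res notclose by (auto simp: set_pair_list)
qed

text \<open>From \<open>Q \<le> R\<close> and \<open>C \<le> 8 * R^2\<close> follows
  \<open>B \<le> R^3\<close>. The values \<open>\<gamma> = \<delta> = 1 / R^3\<close> keep the
  errors linear in them below 1/60, and \<open>L = R^7\<close> gives
  \<open>L * \<delta>^2 = R > 1\<close>. Block collisions cost about
  \<open>B * k^2 / N \<le> R^5 / N\<close>, so \<open>N = R^8\<close> and \<open>n \<ge> R^8\<close>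
  suffice; smaller graphs are read completely.\<close>

lemma estimates_small_epsilon:
  assumes P: "graph_property P" and T: "tester (\<epsilon> / 2) P T" "makes_at_most_queries T (real q)"
    and \<epsilon>: "0 < \<epsilon>" "\<epsilon> < 1 / 2" and n: "n \<ge> 1"
  shows "\<exists>A. \<forall>\<alpha>. estimates \<alpha> \<epsilon> P n (2 ^ (scale q \<epsilon> ^ 24)) (A \<alpha>)"
proof -
  define R where "R = scale q \<epsilon>"
  have R: "R \<ge> 60" and QR: "2 ^ (q + 1) \<le> R" and kR: "2 * q + 4 \<le> R" and \<epsilon>R: "1 / \<epsilon> \<le> real R"
    using scale_bounds[OF \<epsilon>, of q] by (simp_all add: R_def)
  have wk: "estimates \<alpha> \<epsilon> P n b' A" if "estimates \<alpha> \<epsilon> P n b A" "b \<le> b'" for \<alpha> b b' A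
    using that unfolding estimates_def by (meson order_trans)
  show ?thesis
  proof (cases "n < R ^ 8")
    case True
    have "n\<^sup>2 \<le> (R ^ 8)\<^sup>2" using True by (intro power_mono) auto
    also have "\<dots> = R ^ 16" by (simp add: power_mult[symmetric])
    also have "\<dots> \<le> R ^ 24" using R by (intro power_increasing) auto
    also have "\<dots> \<le> 2 ^ (R ^ 24)" using less_exp[of "R ^ 24"] by simp
    finally have "n\<^sup>2 \<le> 2 ^ (R ^ 24)" .
    then show ?thesis unfolding R_def[symmetric]
      by (intro exI[of _ "\<lambda>\<alpha>. return_pmf (query_list (pair_list {..<n})
        (\<lambda>E. if close_to (\<alpha> - \<epsilon>) P \<lparr>nverts = n, edges = E\<rparr> then Close else Far))"] allI)
        (rule wk[OF estimates_query_all[OF \<epsilon>(1)]])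
  next
    case False
    then have nR: "R ^ 8 \<le> n" by simp
    define k where "k = 2 * q + 4"
    define Q :: real where "Q = 2 ^ (q + 1)"
    define C where "C = 8 / \<epsilon>\<^sup>2"
    define B where "B = Q + C"
    define N where "N = R ^ 8"
    define m where "m = 16 * R ^ 20"
    define W where "W = 2 * (N * 2 ^ (m * k))\<^sup>2"
    define M where "M = 2304 * R\<^sup>2 * (W + 24)"
    define r where "r = real R"
    have r: "r \<ge> 60" using R by (simp add: r_def)
    have Qr: "Q \<le> r" using QR unfolding Q_def r_def by (metis of_nat_le_iff of_nat_numeral of_nat_power)
    have Q1: "1 \<le> Q" unfolding Q_def by (rule one_le_power) simp
    have kr: "real k \<le> r" using kR by (simp add: k_def r_def)
    have qr: "real q \<le> r" using kR by (simp add: r_def)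
    have nr: "r ^ 8 \<le> real n" using nR unfolding r_def by (metis of_nat_le_iff of_nat_power)
    have Cr: "C \<le> 8 * r\<^sup>2"
    proof -
      have "(1 / \<epsilon>)\<^sup>2 \<le> r\<^sup>2" using \<epsilon>R \<epsilon> unfolding r_def by (intro power_mono) auto
      then show ?thesis by (simp add: C_def power_divide)
    qed
    have B0: "B > 0" "B \<le> r ^ 3"
    proof -
      have "0 \<le> C" by (simp add: C_def)
      then show "B > 0" using Q1 by (simp add: B_def)
      have "r * 1 \<le> r * r" "9 * r\<^sup>2 \<le> r * r\<^sup>2" using r by (auto intro!: mult_mono mult_left_mono)
      then show "B \<le> r ^ 3" using Qr Cr by (simp add: B_def power2_eq_square power3_eq_cube)
    qed
    have k2: "real (k\<^sup>2) \<le> r\<^sup>2" using kr by (simp add: power_mono)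
    have e0: "Q * real (k\<^sup>2) / real n \<le> 1 / 60"
    proof -
      have "60 * (Q * real (k\<^sup>2)) \<le> r * (r * r\<^sup>2)" using r Qr Q1 k2 by (intro mult_mono) auto
      also have "\<dots> = r ^ 4" by (simp add: power_numeral_reduce)
      also have "\<dots> \<le> r ^ 8" using r by (intro power_increasing) auto
      finally show ?thesis using nr n by (simp add: divide_le_eq)
    qed
    have \<delta>1: "real (R ^ 7) * (1 / r ^ 3)\<^sup>2 > 1"
    proof -
      have "real (R ^ 7) * (1 / r ^ 3)\<^sup>2 = r" using r by (simp add: r_def power_divide power_numeral_reduce)
      then show ?thesis using r by simp
    qed
    have \<delta>2: "Q * (real q * (1 / r ^ 3)) \<le> 1 / 60"
    proof -
      have "60 * (Q * real q) \<le> r * (r * r)" using r Qr Q1 qr by (intro mult_mono) auto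
      then show ?thesis using r by (simp add: divide_le_eq power3_eq_cube)
    qed
    have N1: "2 * B * (real (k\<^sup>2) * (1 / real N + 1 / real n)) \<le> 1 / 60"
    proof -
      have rN: "real N = r ^ 8" by (simp add: N_def r_def)
      have "1 / real n \<le> 1 / r ^ 8" using nr r n by (intro divide_left_mono mult_pos_pos) auto
      then have "1 / real N + 1 / real n \<le> 2 / r ^ 8" unfolding rN by linarith
      then have "2 * B * (real (k\<^sup>2) * (1 / real N + 1 / real n)) \<le> 2 * r ^ 3 * (r\<^sup>2 * (2 / r ^ 8))"
        using B0 k2 r by (intro mult_mono) auto
      also have "\<dots> = 4 / r ^ 3" using r by (simp add: field_simps power_numeral_reduce)
      also have "\<dots> \<le> 1 / 60"
      proof -
        have "60 * (60 * 60) \<le> r * (r * r)" using r by (intro mult_mono) auto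
        then show ?thesis using r by (simp add: divide_le_eq power3_eq_cube)
      qed
      finally show ?thesis .
    qed
    have \<gamma>1: "2 * real k * (1 / r ^ 3) \<le> 1 / 60"
    proof -
      have "(2 * 60) * real k \<le> (r * r) * r" using r kr mult_mono[of 60 r 60 r] by (intro mult_mono) auto
      then show ?thesis using r by (simp add: divide_le_eq power3_eq_cube)
    qed
    have m1: "2 * real k * B * (real k * (4 ^ (R ^ 7) * (2 * exp (- (real m * (1 / r ^ 3)\<^sup>2 / (16 * B\<^sup>2)))))) \<le> 1 / 360"
      unfolding m_def r_def using kR B0 by (intro failure_bound R) (simp_all add: k_def r_def)
    have M1: "2 ^ (2 * (N * 2 ^ (m * k))\<^sup>2)
      * (2 * exp (- (real M * (1 / 12)\<^sup>2 / (16 * Q\<^sup>2))) + 2 * exp (- (real M * (\<epsilon> / 4)\<^sup>2 / (16 * 1\<^sup>2)))) \<le> 1 / 6"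
      unfolding M_def W_def[symmetric] using Q1 Qr \<epsilon> \<epsilon>R by (intro union_bound R) (simp_all add: r_def)
    have pos: "N > 0" "m > 0" "M > 0" "1 / r ^ 3 > 0" "4 \<le> k" "2 * q \<le> k"
      using R r by (simp_all add: N_def m_def M_def k_def)
    have qb: "(N * m * k + M * k)\<^sup>2 \<le> 2 ^ (R ^ 24)"
      unfolding M_def W_def N_def m_def using kR by (intro query_bound R) (simp add: k_def)
    show ?thesis
    proof (rule estimator_large_graphs[where P=P and q=q and n=n and k=k and N=N and m=m and M=M and L="R ^ 7"
          and \<epsilon>=\<epsilon> and \<gamma>="1 / r ^ 3" and \<delta>="1 / r ^ 3", OF P T \<epsilon>(1) n pos(5,6)
          e0[unfolded Q_def] pos(4) \<delta>1 \<delta>2[unfolded Q_def] pos(1) N1[unfolded B_def C_def Q_def] pos(4) \<gamma>1 pos(2)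
          m1[unfolded B_def C_def Q_def] pos(3) M1[unfolded Q_def]], goal_cases)
      case (1 A)
      have "estimates \<alpha> \<epsilon> P n ((N * m * k + M * k)\<^sup>2) (A \<alpha>)" for \<alpha>
        unfolding estimates_def using 1 by blast
      from wk[OF this qb] show ?case unfolding R_def[symmetric] by (intro exI[of _ A] allI)
    qed
  qed
qed

theorem theorem1p9:
  "\<exists>c::real. c \<ge> 1 \<and>
    (\<forall>(P :: sgraph set) (q :: real \<Rightarrow> nat).
      graph_property P \<longrightarrow>
      (\<forall>\<epsilon>\<in>{0<..<1}. \<exists>T. tester \<epsilon> P T \<and> makes_at_most_queries T (real (q \<epsilon>))) \<longrightarrow>
      (\<forall>\<epsilon>\<in>{0<..<1}. \<exists>A :: real \<Rightarrow> verdict algorithm. \<forall>\<alpha>.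
        makes_at_most_queries (A \<alpha>)
          (2 powr ((1 / \<epsilon>) powr c * 2 powr (real (q (\<epsilon> / 2)) powr c))) \<and>
        distinguishes \<alpha> \<epsilon> P (A \<alpha>)))"
proof (intro exI[of _ 216] conjI allI impI ballI)
  fix P :: "sgraph set" and q :: "real \<Rightarrow> nat" and \<epsilon> :: real
  assume P: "graph_property P"
    and T: "\<forall>\<epsilon>\<in>{0<..<1}. \<exists>T. tester \<epsilon> P T \<and> makes_at_most_queries T (real (q \<epsilon>))"
    and \<epsilon>: "\<epsilon> \<in> {0<..<1}"
  let ?b = "2 powr ((1 / \<epsilon>) powr 216 * 2 powr (real (q (\<epsilon> / 2)) powr 216))"
  show "\<exists>A :: real \<Rightarrow> verdict algorithm. \<forall>\<alpha>. makes_at_most_queries (A \<alpha>) ?b \<and> distinguishes \<alpha> \<epsilon> P (A \<alpha>)"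
  proof (cases "\<epsilon> < 1 / 2")
    case True
    obtain T' where T': "tester (\<epsilon> / 2) P T'" "makes_at_most_queries T' (real (q (\<epsilon> / 2)))"
      using T[rule_format, of "\<epsilon> / 2"] \<epsilon> by auto
    have "\<forall>n. \<exists>A. n \<ge> 1 \<longrightarrow> (\<forall>\<alpha>. estimates \<alpha> \<epsilon> P n (2 ^ (scale (q (\<epsilon> / 2)) \<epsilon> ^ 24)) (A \<alpha>))"
      using estimates_small_epsilon[OF P T' _ True] \<epsilon> by auto
    then obtain A where A: "\<And>n \<alpha>. n \<ge> 1 \<Longrightarrow> estimates \<alpha> \<epsilon> P n (2 ^ (scale (q (\<epsilon> / 2)) \<epsilon> ^ 24)) (A n \<alpha>)"
      by metis
    have b: "real (2 ^ (scale (q (\<epsilon> / 2)) \<epsilon> ^ 24)) \<le> ?b"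
      using scale_final_bound[of \<epsilon> "q (\<epsilon> / 2)"] \<epsilon> True by simp
    show ?thesis
      by (intro exI[of _ "\<lambda>\<alpha> n. A n \<alpha>"] allI algorithm_of_estimates[OF A b])
  next
    case False
    have "real 0 \<le> ?b" by simp
    from algorithm_of_estimates[OF estimates_large_epsilon[OF P] this] False show ?thesis
      by (intro exI[of _ "\<lambda>\<alpha> n. return_pmf (Output (if \<alpha> > \<epsilon> \<and> (\<exists>H\<in>P. nverts H = n) then Close else Far))"] allI) simp
  qed
qed simp

end
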